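(* Let $U$ be a nonempty open subset of $\mathbb{R}^d$, let $(\mathcal{A},H)$ be an optimal regular system in $U$, and let $\varphi$ be a positive nonincreasing continuous function on $[0,\infty)$. Let $F_\varphi=\{x\in\mathbb{R}^d:|x-a|<\varphi(H(a))\text{ for infinitely many }a\in\mathcal{A}\}$ and $I_\varphi=\int_0^\infty\eta^{d-1}\varphi(\eta)^d\,d\eta$. If $I_\varphi=\infty$, then $F_\varphi$ has full Lebesgue measure in $U$. If $I_\varphi<\infty$, then $F_\varphi$ is $\mathfrak{n}_\varphi$-describable in $U$, where $\mathfrak{n}_\varphi$ is the Borel measure on $(0,1]$ characterized by $\int_{(0,1]}f\,d\mathfrak{n}_\varphi=\int_0^\infty\eta^{d-1}f(\varphi(\eta))\,d\eta$ for every nonnegative measurable $f$ supported in $(0,1]$.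
   Context: Let $\mathcal{A}\subseteq\mathbb{R}^d$ be countably infinite and $H:\mathcal{A}\to(0,\infty)$. $(\mathcal{A},H)$ is admissible if for every integer $m\ge1$ the set $\{a\in\mathcal{A}:|a|<m,\ H(a)\le m\}$ is finite. It is a regular system in an open set $U$ if it is admissible and there is $\kappa>0$ such that for every open ball $B\subseteq U$ there is $h_B>0$ such that for all $h>h_B$ there is $\mathcal{A}_{B,h}\subseteq\mathcal{A}\cap B$ with $\#\mathcal{A}_{B,h}\ge\kappa(\mathrm{diam}\,B)^dh^d$, $H(a)\le h$ for $a\in\mathcal{A}_{B,h}$, and $|a-a'|\ge1/h$ for distinct $a,a'\in\mathcal{A}_{B,h}$. It is an optimal system in $U$ if it is admissible and for every open ball $B$ there are $\kappa'_B,h'_B>0$ with $\#\{a\in\mathcal{A}\cap U\cap B:H(a)\le h\}\le\kappa'_Bh^d$ for $h>h'_B$. An optimal regular system is one that is both. Fix $d\ge1$ and a norm $|\cdot|$ on $\mathbb{R}^d$ (diameters are taken with respect to it); $\mathcal{L}^d$ is Lebesgue measure. A gauge function is a function $g:[0,\infty]\to[0,\infty]$ that is nondecreasing on a neighbourhood of $0$ and satisfies $\lim_{r\to0}g(r)=g(0)=0$, $g(\infty)=\infty$; $\mathfrak{G}$ denotes the set of gauge functions. $\mathcal{H}^g$ is the Hausdorff $g$-measure: $\mathcal{H}^g(E)=\lim_{\delta\downarrow0}\inf\{\sum_ng(\mathrm{diam}\,C_n):E\subseteq\bigcup_nC_n,\ \mathrm{diam}\,C_n\le\delta\}$. The $d$-normalization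 of $g$ is $g_d(r)=r^d\inf_{0<\rho\le r}g(\rho)/\rho^d$ for $r\in(0,\infty)$, $g_d(0)=0$, $g_d(\infty)=\infty$; $g$ is $d$-normalized if $g=g_d$ on a neighbourhood of $0$. Let $\ell_g=\liminf_{r\to0}g(r)/r^d$, $\mathfrak{G}^\infty=\{g\in\mathfrak{G}:\ell_g=\infty\}$, $\mathfrak{G}^*=\{g\in\mathfrak{G}:\ell_g\in(0,\infty]\}$. For $d$-normalized gauge functions $g,h$ write $h\prec g$ if $h(r)/g(r)$ increases monotonically to $\infty$ as $r\downarrow0$ (with the convention that $h\prec g$ for every $h$ if $g$ vanishes on a neighbourhood of $0$). Dyadic cubes are the sets $2^{-j}(k+[0,1)^d)$, $j\in\mathbb{Z}$, $k\in\mathbb{Z}^d$. For a $d$-normalized gauge function $h$, let $\varepsilon_h$ be the supremum of those $\varepsilon>0$ such that $h$ is nondecreasing on $[0,\varepsilon]$ and $r\mapsto h(r)/r^d$ is nonincreasing on $(0,\varepsilon]$, and let $\mathcal{M}^h_\infty(E)=\inf\sum_nh(\mathrm{diam}\,\lambda_n)$, the infimum over all countable coverings of $E$ by dyadic cubes $\lambda_n$ of diameter less than $\varepsilon_h$. For a gauge function $g$ and a nonempty open set $U\subseteq\mathbb{R}^d$, the large intersection class $G^g(U)$ is the collection of $G_\delta$ subsets $F\subseteq\mathbb{R}^d$ such that $\mathcal{M}^h_\infty(F\cap V)=\mathcal{M}^h_\infty(V)$ for every $d$-normalized gauge function $h$ with $h\prec g_d$ and every open $V\subseteq U$. Let $\mathcal{Z}(U)$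 be the set of Borel sets $E$ with $\mathcal{L}^d(E\cap U)=0$; for such $E$, the majorizing collection is $\mathfrak{M}(E,U)=\{g\in\mathfrak{G}^\infty:\mathcal{H}^g(E\cap U)=0\}$ and the minorizing collection is $\mathfrak{m}(E,U)=\{g\in\mathfrak{G}^*:\exists F\in G^g(U),\ F\subseteq E\}$. Let $\mathcal{R}$ be the set of positive Borel measures $\mathfrak{n}$ on $(0,1]$ with infinite total mass and $\mathfrak{n}([\rho,1])<\infty$ for all $\rho\in(0,1]$, and $\mathcal{R}_d=\{\mathfrak{n}\in\mathcal{R}:\int_{(0,1]}r^d\,\mathfrak{n}(dr)<\infty\}$. For $\mathfrak{n}\in\mathcal{R}_d$, $\mathfrak{G}(\mathfrak{n})=\{g\in\mathfrak{G}^\infty:\int_{(0,1]}g_d\,d\mathfrak{n}=\infty\}$ and $\mathfrak{G}(\mathfrak{n})^\complement=\mathfrak{G}^\infty\setminus\mathfrak{G}(\mathfrak{n})$. A set $E$ is $\mathfrak{n}$-describable in $U$ if $E\in\mathcal{Z}(U)$, $\mathfrak{M}(E,U)=\mathfrak{G}(\mathfrak{n})^\complement$ and $\mathfrak{m}(E,U)\cap\mathfrak{G}^\infty=\mathfrak{G}(\mathfrak{n})$. For $\mathfrak{s}\in[0,d)$, $\mathfrak{G}(\mathfrak{s})$ is the set of $g\in\mathfrak{G}^\infty$ such that for every $s>\mathfrak{s}$, $g_d(r)$ is not $o(r^s)$ as $r\to0$; $E$ is $\mathfrak{s}$-describable in $U$ if $E\in\mathcal{Z}(U)$, $\mathfrak{M}(E,U)=\mathfrak{G}^\infty\setminus\mathfrak{G}(\mathfrak{s})$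 and $\mathfrak{m}(E,U)\cap\mathfrak{G}^\infty=\mathfrak{G}(\mathfrak{s})$. *)

theory Defs
  imports "HOL-Analysis.Analysis"
begin

definition is_norm :: "('a::euclidean_space \<Rightarrow> real) \<Rightarrow> bool" where
  "is_norm nrm \<longleftrightarrow> (\<forall>x. nrm x = 0 \<longleftrightarrow> x = 0) \<and> (\<forall>c x. nrm (c *\<^sub>R x) = \<bar>c\<bar> * nrm x)
     \<and> (\<forall>x y. nrm (x + y) \<le> nrm x + nrm y)"

definition nball :: "('a::euclidean_space \<Rightarrow> real) \<Rightarrow> 'a \<Rightarrow> real \<Rightarrow> 'a set" where
  "nball nrm c r = {x. nrm (x - c) < r}"

definition is_open_ball :: "('a::euclidean_space \<Rightarrow> real) \<Rightarrow> 'a set \<Rightarrow> bool" where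
  "is_open_ball nrm B \<longleftrightarrow> (\<exists>c r. r > 0 \<and> B = nball nrm c r)"

definition ediam :: "('a::euclidean_space \<Rightarrow> real) \<Rightarrow> 'a set \<Rightarrow> ennreal" where
  "ediam nrm S = (SUP x\<in>S. SUP y\<in>S. ennreal (nrm (x - y)))"

definition admissible :: "('a::euclidean_space \<Rightarrow> real) \<Rightarrow> 'a set \<Rightarrow> ('a \<Rightarrow> real) \<Rightarrow> bool" where
  "admissible nrm A H \<longleftrightarrow> countable A \<and> infinite A \<and> (\<forall>a\<in>A. H a > 0) \<and>
     (\<forall>m::nat. m \<ge> 1 \<longrightarrow> finite {a\<in>A. nrm a < real m \<and> H a \<le> real m})"

definition regular_system :: "('a::euclidean_space \<Rightarrow> real) \<Rightarrow> 'a set \<Rightarrow> ('a \<Rightarrow> real) \<Rightarrow> 'a set \<Rightarrow> bool" where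
  "regular_system nrm A H U \<longleftrightarrow> admissible nrm A H \<and>
     (\<exists>\<kappa>>0. \<forall>B. is_open_ball nrm B \<and> B \<subseteq> U \<longrightarrow>
        (\<exists>hB>0. \<forall>h>hB. \<exists>ABh. ABh \<subseteq> A \<inter> B \<and> finite ABh \<and>
            real (card ABh) \<ge> \<kappa> * (enn2real (ediam nrm B)) ^ DIM('a) * h ^ DIM('a) \<and>
            (\<forall>a\<in>ABh. H a \<le> h) \<and>
            (\<forall>a\<in>ABh. \<forall>a'\<in>ABh. a \<noteq> a' \<longrightarrow> nrm (a - a') \<ge> 1 / h)))"

definition optimal_system :: "('a::euclidean_space \<Rightarrow> real) \<Rightarrow> 'a set \<Rightarrow> ('a \<Rightarrow> real) \<Rightarrow> 'a set \<Rightarrow> bool" where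
  "optimal_system nrm A H U \<longleftrightarrow> admissible nrm A H \<and>
     (\<forall>B. is_open_ball nrm B \<longrightarrow> (\<exists>\<kappa>'>0. \<exists>h'>0. \<forall>h>h'.
         real (card {a\<in>A \<inter> U \<inter> B. H a \<le> h}) \<le> \<kappa>' * h ^ DIM('a)))"

definition optimal_regular_system :: "('a::euclidean_space \<Rightarrow> real) \<Rightarrow> 'a set \<Rightarrow> ('a \<Rightarrow> real) \<Rightarrow> 'a set \<Rightarrow> bool" where
  "optimal_regular_system nrm A H U \<longleftrightarrow> regular_system nrm A H U \<and> optimal_system nrm A H U"

definition gauge :: "(ennreal \<Rightarrow> ennreal) \<Rightarrow> bool" where
  "gauge g \<longleftrightarrow> (\<exists>\<epsilon>>0. mono_on {0..\<epsilon>} g) \<and> g 0 = 0 \<and> (g \<longlongrightarrow> 0) (at 0) \<and> g top = top"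

definition dnorm :: "nat \<Rightarrow> (ennreal \<Rightarrow> ennreal) \<Rightarrow> ennreal \<Rightarrow> ennreal" where
  "dnorm d g r = (if r = 0 then 0 else if r = top then top else
       r ^ d * (INF \<rho>\<in>{0<..r}. g \<rho> / \<rho> ^ d))"

definition d_normalized :: "nat \<Rightarrow> (ennreal \<Rightarrow> ennreal) \<Rightarrow> bool" where
  "d_normalized d g \<longleftrightarrow> (\<exists>\<epsilon>>0. \<forall>r<\<epsilon>. g r = dnorm d g r)"

definition ell :: "nat \<Rightarrow> (ennreal \<Rightarrow> ennreal) \<Rightarrow> ennreal" where
  "ell d g = Liminf (at_right (0::real)) (\<lambda>r. g (ennreal r) / ennreal r ^ d)"

definition Ginf :: "nat \<Rightarrow> (ennreal \<Rightarrow> ennreal) set" where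
  "Ginf d = {g. gauge g \<and> ell d g = top}"

definition Gstar :: "nat \<Rightarrow> (ennreal \<Rightarrow> ennreal) set" where
  "Gstar d = {g. gauge g \<and> ell d g > 0}"

definition gprec :: "(ennreal \<Rightarrow> ennreal) \<Rightarrow> (ennreal \<Rightarrow> ennreal) \<Rightarrow> bool" where
  "gprec h g \<longleftrightarrow> (\<exists>\<epsilon>>0. \<forall>r<\<epsilon>. g r = 0) \<or>
     ((\<exists>\<epsilon>>(0::real). \<forall>r s. 0 < r \<longrightarrow> r \<le> s \<longrightarrow> s < \<epsilon> \<longrightarrow>
          h (ennreal s) / g (ennreal s) \<le> h (ennreal r) / g (ennreal r)) \<and>
      ((\<lambda>r. h (ennreal r) / g (ennreal r)) \<longlongrightarrow> top) (at_right 0))"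

definition hausdorff_g :: "('a::euclidean_space \<Rightarrow> real) \<Rightarrow> (ennreal \<Rightarrow> ennreal) \<Rightarrow> 'a set \<Rightarrow> ennreal" where
  "hausdorff_g nrm g E = (SUP \<delta>\<in>{0::real<..}.
      INF C\<in>{C::nat \<Rightarrow> 'a set. E \<subseteq> (\<Union>n. C n) \<and> (\<forall>n. ediam nrm (C n) \<le> ennreal \<delta>)}.
        (\<Sum>n. g (ediam nrm (C n))))"

definition dyadic_cube :: "'a::euclidean_space set \<Rightarrow> bool" where
  "dyadic_cube Q \<longleftrightarrow> (\<exists>(j::int) (k::'a \<Rightarrow> int). Q =
      {x. \<forall>b\<in>Basis. 2 powr (- real_of_int j) * real_of_int (k b) \<le> x \<bullet> b \<and>
                    x \<bullet> b < 2 powr (- real_of_int j) * (real_of_int (k b) + 1)})"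

definition eps_h :: "nat \<Rightarrow> (ennreal \<Rightarrow> ennreal) \<Rightarrow> ennreal" where
  "eps_h d h = Sup {ennreal e | e. e > 0 \<and> mono_on {0..ennreal e} h \<and>
      (\<forall>r s. 0 < r \<longrightarrow> r \<le> s \<longrightarrow> s \<le> e \<longrightarrow>
          h (ennreal s) / ennreal s ^ d \<le> h (ennreal r) / ennreal r ^ d)}"

text \<open>Countable coverings are encoded as sequences, empty sets being allowed
  (they contribute h(0) = 0), so that finite coverings are included.\<close>
definition Minf :: "('a::euclidean_space \<Rightarrow> real) \<Rightarrow> (ennreal \<Rightarrow> ennreal) \<Rightarrow> 'a set \<Rightarrow> ennreal" where
  "Minf nrm h E = (INF C\<in>{C::nat \<Rightarrow> 'a set. E \<subseteq> (\<Union>n. C n) \<and>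
        (\<forall>n. C n = {} \<or> (dyadic_cube (C n) \<and> ediam nrm (C n) < eps_h DIM('a) h))}.
      (\<Sum>n. h (ediam nrm (C n))))"

definition large_int_class :: "('a::euclidean_space \<Rightarrow> real) \<Rightarrow> (ennreal \<Rightarrow> ennreal) \<Rightarrow> 'a set \<Rightarrow> 'a set set" where
  "large_int_class nrm g U = {F. gdelta_in euclidean F \<and>
      (\<forall>h V. gauge h \<and> d_normalized DIM('a) h \<and> gprec h (dnorm DIM('a) g) \<and> open V \<and> V \<subseteq> U \<longrightarrow>
         Minf nrm h (F \<inter> V) = Minf nrm h V)}"

definition nullsets_in :: "'a::euclidean_space set \<Rightarrow> 'a set set" where
  "nullsets_in U = {E. E \<in> sets borel \<and> emeasure lebesgue (E \<inter> U) = 0}"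

definition majorizing :: "('a::euclidean_space \<Rightarrow> real) \<Rightarrow> 'a set \<Rightarrow> 'a set \<Rightarrow> (ennreal \<Rightarrow> ennreal) set" where
  "majorizing nrm E U = {g \<in> Ginf DIM('a). hausdorff_g nrm g (E \<inter> U) = 0}"

definition minorizing :: "('a::euclidean_space \<Rightarrow> real) \<Rightarrow> 'a set \<Rightarrow> 'a set \<Rightarrow> (ennreal \<Rightarrow> ennreal) set" where
  "minorizing nrm E U = {g \<in> Gstar DIM('a). \<exists>F\<in>large_int_class nrm g U. F \<subseteq> E}"

text \<open>Measures on (0,1] are modelled as Borel measures on the reals concentrated on (0,1].\<close>
definition Rcal :: "real measure set" where
  "Rcal = {n. sets n = sets borel \<and> emeasure n (- {0<..1}) = 0 \<and>
      emeasure n {0<..1} = \<infinity> \<and> (\<forall>\<rho>\<in>{0<..1}. emeasure n {\<rho>..1} < \<infinity>)}"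

definition Rcal_d :: "nat \<Rightarrow> real measure set" where
  "Rcal_d d = {n \<in> Rcal. (\<integral>\<^sup>+ r\<in>{0<..1}. ennreal (r ^ d) \<partial>n) < \<infinity>}"

definition Gn :: "nat \<Rightarrow> real measure \<Rightarrow> (ennreal \<Rightarrow> ennreal) set" where
  "Gn d n = {g \<in> Ginf d. (\<integral>\<^sup>+ r\<in>{0<..1}. dnorm d g (ennreal r) \<partial>n) = \<infinity>}"

definition n_describable :: "('a::euclidean_space \<Rightarrow> real) \<Rightarrow> real measure \<Rightarrow> 'a set \<Rightarrow> 'a set \<Rightarrow> bool" where
  "n_describable nrm n E U \<longleftrightarrow> n \<in> Rcal_d DIM('a) \<and> E \<in> nullsets_in U \<and>
     majorizing nrm E U = Ginf DIM('a) - Gn DIM('a) n \<and>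
     minorizing nrm E U \<inter> Ginf DIM('a) = Gn DIM('a) n"

end

theory Submission
  imports Defs
begin

text \<open>Everything rests on a one-step mass estimate. For a normalized gauge \<open>g\<close> with
  \<open>\<integral> \<eta>^(d-1) g(\<phi>(\<eta>)) d\<eta> = \<infinity>\<close>, a greedy choice of separated points \<open>a\<close> in a cube \<open>Q\<close>, with weights
  proportional to \<open>g(\<phi>(H a))\<close>, gives finitely many disjoint dyadic cubes, each inside a ball
  \<open>B(a, \<phi>(H a))\<close>, such that every family of dyadic subcubes of \<open>Q\<close> dominating them has \<open>g\<close>-mass at least
  \<open>c g(diam Q)\<close>. Damping \<open>g\<close> slightly improves \<open>c\<close> to \<open>1\<close>, and then the estimate can be iterated without loss
  along a tree of cubes whose branches converge to points of the limsup set. This gives the equality of net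
  contents that defines the large intersection classes. With \<open>g(r) = r^d\<close> the one-step estimate alone gives
  full measure.
  In the convergent case, optimality bounds the natural covers by balls, and a slightly larger gauge that
  still converges shows that no large intersection set with gauge \<open>g\<close> fits inside.\<close>


section \<open>Norms on a Euclidean space\<close>

text \<open>A loss factor c < 1 in the one-step estimate would be fatal: the tree is infinitely
  deep, and n steps would leave c^n. The damped gauge g' keeps a divergent series while g/g' tends
  to infinity at 0, so on small enough cubes the loss is absorbed by the factor between g and g'.
  This needs g(r)/r^d unbounded at 0, which fails for r^d itself; hence full measure has to be won
  from the lossy estimate alone. The class tests every h that precedes g_d. Such an h dominates g_d
  near 0, so its own series diverges and the argument is run for h. It works for h = g_d too,
  although g_d does not precede itself; the positive net content found in this way is what excludes
  a null Hausdorff measure, so majorizing and minorizing gauges are separated by one and the same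
  series. If the series of g converges, a boosted h precedes g_d and still converges: natural covers
  then make the net content of the limsup set zero, where membership in the class would force it to
  be that of U. Gauges are arbitrary away from 0, so all estimates are made for real functions on
  some (0, \<epsilon>].\<close>

locale euclidean_norm =
  fixes nrm :: "'a::euclidean_space \<Rightarrow> real"
  assumes is_norm: "is_norm nrm"
begin

lemma nrm_0 [simp]: "nrm 0 = 0"
  and nrm_eq_0_iff: "nrm x = 0 \<longleftrightarrow> x = 0"
  and nrm_scaleR: "nrm (c *\<^sub>R x) = \<bar>c\<bar> * nrm x"
  and nrm_add_le: "nrm (x + y) \<le> nrm x + nrm y"
  using is_norm unfolding is_norm_def by auto

lemma nrm_uminus [simp]: "nrm (- x) = nrm x"
  using nrm_scaleR[of "-1" x] by simp

lemma nrm_minus_commute: "nrm (x - y) = nrm (y - x)"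
  using nrm_uminus[of "x - y"] by simp

lemma nrm_ge_0 [simp]: "0 \<le> nrm x"
  using nrm_add_le[of x "- x"] by simp

lemma nrm_diff_triangle: "nrm (x - z) \<le> nrm (x - y) + nrm (y - z)"
  using nrm_add_le[of "x - y" "y - z"] by simp

lemma nrm_sum_le: "nrm (sum f S) \<le> (\<Sum>i\<in>S. nrm (f i))"
proof (induction S rule: infinite_finite_induct)
  case (insert x F)
  then show ?case using nrm_add_le[of "f x" "sum f F"] by simp
qed auto

lemma nrm_le_sum_coords: "nrm x \<le> (\<Sum>b\<in>Basis. \<bar>x \<bullet> b\<bar> * nrm b)"
proof -
  have "nrm x = nrm (\<Sum>b\<in>Basis. (x \<bullet> b) *\<^sub>R b)"
    by (simp add: euclidean_representation)
  also have "\<dots> \<le> (\<Sum>b\<in>Basis. \<bar>x \<bullet> b\<bar> * nrm b)"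
    by (rule order.trans[OF nrm_sum_le]) (simp add: nrm_scaleR)
  finally show ?thesis .
qed

lemma nrm_le_norm: obtains C where "C > 0" "\<And>x. nrm x \<le> C * norm x"
proof
  show "(1 + (\<Sum>b\<in>(Basis::'a set). nrm b)) > 0"
    by (simp add: add_pos_nonneg sum_nonneg)
  fix x
  have "nrm x \<le> (\<Sum>b\<in>Basis. \<bar>x \<bullet> b\<bar> * nrm b)"
    by (rule nrm_le_sum_coords)
  also have "\<dots> \<le> (\<Sum>b\<in>(Basis::'a set). norm x * nrm b)"
    by (intro sum_mono mult_right_mono) (auto simp: Basis_le_norm)
  also have "\<dots> = norm x * (\<Sum>b\<in>(Basis::'a set). nrm b)"
    by (simp add: sum_distrib_left)
  also have "\<dots> \<le> (1 + (\<Sum>b\<in>(Basis::'a set). nrm b)) * norm x"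
    by (simp add: algebra_simps)
  finally show "nrm x \<le> (1 + (\<Sum>b\<in>(Basis::'a set). nrm b)) * norm x" .
qed

lemma continuous_on_nrm: "continuous_on S nrm"
proof -
  obtain C where C: "C > 0" "\<And>x. nrm x \<le> C * norm x" by (rule nrm_le_norm) auto
  have "\<bar>nrm x - nrm y\<bar> \<le> nrm (x - y)" for x y
    using nrm_diff_triangle[of x 0 y] nrm_diff_triangle[of y 0 x] nrm_minus_commute[of x y] by auto
  then have "dist (nrm x) (nrm y) \<le> C * dist x y" for x y
    unfolding dist_real_def dist_norm using C(2)[of "x - y"] order.trans by blast
  then have "C-lipschitz_on S nrm"
    using C(1) by (auto simp: lipschitz_on_def)
  then show ?thesis by (rule lipschitz_on_continuous_on)
qed

lemma norm_le_nrm: obtains c where "c > 0" "\<And>x. norm x \<le> c * nrm x"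
proof -
  have "compact (sphere (0::'a) 1)" "sphere (0::'a) 1 \<noteq> {}" by auto
  from continuous_attains_inf[OF this continuous_on_nrm]
  obtain x0 where x0: "x0 \<in> sphere (0::'a) 1" "\<And>y. y \<in> sphere 0 1 \<Longrightarrow> nrm x0 \<le> nrm y" by blast
  then have "x0 \<noteq> 0" by auto
  then have p: "nrm x0 > 0" using nrm_eq_0_iff[of x0] nrm_ge_0[of x0] by linarith
  show ?thesis
  proof
    show "1 / nrm x0 > 0" using p by simp
    fix x
    show "norm x \<le> 1 / nrm x0 * nrm x"
    proof (cases "x = 0")
      case False
      then have "nrm x0 \<le> nrm ((1 / norm x) *\<^sub>R x)" by (intro x0(2)) simp
      also have "\<dots> = nrm x / norm x" by (simp add: nrm_scaleR)
      finally show ?thesis using p False by (simp add: field_simps)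
    qed simp
  qed
qed

lemma open_nball [simp]: "open (nball nrm c r)"
proof -
  have "nball nrm c r = {x. nrm (x - c) < r}" by (simp add: nball_def)
  moreover have "open {x. nrm (x - c) < r}"
    by (intro open_Collect_less continuous_intros continuous_on_compose2[OF continuous_on_nrm[of UNIV]]) auto
  ultimately show ?thesis by simp
qed

lemma closed_nball: "closed {x. nrm (x - c) \<le> r}"
  by (intro closed_Collect_le continuous_intros continuous_on_compose2[OF continuous_on_nrm[of UNIV]]) auto

lemma nball_measurable [measurable, simp]: "nball nrm c r \<in> sets borel"
  by simp

lemma mem_nball: "x \<in> nball nrm c r \<longleftrightarrow> nrm (x - c) < r"
  by (simp add: nball_def)

lemma bounded_nball: "bounded (nball nrm c r)"
proof -
  obtain k where k: "k > 0" "\<And>x. norm x \<le> k * nrm x" by (rule norm_le_nrm) auto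
  have "nball nrm c r \<subseteq> cball c (k * r)"
  proof
    fix x assume "x \<in> nball nrm c r"
    then have "k * nrm (x - c) \<le> k * r" using k(1) by (simp add: mem_nball)
    then show "x \<in> cball c (k * r)" using k(2)[of "x - c"] by (simp add: dist_norm norm_minus_commute)
  qed
  then show ?thesis using bounded_cball bounded_subset by blast
qed

lemma openE_nball:
  assumes "open W" "x \<in> W" obtains e where "e > 0" "nball nrm x e \<subseteq> W"
proof -
  obtain k where k: "k > 0" "\<And>x. norm x \<le> k * nrm x" by (rule norm_le_nrm) auto
  obtain e where e: "e > 0" "ball x e \<subseteq> W" using assms open_contains_ball by blast
  have "nball nrm x (e / k) \<subseteq> ball x e"
  proof
    fix y assume "y \<in> nball nrm x (e / k)"
    then have "k * nrm (y - x) < e" using k(1) by (simp add: mem_nball field_simps)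
    then show "y \<in> ball x e" using k(2)[of "y - x"] by (simp add: dist_norm norm_minus_commute)
  qed
  then show ?thesis using e k that[of "e / k"] by auto
qed

section \<open>Volumes of balls and packing\<close>

definition uvol :: real where "uvol = measure lebesgue (nball nrm 0 1)"

lemma emeasure_nball:
  assumes "0 \<le> r" shows "emeasure lebesgue (nball nrm c r) = ennreal (uvol * r ^ DIM('a))"
proof (cases "r = 0")
  case True
  moreover have "\<not> nrm (x - c) < 0" for x by (simp add: not_less)
  ultimately have "nball nrm c r = {}" by (auto simp: mem_nball)
  then show ?thesis using True by (simp add: zero_power)
next
  case False
  have e: "nball nrm c r = (\<lambda>x. r *\<^sub>R x + c) ` nball nrm 0 1"
  proof (safe, goal_cases)
    case (1 x)
    show ?case
    proof (rule image_eqI)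
      show "x = r *\<^sub>R ((1/r) *\<^sub>R (x - c)) + c" using False by simp
      show "(1/r) *\<^sub>R (x - c) \<in> nball nrm 0 1"
        using 1 assms False nrm_scaleR[of "1/r" "x - c"] by (simp add: mem_nball)
    qed
  next
    case (2 _ y)
    then show ?case using assms False by (simp add: mem_nball nrm_scaleR)
  qed
  have "emeasure lebesgue (nball nrm 0 1) < \<infinity>"
    using emeasure_bounded_finite[OF bounded_nball[of 0 1]] by simp
  then have "emeasure lebesgue (nball nrm 0 1) = ennreal uvol"
    unfolding uvol_def by (simp add: emeasure_eq_ennreal_measure)
  then show ?thesis unfolding e using assms
    by (subst emeasure_lebesgue_affine)
      (auto simp: ennreal_power ennreal_mult' mult.commute uvol_def)
qed

lemma uvol_pos: "uvol > 0"
proof -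
  obtain e where "e > 0" "ball 0 e \<subseteq> nball nrm 0 1"
    using open_nball[of 0 1] open_contains_ball[of "nball nrm 0 1"] mem_nball[of 0 0 1] by fastforce
  then have "emeasure lebesgue (ball (0::'a) e) \<le> emeasure lebesgue (nball nrm 0 1)"
    by (intro emeasure_mono) auto
  moreover have "emeasure lebesgue (ball (0::'a) e) > 0"
    using \<open>e > 0\<close> by (simp add: emeasure_ball unit_ball_vol_pos)
  ultimately have "ennreal (uvol * 1 ^ DIM('a)) > 0" by (subst emeasure_nball[symmetric, of 1 0]) auto
  then show ?thesis by simp
qed

text \<open>The balls of radius \<open>\<rho> i / 2\<close> about the points are disjoint, since the
  mean of two radii is at most their maximum, and they all lie in the ball of radius R + R'/2;
  compare volumes. Radii may vary from point to point, as is required for points selected at several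
  levels.\<close>

lemma packing:
  assumes fin: "finite S" and inj: "inj_on p S"
    and sep: "\<And>i j. i \<in> S \<Longrightarrow> j \<in> S \<Longrightarrow> i \<noteq> j \<Longrightarrow> max (\<rho> i) (\<rho> j) \<le> nrm (p i - p j)"
    and \<rho>: "\<And>i. i \<in> S \<Longrightarrow> 0 < \<rho> i" "\<And>i. i \<in> S \<Longrightarrow> \<rho> i \<le> R'"
    and near: "\<And>i. i \<in> S \<Longrightarrow> nrm (p i - x) \<le> R" and nonneg: "0 \<le> 2 * R + R'"
  shows "(\<Sum>i\<in>S. \<rho> i ^ DIM('a)) \<le> (2 * R + R') ^ DIM('a)"
proof (cases "S = {}")
  case False
  then obtain i0 where i0: "i0 \<in> S" by auto
  have R: "0 \<le> R" "0 < R'" using near[OF i0] nrm_ge_0[of "p i0 - x"] \<rho>[OF i0] by linarith+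
  let ?B = "\<lambda>i. nball nrm (p i) (\<rho> i / 2)"
  have disj: "disjoint_family_on ?B S"
    unfolding disjoint_family_on_def
  proof (intro ballI impI)
    fix i j assume ij: "i \<in> S" "j \<in> S" "i \<noteq> j"
    { fix y assume "y \<in> ?B i" "y \<in> ?B j"
      then have "nrm (p i - p j) < \<rho> i / 2 + \<rho> j / 2"
        using nrm_diff_triangle[of "p i" "p j" y] nrm_minus_commute[of y "p i"] by (simp add: mem_nball)
      also have "\<dots> \<le> max (\<rho> i) (\<rho> j)" by linarith
      finally have False using sep[OF ij] by linarith }
    then show "?B i \<inter> ?B j = {}" by blast
  qed
  have sub: "(\<Union>i\<in>S. ?B i) \<subseteq> nball nrm x (R + R' / 2)"
  proof safe
    fix i y assume i: "i \<in> S" "y \<in> ?B i"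
    then show "y \<in> nball nrm x (R + R' / 2)"
      using nrm_diff_triangle[of y x "p i"] near[OF i(1)] \<rho>(2)[OF i(1)] by (simp add: mem_nball)
  qed
  have "ennreal (\<Sum>i\<in>S. uvol * (\<rho> i / 2) ^ DIM('a)) = (\<Sum>i\<in>S. emeasure lebesgue (?B i))"
    using \<rho>(1) uvol_pos by (subst sum_ennreal[symmetric])
      (auto intro!: sum.cong simp: emeasure_nball[simplified] less_imp_le)
  also have "\<dots> = emeasure lebesgue (\<Union>i\<in>S. ?B i)"
    using disj fin by (intro sum_emeasure) auto
  also have "\<dots> \<le> emeasure lebesgue (nball nrm x (R + R' / 2))"
    by (rule emeasure_mono[OF sub]) auto
  also have "\<dots> = ennreal (uvol * (R + R' / 2) ^ DIM('a))"
    using R by (intro emeasure_nball) auto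
  finally have "(\<Sum>i\<in>S. uvol * (\<rho> i / 2) ^ DIM('a)) \<le> uvol * (R + R' / 2) ^ DIM('a)"
    using R uvol_pos by (subst (asm) ennreal_le_iff) auto
  then have "uvol * (\<Sum>i\<in>S. (\<rho> i / 2) ^ DIM('a)) \<le> uvol * (R + R' / 2) ^ DIM('a)"
    by (simp add: sum_distrib_left)
  then have "(\<Sum>i\<in>S. (\<rho> i / 2) ^ DIM('a)) \<le> (R + R' / 2) ^ DIM('a)"
    using uvol_pos by simp
  then have "2 ^ DIM('a) * (\<Sum>i\<in>S. (\<rho> i / 2) ^ DIM('a)) \<le> 2 ^ DIM('a) * (R + R' / 2) ^ DIM('a)"
    by simp
  then show ?thesis
    by (simp add: sum_distrib_left power_mult_distrib[symmetric] algebra_simps)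
\<comment> \<open>For empty S there is no point to make the right-hand side nonnegative;
  \<open>nonneg\<close> does it.\<close>
qed (use assms in \<open>auto simp: le_less power_mult_distrib\<close>)

lemma packing_count:
  assumes fin: "finite S" and s: "0 < s" and "0 \<le> R"
    and sep: "\<And>a b. a \<in> S \<Longrightarrow> b \<in> S \<Longrightarrow> a \<noteq> b \<Longrightarrow> s \<le> nrm (a - b)"
    and near: "\<And>a. a \<in> S \<Longrightarrow> nrm (a - x) \<le> R"
  shows "real (card S) * s ^ DIM('a) \<le> (2 * R + s) ^ DIM('a)"
  using packing[OF fin, of "\<lambda>a. a" "\<lambda>_. s" s x R] assms by simp

lemma ediam_le:
  assumes "\<And>x y. x \<in> S \<Longrightarrow> y \<in> S \<Longrightarrow> nrm (x - y) \<le> r"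
  shows "ediam nrm S \<le> ennreal r"
  unfolding ediam_def by (intro SUP_least ennreal_leI assms)

lemma nrm_le_ediam:
  assumes "x \<in> S" "y \<in> S" shows "ennreal (nrm (x - y)) \<le> ediam nrm S"
  unfolding ediam_def using assms by (meson SUP_upper2 order_refl)

lemma ediam_mono: "S \<subseteq> T \<Longrightarrow> ediam nrm S \<le> ediam nrm T"
  unfolding ediam_def by (intro SUP_subset_mono) auto

lemma ediam_empty [simp]: "ediam nrm {} = 0"
  by (simp add: ediam_def bot_ennreal)

text \<open>The lower bound r/2 is deliberately crude: one explicit point at that distance from the
  centre proves it, and the lost factor only changes the constant in
  \<open>regular_ball\<close>.\<close>

lemma ediam_nball:
  assumes "0 < r"
  shows "ediam nrm (nball nrm c r) \<le> ennreal (2 * r)" "ennreal (r / 2) \<le> ediam nrm (nball nrm c r)"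
proof -
  show "ediam nrm (nball nrm c r) \<le> ennreal (2 * r)"
  proof (rule ediam_le)
    fix x y assume "x \<in> nball nrm c r" "y \<in> nball nrm c r"
    then show "nrm (x - y) \<le> 2 * r"
      using nrm_diff_triangle[of x y c] nrm_minus_commute[of y c] by (simp add: mem_nball)
  qed
  obtain b :: 'a where b: "b \<in> Basis" using nonempty_Basis by blast
  then have nb: "nrm b \<noteq> 0" using nonzero_Basis nrm_eq_0_iff by blast
  define y where "y = c + (r / 2 / nrm b) *\<^sub>R b"
  have y: "nrm (y - c) = r / 2" using nb assms by (simp add: y_def nrm_scaleR)
  show "ennreal (r / 2) \<le> ediam nrm (nball nrm c r)"
    using nrm_le_ediam[of y "nball nrm c r" c] y assms by (simp add: mem_nball)
qed

end

section \<open>Dyadic cubes\<close>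

text \<open>A cube is named by its generation j and any one of its points, so that two cubes of one
  generation coincide as soon as they meet.\<close>

definition cub :: "int \<Rightarrow> 'a::euclidean_space \<Rightarrow> 'a set" where
  "cub j x = {y. \<forall>b\<in>Basis. \<lfloor>2 powr j * (y \<bullet> b)\<rfloor> = \<lfloor>2 powr j * (x \<bullet> b)\<rfloor>}"

lemma mem_cub_self [simp]: "x \<in> cub j x"
  by (simp add: cub_def)

lemma cub_eqI: "y \<in> cub j x \<Longrightarrow> cub j y = cub j x"
  by (auto simp: cub_def)

lemma cub_eq_if_meet: "z \<in> cub j x \<Longrightarrow> z \<in> cub j y \<Longrightarrow> cub j x = cub j y"
  using cub_eqI by blast

lemma cub_antimono:
  assumes "i \<le> j" shows "cub j x \<subseteq> cub i (x :: 'a::euclidean_space)"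
proof -
  \<comment> \<open>The index of the coarser cube is an integer quotient of the finer index, so
    equal fine indices force equal coarse ones.\<close>
  have e: "\<lfloor>2 powr i * t\<rfloor> = \<lfloor>2 powr j * t\<rfloor> div (2 ^ nat (j - i))" for t :: real
  proof -
    have "2 powr real_of_int j = 2 powr (real_of_int i + real (nat (j - i)))"
      using assms by simp
    also have "\<dots> = 2 powr i * 2 ^ nat (j - i)"
      by (simp add: powr_add powr_realpow)
    finally have "2 powr i * t = (2 powr j * t) / real_of_int (2 ^ nat (j - i))" by simp
    then show ?thesis using floor_divide_real_eq_div[of "2 ^ nat (j - i)" "2 powr j * t"] by simp
  qed
  show ?thesis unfolding cub_def e by auto
qed

lemma mem_cub_iff:
  "y \<in> cub j x \<longleftrightarrow> (\<forall>b\<in>Basis. 2 powr (- real_of_int j) * real_of_int \<lfloor>2 powr j * (x \<bullet> b)\<rfloor> \<le> y \<bullet> b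
     \<and> y \<bullet> b < 2 powr (- real_of_int j) * (real_of_int \<lfloor>2 powr j * (x \<bullet> b)\<rfloor> + 1))"
proof -
  have "\<lfloor>2 powr j * t\<rfloor> = k \<longleftrightarrow> 2 powr (- real_of_int j) * real_of_int k \<le> t
     \<and> t < 2 powr (- real_of_int j) * (real_of_int k + 1)" for k t
    unfolding floor_eq_iff powr_minus by (simp add: field_simps)
  then show ?thesis unfolding cub_def by simp
qed

lemma dyadic_cube_cub [simp]: "dyadic_cube (cub j x)"
  unfolding dyadic_cube_def
  by (intro exI[of _ j] exI[of _ "\<lambda>b. \<lfloor>2 powr j * (x \<bullet> b)\<rfloor>"]) (auto simp: mem_cub_iff)

lemma dyadic_cubeE:
  assumes "dyadic_cube Q" obtains j x where "Q = cub j (x :: 'a::euclidean_space)"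
proof -
  obtain j :: int and k :: "'a \<Rightarrow> int" where Q: "Q = {x. \<forall>b\<in>Basis. 2 powr (- real_of_int j) * real_of_int (k b) \<le> x \<bullet> b \<and>
                    x \<bullet> b < 2 powr (- real_of_int j) * (real_of_int (k b) + 1)}"
    using assms unfolding dyadic_cube_def by auto
  define x where "x = (\<Sum>b\<in>Basis. (2 powr (- real_of_int j) * real_of_int (k b)) *\<^sub>R b)"
  have "x \<bullet> b = 2 powr (- real_of_int j) * real_of_int (k b)" if "b \<in> Basis" for b
    unfolding x_def using that by simp
  then have "\<lfloor>2 powr j * (x \<bullet> b)\<rfloor> = k b" if "b \<in> Basis" for b
    using that by (simp add: powr_minus field_simps)
  then have "Q = cub j x" unfolding Q by (auto simp: mem_cub_iff)
  then show ?thesis using that by blast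
qed

lemma dyadic_cube_nonempty: "dyadic_cube Q \<Longrightarrow> Q \<noteq> {}"
  by (metis dyadic_cubeE empty_iff mem_cub_self)

lemma cub_meet_subset: "i \<le> j \<Longrightarrow> cub i x \<inter> cub j y \<noteq> {} \<Longrightarrow> cub j y \<subseteq> cub i x"
  using cub_antimono cub_eqI by blast

lemma dyadic_cubes_nested:
  assumes "dyadic_cube P" "dyadic_cube Q" "P \<inter> Q \<noteq> {}" shows "P \<subseteq> Q \<or> Q \<subseteq> P"
  using assms by (metis cub_meet_subset dyadic_cubeE inf_commute linear)

lemma cub_borel [measurable, simp]: "cub j (x :: 'a::euclidean_space) \<in> sets borel"
proof -
  have "cub j x = (\<Inter>b\<in>Basis. {y. 2 powr (- real_of_int j) * real_of_int \<lfloor>2 powr j * (x \<bullet> b)\<rfloor> \<le> y \<bullet> b} \<inter>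
     {y. y \<bullet> b < 2 powr (- real_of_int j) * (real_of_int \<lfloor>2 powr j * (x \<bullet> b)\<rfloor> + 1)})"
    by (auto simp: mem_cub_iff)
  also have "\<dots> \<in> sets borel"
    by (intro sets.finite_INT sets.Int) (auto intro!: borel_closed borel_open closed_Collect_le open_Collect_less continuous_intros)
  finally show ?thesis .
qed

lemma dyadic_cube_borel: "dyadic_cube Q \<Longrightarrow> Q \<in> sets borel"
  by (metis cub_borel dyadic_cubeE)

text \<open>Reduces every cube to the unit cube: volume and diameter in an arbitrary norm are
  computed once and then scaled.\<close>

lemma cub_scale:
  "\<exists>c. cub j x = (\<lambda>y. 2 powr (- real_of_int j) *\<^sub>R y + c) ` cub 0 (0 :: 'a::euclidean_space)"
proof -
  let ?s = "2 powr (- real_of_int j)"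
  let ?k = "\<lambda>b. real_of_int \<lfloor>2 powr j * (x \<bullet> b)\<rfloor>"
  define c where "c = (\<Sum>b\<in>Basis. (?s * ?k b) *\<^sub>R b)"
  have c: "c \<bullet> b = ?s * ?k b" if "b \<in> Basis" for b unfolding c_def using that by simp
  have "cub j x = (\<lambda>y. ?s *\<^sub>R y + c) ` cub 0 0"
  proof (safe, goal_cases)
    case (1 y)
    show ?case
    proof (rule image_eqI)
      show "y = ?s *\<^sub>R ((1 / ?s) *\<^sub>R (y - c)) + c" by simp
      show "(1 / ?s) *\<^sub>R (y - c) \<in> cub 0 0"
        using 1 by (auto simp: mem_cub_iff inner_diff_left c field_simps)
    qed
  next
    case (2 _ y)
    then show ?case by (auto simp: mem_cub_iff inner_add_left c field_simps)
  qed
  then show ?thesis by blast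
qed

lemma cub_0: "cub 0 0 = {y :: 'a::euclidean_space. \<forall>b\<in>Basis. 0 \<le> y \<bullet> b \<and> y \<bullet> b < 1}"
  by (auto simp: mem_cub_iff)

lemma emeasure_cub:
  "emeasure lborel (cub j (x :: 'a::euclidean_space)) = ennreal ((2 powr (- real_of_int j)) ^ DIM('a))"
proof -
  \<comment> \<open>The half-open unit cube is squeezed between an open and a closed box, both of
    volume 1.\<close>
  have "box 0 One \<subseteq> cub 0 (0::'a)" "cub 0 (0::'a) \<subseteq> cbox 0 One"
    by (auto simp: cub_0 mem_box less_imp_le)
  then have "emeasure lborel (box 0 (One::'a)) \<le> emeasure lborel (cub 0 (0::'a))"
     "emeasure lborel (cub 0 (0::'a)) \<le> emeasure lborel (cbox 0 (One::'a))"
    by (intro emeasure_mono; simp)+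
  then have u: "emeasure lborel (cub 0 (0::'a)) = 1"
    by (auto simp: emeasure_lborel_box_eq emeasure_lborel_cbox_eq)
  obtain c where "cub j x = (\<lambda>y. 2 powr (- real_of_int j) *\<^sub>R y + c) ` cub 0 (0::'a)"
    using cub_scale by blast
  then have "emeasure lebesgue (cub j x) = \<bar>2 powr (- real_of_int j)\<bar> ^ DIM('a) * emeasure lebesgue (cub 0 (0::'a))"
    using emeasure_lebesgue_affine[of "2 powr (- real_of_int j)" c "cub 0 (0::'a)"] by simp
  then show ?thesis using u by (simp add: ennreal_power)
qed

lemma countable_dyadic_cubes: "countable {Q :: 'a::euclidean_space set. dyadic_cube Q}"
proof -
  have "{Q :: 'a set. dyadic_cube Q} \<subseteq> (\<Union>j::int. (\<lambda>k. {x. \<forall>b\<in>Basis. 2 powr (- real_of_int j) * real_of_int (k b) \<le> x \<bullet> b \<and>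
                    x \<bullet> b < 2 powr (- real_of_int j) * (real_of_int (k b) + 1)}) ` (Basis \<rightarrow>\<^sub>E (UNIV::int set)))"
  proof
    fix Q :: "'a set" assume "Q \<in> {Q. dyadic_cube Q}"
    then obtain j :: int and k :: "'a \<Rightarrow> int" where Q: "Q = {x. \<forall>b\<in>Basis. 2 powr (- real_of_int j) * real_of_int (k b) \<le> x \<bullet> b \<and>
                    x \<bullet> b < 2 powr (- real_of_int j) * (real_of_int (k b) + 1)}"
      unfolding dyadic_cube_def by auto
    \<comment> \<open>Off \<open>Basis\<close> the index function is arbitrary; restricting it lands
      in a countable set of functions.\<close>
    then have "Q = {x. \<forall>b\<in>Basis. 2 powr (- real_of_int j) * real_of_int (restrict k Basis b) \<le> x \<bullet> b \<and>
                    x \<bullet> b < 2 powr (- real_of_int j) * (real_of_int (restrict k Basis b) + 1)}"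
      by auto
    moreover have "restrict k Basis \<in> Basis \<rightarrow>\<^sub>E UNIV" by auto
    ultimately show "Q \<in> (\<Union>j::int. (\<lambda>k. {x. \<forall>b\<in>Basis. 2 powr (- real_of_int j) * real_of_int (k b) \<le> x \<bullet> b \<and>
                    x \<bullet> b < 2 powr (- real_of_int j) * (real_of_int (k b) + 1)}) ` (Basis \<rightarrow>\<^sub>E (UNIV::int set)))" by blast
  qed
  moreover have "countable (\<Union>j::int. (\<lambda>k. {x::'a. \<forall>b\<in>Basis. 2 powr (- real_of_int j) * real_of_int (k b) \<le> x \<bullet> b \<and>
                    x \<bullet> b < 2 powr (- real_of_int j) * (real_of_int (k b) + 1)}) ` (Basis \<rightarrow>\<^sub>E (UNIV::int set)))"
    by (intro countable_UN countable_image countable_PiE) auto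
  ultimately show ?thesis by (rule countable_subset)
qed

section \<open>Diameter and volume of dyadic cubes in the given norm\<close>

context euclidean_norm begin

definition dm :: "'a set \<Rightarrow> real" where "dm Q = enn2real (ediam nrm Q)"

definition udiam :: real where "udiam = dm (cub 0 0)"

lemma ediam_cub_0: "ediam nrm (cub 0 0) = ennreal udiam" and udiam_pos: "udiam > 0"
proof -
  have "ediam nrm (cub 0 (0::'a)) \<le> ennreal (\<Sum>b\<in>(Basis::'a set). nrm b)"
  proof (rule ediam_le)
    fix x y :: 'a assume xy: "x \<in> cub 0 0" "y \<in> cub 0 0"
    have "nrm (x - y) \<le> (\<Sum>b\<in>Basis. \<bar>(x - y) \<bullet> b\<bar> * nrm b)" by (rule nrm_le_sum_coords)
    also have "\<dots> \<le> (\<Sum>b\<in>(Basis::'a set). 1 * nrm b)"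
    proof (intro sum_mono mult_right_mono)
      fix b :: 'a assume "b \<in> Basis"
      then have "0 \<le> x \<bullet> b" "x \<bullet> b < 1" "0 \<le> y \<bullet> b" "y \<bullet> b < 1" using xy by (auto simp: cub_0)
      then show "\<bar>(x - y) \<bullet> b\<bar> \<le> 1" by (simp add: inner_diff_left abs_le_iff)
    qed auto
    finally show "nrm (x - y) \<le> (\<Sum>b\<in>(Basis::'a set). nrm b)" by simp
  qed
  then have "ediam nrm (cub 0 (0::'a)) < \<infinity>" by (simp add: le_less_trans)
  then show e: "ediam nrm (cub 0 (0::'a)) = ennreal udiam" by (simp add: udiam_def dm_def)
  obtain b :: 'a where b: "b \<in> Basis" using nonempty_Basis by blast
  then have nb: "nrm b > 0" using nonzero_Basis nrm_eq_0_iff nrm_ge_0 by (metis order_le_less)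
  have "(1/2) *\<^sub>R b \<in> cub 0 0" using b by (auto simp: cub_0 inner_Basis)
  from nrm_le_ediam[OF this mem_cub_self] have "ennreal (nrm b / 2) \<le> ennreal udiam"
    unfolding e by (simp add: nrm_scaleR)
  moreover have "ennreal (nrm b / 2) > 0" using nb by simp
  ultimately have "ennreal udiam > 0" by (rule less_le_trans[rotated])
  then show "udiam > 0" by simp
qed

lemma ediam_cub: "ediam nrm (cub j x) = ennreal (udiam * 2 powr (- real_of_int j))"
proof -
  let ?s = "2 powr (- real_of_int j)"
  obtain c where c: "cub j x = (\<lambda>y. ?s *\<^sub>R y + c) ` cub 0 (0::'a)" using cub_scale by blast
  have d: "ennreal (nrm (?s *\<^sub>R y + c - (?s *\<^sub>R z + c))) = ennreal ?s * ennreal (nrm (y - z))" for y z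
    by (simp add: nrm_scaleR ennreal_mult' scaleR_diff_right[symmetric])
  have "ediam nrm (cub j x) = (SUP y\<in>cub 0 0. SUP z\<in>cub 0 0. ennreal ?s * ennreal (nrm (y - z)))"
    unfolding ediam_def c by (simp only: SUP_image o_def image_image d)
  also have "\<dots> = ennreal ?s * ediam nrm (cub 0 0)"
    unfolding ediam_def by (simp add: SUP_mult_left_ennreal)
  also have "\<dots> = ennreal (udiam * ?s)" unfolding ediam_cub_0 using udiam_pos
    by (simp add: ennreal_mult' mult.commute)
  finally show ?thesis .
qed

lemma dm_cub: "dm (cub j x) = udiam * 2 powr (- real_of_int j)"
  using udiam_pos by (simp add: dm_def ediam_cub)

lemma dm_pos: "dyadic_cube Q \<Longrightarrow> 0 < dm Q"
  using udiam_pos by (auto elim!: dyadic_cubeE simp: dm_cub)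

lemma ediam_eq_dm: "dyadic_cube Q \<Longrightarrow> ediam nrm Q = ennreal (dm Q)"
  by (auto elim!: dyadic_cubeE simp: dm_cub ediam_cub)

lemma dm_empty [simp]: "dm {} = 0" by (simp add: dm_def)

lemma dm_mono: "dyadic_cube P \<Longrightarrow> dyadic_cube Q \<Longrightarrow> P \<subseteq> Q \<Longrightarrow> dm P \<le> dm Q"
  using ediam_mono[of P Q] dm_pos[of Q] by (simp add: ediam_eq_dm ennreal_le_iff)

lemma nrm_le_dm: "dyadic_cube Q \<Longrightarrow> x \<in> Q \<Longrightarrow> y \<in> Q \<Longrightarrow> nrm (x - y) \<le> dm Q"
  using nrm_le_ediam[of x Q y] dm_pos[of Q] by (simp add: ediam_eq_dm ennreal_le_iff)

lemma emeasure_dyadic_cube: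
  assumes "dyadic_cube Q" shows "emeasure lborel Q = ennreal ((dm Q / udiam) ^ DIM('a))"
  using assms udiam_pos by (auto elim!: dyadic_cubeE simp: dm_cub emeasure_cub)

lemma cub_diam_less:
  assumes "r > 0" obtains j :: int where "r / 2 < udiam * 2 powr (- real_of_int j)" "udiam * 2 powr (- real_of_int j) \<le> r"
proof
  define j where "j = \<lceil>log 2 (udiam / r)\<rceil>"
  have "log 2 (udiam / r) \<le> j" "j < log 2 (udiam / r) + 1" unfolding j_def by linarith+
  then have "2 powr (log 2 (udiam / r)) \<le> 2 powr j" "2 powr j < 2 powr (log 2 (udiam / r) + 1)" by simp_all
  then have "udiam / r \<le> 2 powr j" "2 powr j < udiam / r * 2"
    using udiam_pos assms by (simp_all add: powr_add)
  then show "r / 2 < udiam * 2 powr (- real_of_int j)" "udiam * 2 powr (- real_of_int j) \<le> r"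
    using udiam_pos assms by (simp_all add: powr_minus field_simps)
qed

lemma closure_dyadic_cube:
  assumes "dyadic_cube Q" "x \<in> Q" "y \<in> closure Q" shows "nrm (y - x) \<le> dm Q"
proof -
  have "closure Q \<subseteq> {y. nrm (y - x) \<le> dm Q}"
    by (intro closure_minimal closed_nball) (use nrm_le_dm[OF assms(1) _ assms(2)] in auto)
  then show ?thesis using assms(3) by auto
qed

lemma nball_in_dyadic_cube:
  obtains \<tau> where "\<tau> > 0" "\<And>Q. dyadic_cube Q \<Longrightarrow> \<exists>c. nball nrm c (\<tau> * dm Q) \<subseteq> Q"
proof -
  obtain k where k: "k > 0" "\<And>x. norm x \<le> k * nrm x" by (rule norm_le_nrm) auto
  show ?thesis
  proof
    \<comment> \<open>A cube of side s has diameter \<open>udiam * s\<close> and contains the open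
      Euclidean ball of radius s/2 about its centre; dividing by k passes to
      \<open>nrm\<close>.\<close>
    show "1 / (2 * k * udiam) > 0" using k udiam_pos by simp
    fix Q :: "'a set" assume "dyadic_cube Q"
    then obtain j x where Q: "Q = cub j x" by (rule dyadic_cubeE)
    let ?s = "2 powr (- real_of_int j)"
    let ?k = "\<lambda>b. real_of_int \<lfloor>2 powr j * (x \<bullet> b)\<rfloor>"
    define c where "c = (\<Sum>b\<in>Basis. (?s * (?k b + 1/2)) *\<^sub>R b)"
    have c: "c \<bullet> b = ?s * (?k b + 1/2)" if "b \<in> Basis" for b unfolding c_def using that by simp
    have "nball nrm c (1 / (2 * k * udiam) * dm Q) \<subseteq> Q"
    proof
      fix y assume "y \<in> nball nrm c (1 / (2 * k * udiam) * dm Q)"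
      then have "nrm (y - c) < ?s / (2 * k)"
        using udiam_pos by (simp add: mem_nball Q dm_cub)
      then have "k * nrm (y - c) < ?s / 2" using k(1) by (simp add: field_simps)
      then have n: "norm (y - c) < ?s / 2" using k(2)[of "y - c"] by linarith
      show "y \<in> Q" unfolding Q mem_cub_iff
      proof
        fix b :: 'a assume b: "b \<in> Basis"
        have "\<bar>y \<bullet> b - c \<bullet> b\<bar> < ?s / 2"
          using n Basis_le_norm[OF b, of "y - c"] by (simp add: inner_diff_left)
        then have "- (?s / 2) < y \<bullet> b - c \<bullet> b" "y \<bullet> b - c \<bullet> b < ?s / 2" by linarith+
        then show "?s * ?k b \<le> y \<bullet> b \<and> y \<bullet> b < ?s * (?k b + 1)"
          unfolding c[OF b] by (simp add: algebra_simps)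
      qed
    qed
    then show "\<exists>c. nball nrm c (1 / (2 * k * udiam) * dm Q) \<subseteq> Q" by blast
  qed
qed

text \<open>The cubes met by S are disjoint, of equal volume, and lie in the ball of radius R + r.
  The volume comparison is made first for finite subfamilies, because finiteness is itself a
  consequence of it.\<close>

lemma cubes_count:
  fixes j :: int
  assumes R: "S \<subseteq> nball nrm c R" "0 \<le> R"
  defines "r \<equiv> udiam * 2 powr (- real_of_int j)"
  shows "finite (cub j ` S)" "real (card (cub j ` S)) * r ^ DIM('a) \<le> udiam ^ DIM('a) * uvol * (R + r) ^ DIM('a)"
proof -
  have r: "r > 0" unfolding r_def using udiam_pos by simp
  have *: "real (card F) * r ^ DIM('a) \<le> udiam ^ DIM('a) * uvol * (R + r) ^ DIM('a)"
    if F: "F \<subseteq> cub j ` S" "finite F" for F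
  proof -
    have m: "emeasure lborel q = ennreal ((r / udiam) ^ DIM('a))" if "q \<in> F" for q
      using that F by (auto simp: emeasure_dyadic_cube dm_cub r_def)
    have "ennreal (real (card F) * (r / udiam) ^ DIM('a)) = (\<Sum>q\<in>F. emeasure lborel q)"
      using m r udiam_pos by (simp add: ennreal_mult' ennreal_of_nat_eq_real_of_nat)
    also have "\<dots> = emeasure lborel (\<Union>q\<in>F. q)"
    proof (intro sum_emeasure)
      show "disjoint_family_on (\<lambda>q. q) F"
        unfolding disjoint_family_on_def using F(1) by (blast dest: cub_eq_if_meet)
    qed (use F in auto)
    also have "\<dots> \<le> emeasure lborel (nball nrm c (R + r))"
    proof (intro emeasure_mono)
      show "(\<Union>q\<in>F. q) \<subseteq> nball nrm c (R + r)"
      proof safe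
        fix q y assume q: "q \<in> F" "y \<in> q"
        then obtain x where x: "x \<in> S" "q = cub j x" using F by auto
        then have "nrm (y - x) \<le> r" using nrm_le_dm[of q y x] q by (simp add: dm_cub r_def)
        moreover have "nrm (x - c) < R" using x R by (auto simp: mem_nball)
        ultimately show "y \<in> nball nrm c (R + r)"
          using nrm_diff_triangle[of y c x] by (simp add: mem_nball)
      qed
    qed simp
    also have "\<dots> = ennreal (uvol * (R + r) ^ DIM('a))"
      using emeasure_nball[of "R + r" c] R r by simp
    finally have "real (card F) * (r / udiam) ^ DIM('a) \<le> uvol * (R + r) ^ DIM('a)"
      using uvol_pos R r by (subst (asm) ennreal_le_iff) auto
    then show ?thesis using udiam_pos by (simp add: power_divide field_simps)
  qed
  show fin: "finite (cub j ` S)"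
  proof (rule ccontr)
    assume inf: "infinite (cub j ` S)"
    define N where "N = nat \<lceil>udiam ^ DIM('a) * uvol * (R + r) ^ DIM('a) / r ^ DIM('a)\<rceil> + 1"
    obtain F where F: "F \<subseteq> cub j ` S" "finite F" "card F = N"
      using infinite_arbitrarily_large[OF inf] by blast
    have "real N \<le> udiam ^ DIM('a) * uvol * (R + r) ^ DIM('a) / r ^ DIM('a)"
      using *[OF F(1,2)] r F(3) by (simp add: field_simps)
    then show False unfolding N_def by linarith
  qed
  show "real (card (cub j ` S)) * r ^ DIM('a) \<le> udiam ^ DIM('a) * uvol * (R + r) ^ DIM('a)"
    by (rule *) (auto simp: fin)
qed

text \<open>The volume of a dyadic cube is a fixed multiple of \<open>dm\<close> to the power d, so
  for the gauge r^d this is subadditivity of Lebesgue measure. Other gauges are compared with it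
  through their ratio to r^d.\<close>

lemma dm_power_subadditive:
  assumes "finite L" "dyadic_cube Q" "\<And>l. l \<in> L \<Longrightarrow> dyadic_cube l" "Q \<subseteq> \<Union>L"
  shows "dm Q ^ DIM('a) \<le> (\<Sum>l\<in>L. dm l ^ DIM('a))"
proof -
  have "emeasure lborel Q \<le> emeasure lborel (\<Union>l\<in>L. l)"
  proof (intro emeasure_mono)
    show "(\<Union>l\<in>L. l) \<in> sets lborel"
      using assms dyadic_cube_borel by (intro sets.finite_UN) auto
  qed (use assms in auto)
  also have "\<dots> \<le> (\<Sum>l\<in>L. emeasure lborel l)"
    using assms by (intro emeasure_subadditive_finite) (auto intro!: dyadic_cube_borel)
  also have "\<dots> = (\<Sum>l\<in>L. ennreal ((dm l / udiam) ^ DIM('a)))"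
    using assms by (intro sum.cong) (auto simp: emeasure_dyadic_cube)
  also have "\<dots> = ennreal (\<Sum>l\<in>L. (dm l / udiam) ^ DIM('a))"
    using udiam_pos assms dm_pos by (intro sum_ennreal) (auto intro!: divide_nonneg_nonneg simp: less_imp_le)
  finally have "ennreal ((dm Q / udiam) ^ DIM('a)) \<le> ennreal (\<Sum>l\<in>L. (dm l / udiam) ^ DIM('a))"
    using assms by (simp add: emeasure_dyadic_cube)
  then have "(dm Q / udiam) ^ DIM('a) \<le> (\<Sum>l\<in>L. (dm l / udiam) ^ DIM('a))"
    using udiam_pos assms dm_pos by (subst (asm) ennreal_le_iff) (auto intro!: sum_nonneg simp: less_imp_le)
  then show ?thesis using udiam_pos
    by (simp add: power_divide sum_divide_distrib[symmetric] divide_le_cancel)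
qed

lemma dm_power_subadditive_countable:
  fixes C :: "nat \<Rightarrow> 'a set"
  assumes "dyadic_cube Q" "\<And>n. C n = {} \<or> dyadic_cube (C n)" "Q \<subseteq> (\<Union>n. C n)"
  shows "ennreal (dm Q ^ DIM('a)) \<le> (\<Sum>n. ennreal (dm (C n) ^ DIM('a)))"
proof -
  have C: "C n \<in> sets borel" for n using assms(2)[of n] dyadic_cube_borel by auto
  have e: "emeasure lborel (C n) = ennreal ((1 / udiam) ^ DIM('a)) * ennreal (dm (C n) ^ DIM('a))" for n
    using assms(2)[of n] udiam_pos by (auto simp: emeasure_dyadic_cube ennreal_mult'[symmetric] power_divide zero_power)
  have "emeasure lborel Q \<le> emeasure lborel (\<Union>n. C n)"
    using assms C by (intro emeasure_mono) auto
  also have "\<dots> \<le> (\<Sum>n. emeasure lborel (C n))"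
    using C by (intro emeasure_subadditive_countably) auto
  also have "\<dots> = ennreal ((1 / udiam) ^ DIM('a)) * (\<Sum>n. ennreal (dm (C n) ^ DIM('a)))"
    unfolding e by simp
  finally have "ennreal ((1 / udiam) ^ DIM('a)) * ennreal (dm Q ^ DIM('a)) \<le> ennreal ((1 / udiam) ^ DIM('a)) * (\<Sum>n. ennreal (dm (C n) ^ DIM('a)))"
    using assms udiam_pos by (simp add: emeasure_dyadic_cube ennreal_mult'[symmetric] power_divide)
  then have "ennreal (udiam ^ DIM('a)) * (ennreal ((1 / udiam) ^ DIM('a)) * ennreal (dm Q ^ DIM('a))) \<le>
      ennreal (udiam ^ DIM('a)) * (ennreal ((1 / udiam) ^ DIM('a)) * (\<Sum>n. ennreal (dm (C n) ^ DIM('a))))"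
    by (rule mult_left_mono) simp
  moreover have "ennreal (udiam ^ DIM('a)) * ennreal ((1 / udiam) ^ DIM('a)) = 1"
    using udiam_pos by (simp add: ennreal_mult'[symmetric] power_divide)
  ultimately show ?thesis by (simp add: mult.assoc[symmetric])
qed

lemma dyadic_cube_around:
  fixes x :: 'a
  assumes "open W" "x \<in> W" obtains n :: nat where "cub (j0 + int n) x \<subseteq> W"
proof -
  obtain e where e: "e > 0" "nball nrm x e \<subseteq> W" using openE_nball assms by blast
  obtain j where j: "udiam * 2 powr (- real_of_int j) \<le> e / 2" using cub_diam_less[of "e/2"] e by auto
  have "cub (j0 + int (nat (j - j0))) x \<subseteq> cub j x" by (rule cub_antimono) simp
  also have "cub j x \<subseteq> nball nrm x e"
  proof
    fix y assume "y \<in> cub j x"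
    then have "nrm (y - x) \<le> dm (cub j x)" by (intro nrm_le_dm) auto
    then show "y \<in> nball nrm x e" using j e by (simp add: mem_nball dm_cub)
  qed
  finally show ?thesis using e that by blast
qed

lemma dyadic_partition:
  assumes "open W" "0 < \<epsilon>"
  obtains \<Q> where "countable \<Q>" "disjoint \<Q>" "\<Union>\<Q> = W" "\<And>Q. Q \<in> \<Q> \<Longrightarrow> dyadic_cube Q \<and> dm Q \<le> \<epsilon>"
proof -
  obtain j0 where j0: "udiam * 2 powr (- real_of_int j0) \<le> \<epsilon>" using cub_diam_less[of \<epsilon>] assms by auto
  \<comment> \<open>\<open>J x\<close> picks the largest cube about x, of generation at least j0,
    that fits in W. By maximality all points of that cube pick the same one, which gives
    disjointness.\<close>
  define J where "J x = (LEAST n. cub (j0 + int n) x \<subseteq> W)" for x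
  have J: "cub (j0 + int (J x)) x \<subseteq> W" if "x \<in> W" for x
    unfolding J_def by (rule LeastI_ex) (use dyadic_cube_around[OF assms(1) that, of j0] in blast)
  have J_le: "J x \<le> n" if "cub (j0 + int n) x \<subseteq> W" for x n
    unfolding J_def using that by (rule Least_le)
  define q where "q x = cub (j0 + int (J x)) x" for x
  have eq: "q y = q x" if "y \<in> q x" "x \<in> W" for x y
  proof -
    have c: "cub (j0 + int (J x)) y = q x" using that(1) unfolding q_def by (rule cub_eqI)
    then have le: "J y \<le> J x" by (intro J_le) (use J[OF that(2)] q_def in auto)
    have "y \<in> W" using that J[of x] by (auto simp: q_def)
    have "cub (j0 + int (J x)) y \<subseteq> cub (j0 + int (J y)) y" by (rule cub_antimono) (use le in simp)
    then have "x \<in> cub (j0 + int (J y)) y" using c by (auto simp: q_def)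
    then have "cub (j0 + int (J y)) x = cub (j0 + int (J y)) y" by (rule cub_eqI)
    then have "J x \<le> J y" using J[OF \<open>y \<in> W\<close>] by (intro J_le) auto
    then show ?thesis using le c by (simp add: q_def)
  qed
  show ?thesis
  proof
    show "countable (q ` W)"
      by (rule countable_subset[OF _ countable_dyadic_cubes]) (auto simp: q_def)
    show "disjoint (q ` W)"
      by (auto simp: pairwise_def disjnt_def dest: eq)
    show "\<Union>(q ` W) = W" using J by (auto simp: q_def)
    fix Q assume "Q \<in> q ` W"
    then obtain x where "Q = q x" by auto
    moreover have "2 powr (- real_of_int (j0 + int (J x))) \<le> 2 powr (- real_of_int j0)" by simp
    then have "udiam * 2 powr (- real_of_int (j0 + int (J x))) \<le> udiam * 2 powr (- real_of_int j0)"
      using udiam_pos by (intro mult_left_mono) auto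
    ultimately show "dyadic_cube Q \<and> dm Q \<le> \<epsilon>" using j0
      unfolding q_def by (simp only: dm_cub dyadic_cube_cub) auto
  qed
qed

end

section \<open>Greedy selection of separated points\<close>

text \<open>Real-valued picture of a d-normalized gauge on (0, \<epsilon>]. Strict positivity allows
  division; \<open>represents\<close> links such functions to extended-real gauges.\<close>

definition dgauge_on :: "nat \<Rightarrow> real \<Rightarrow> (real \<Rightarrow> real) \<Rightarrow> bool" where
  "dgauge_on d \<epsilon> g \<longleftrightarrow> 0 < \<epsilon> \<and> (\<forall>r. 0 < r \<longrightarrow> r \<le> \<epsilon> \<longrightarrow> 0 < g r) \<and>
     (\<forall>r s. 0 < r \<longrightarrow> r \<le> s \<longrightarrow> s \<le> \<epsilon> \<longrightarrow> g r \<le> g s \<and> g s / s ^ d \<le> g r / r ^ d)"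

lemma dgauge_onD:
  assumes "dgauge_on d \<epsilon> g"
  shows "0 < \<epsilon>" "0 < r \<Longrightarrow> r \<le> \<epsilon> \<Longrightarrow> 0 < g r"
    "0 < r \<Longrightarrow> r \<le> s \<Longrightarrow> s \<le> \<epsilon> \<Longrightarrow> g r \<le> g s"
    "0 < r \<Longrightarrow> r \<le> s \<Longrightarrow> s \<le> \<epsilon> \<Longrightarrow> g s / s ^ d \<le> g r / r ^ d"
  using assms by (auto simp: dgauge_on_def)

text \<open>Doubling property: up to s monotonicity suffices, and beyond s the ratio to r^d lets g
  grow no faster than r^d.\<close>

lemma dgauge_on_scale:
  assumes g: "dgauge_on d \<epsilon> g" and "0 < r" "r \<le> c * s" "1 \<le> c" "0 < s" "s \<le> \<epsilon>" "r \<le> \<epsilon>"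
  shows "g r \<le> c ^ d * g s"
proof (cases "r \<le> s")
  case True
  then have "g r \<le> g s" using dgauge_onD(3)[OF g] assms by blast
  also have "\<dots> \<le> c ^ d * g s"
    using dgauge_onD(2)[OF g, of s] assms by (simp add: mult_le_cancel_right1)
  finally show ?thesis .
next
  case False
  then have "g r / r ^ d \<le> g s / s ^ d" using dgauge_onD(4)[OF g, of s r] assms by simp
  then have "g r \<le> (r ^ d / s ^ d) * g s" using assms by (simp add: field_simps)
  also have "\<dots> \<le> (c * s) ^ d / s ^ d * g s"
    using dgauge_onD(2)[OF g, of s] assms by (intro mult_right_mono divide_right_mono power_mono) auto
  also have "\<dots> = c ^ d * g s" using assms by (simp add: power_mult_distrib)
  finally show ?thesis .
qed

lemma dgauge_on_subset:
  "dgauge_on d \<epsilon> g \<Longrightarrow> 0 < \<delta> \<Longrightarrow> \<delta> \<le> \<epsilon> \<Longrightarrow> dgauge_on d \<delta> g"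
  by (simp add: dgauge_on_def)

lemma sum_UN_le:
  fixes f :: "'b \<Rightarrow> real"
  assumes "finite L" "\<And>l. l \<in> L \<Longrightarrow> finite (T l)" "\<And>x. 0 \<le> f x"
  shows "(\<Sum>x\<in>(\<Union>l\<in>L. T l). f x) \<le> (\<Sum>l\<in>L. \<Sum>x\<in>T l. f x)"
  using assms
proof (induction L rule: finite_induct)
  case (insert l L)
  have "(\<Sum>x\<in>(\<Union>l\<in>insert l L. T l). f x) \<le> sum f (T l) + (\<Sum>x\<in>(\<Union>l\<in>L. T l). f x)"
    using insert sum.union_inter[of "T l" "\<Union>l\<in>L. T l" f] sum_nonneg[of "T l \<inter> (\<Union>l\<in>L. T l)" f] by simp
  then show ?case using insert by simp
qed simp

text \<open>If the truncated series converged, its terms would eventually be below c, where the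
  truncation is inactive.\<close>

lemma not_summable_min_1:
  fixes x :: "nat \<Rightarrow> real"
  assumes "\<not> summable x" "\<And>k. 0 \<le> x k" "0 < c"
  shows "\<not> summable (\<lambda>k. min (x k) c)"
proof
  assume s: "summable (\<lambda>k. min (x k) c)"
  then have "(\<lambda>k. min (x k) c) \<longlonglongrightarrow> 0" by (rule summable_LIMSEQ_zero)
  then have "\<forall>\<^sub>F k in sequentially. min (x k) c < c"
    by (rule order_tendstoD) (use assms in auto)
  then have "\<forall>\<^sub>F k in sequentially. min (x k) c = x k"
    by (rule eventually_mono) auto
  then have "summable (\<lambda>k. min (x k) c) = summable x" by (rule summable_cong)
  then show False using s assms(1) by blast
qed

context euclidean_norm begin

text \<open>A candidate of level k0 + n is kept if it avoids the balls of radius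
  \<open>\<rho> i\<close> about all points kept at earlier levels. It is not tested against its own
  level, where separation is supplied as a hypothesis. The level is stored with the point because it
  determines the radius.\<close>

primrec select :: "(nat \<Rightarrow> 'a set) \<Rightarrow> (nat \<Rightarrow> real) \<Rightarrow> nat \<Rightarrow> nat \<Rightarrow> ('a \<times> nat) set" where
  "select P \<rho> k0 0 = {}"
| "select P \<rho> k0 (Suc n) = select P \<rho> k0 n \<union>
     {(a, k0 + n) | a. a \<in> P (k0 + n) \<and> (\<forall>(b, i) \<in> select P \<rho> k0 n. \<rho> i \<le> nrm (a - b))}"

lemma select_level: "(a, k) \<in> select P \<rho> k0 n \<Longrightarrow> k0 \<le> k \<and> k < k0 + n \<and> a \<in> P k"
  by (induction n) auto

lemma finite_select:
  assumes "\<And>k. k0 \<le> k \<Longrightarrow> finite (P k)" shows "finite (select P \<rho> k0 n)"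
proof (induction n)
  case (Suc n)
  have "{(a, k0 + n) | a. a \<in> P (k0 + n) \<and> (\<forall>(b, i) \<in> select P \<rho> k0 n. \<rho> i \<le> nrm (a - b))} \<subseteq> P (k0 + n) \<times> {k0 + n}"
    by auto
  then have "finite {(a, k0 + n) | a. a \<in> P (k0 + n) \<and> (\<forall>(b, i) \<in> select P \<rho> k0 n. \<rho> i \<le> nrm (a - b))}"
    by (rule finite_subset) (use assms in auto)
  then show ?case using Suc by simp
qed simp

text \<open>The later of two points avoids the ball of the earlier one, whose radius is the larger
  because \<rho> decreases; two points of one level are separated by \<open>sep\<close>.\<close>

lemma select_separated:
  assumes sep: "\<And>k a b. k0 \<le> k \<Longrightarrow> a \<in> P k \<Longrightarrow> b \<in> P k \<Longrightarrow> a \<noteq> b \<Longrightarrow> \<rho> k \<le> nrm (a - b)"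
    and anti: "\<And>i k. k0 \<le> i \<Longrightarrow> i \<le> k \<Longrightarrow> \<rho> k \<le> \<rho> i"
    and x: "x \<in> select P \<rho> k0 n" and y: "y \<in> select P \<rho> k0 n" and "x \<noteq> y"
  shows "max (\<rho> (snd x)) (\<rho> (snd y)) \<le> nrm (fst x - fst y)"
proof -
  have "(\<rho> (snd x)) \<le> nrm (fst x - fst y) \<and> (\<rho> (snd y)) \<le> nrm (fst x - fst y)"
    if "x \<in> select P \<rho> k0 n" "y \<in> select P \<rho> k0 n" "x \<noteq> y" "snd x \<le> snd y" for x y
    using that
  proof (induction n)
    case (Suc n)
    obtain a i where x: "x = (a, i)" by force
    obtain b k where y: "y = (b, k)" by force
    show ?case
    proof (cases "y \<in> select P \<rho> k0 n")
      case True
      have "x \<in> select P \<rho> k0 n"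
        using Suc.prems select_level[of b k P \<rho> k0 n] True x y by auto
      then show ?thesis using True Suc by blast
    next
      case False
      then have k: "k = k0 + n" "b \<in> P k" and far: "\<And>c i. (c, i) \<in> select P \<rho> k0 n \<Longrightarrow> \<rho> i \<le> nrm (b - c)"
        using Suc.prems(2) y by auto
      show ?thesis
      proof (cases "x \<in> select P \<rho> k0 n")
        case True
        then have "k0 \<le> i" "\<rho> i \<le> nrm (a - b)" "i \<le> k"
          using far select_level x y Suc.prems(4) nrm_minus_commute[of a b] by auto
        then show ?thesis using anti[of i k] x y by auto
      next
        case False
        then have "i = k" "a \<in> P k" using Suc.prems(1) x k(1) by auto
        then show ?thesis using sep[of k a b] x y k Suc.prems(3) by auto
      qed
    qed
  qed simp
  from this[OF x y \<open>x \<noteq> y\<close>] this[OF y x \<open>x \<noteq> y\<close>[symmetric]] show ?thesis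
    using nrm_minus_commute[of "fst x" "fst y"] by (cases "snd x \<le> snd y") auto
qed

text \<open>Since q - 1 is at least q/2, the sum is at most twice its last term. With q = M^d this
  makes all earlier levels together sparse compared with the next one.\<close>

lemma geometric_sum_le:
  fixes q :: real assumes "2 \<le> q" shows "(\<Sum>i<n. q ^ i) \<le> 2 / q * q ^ n"
proof -
  have "(\<Sum>i<n. q ^ i) = (q ^ n - 1) / (q - 1)"
    using assms by (subst geometric_sum) auto
  also have "\<dots> \<le> q ^ n / (q / 2)"
    using assms by (intro frac_le) auto
  finally show ?thesis by (simp add: field_simps)
qed

text \<open>By contradiction: as long as the selected weight stays small, the balls already chosen
  discard at most half of the guaranteed points of each new level. Every level then adds a fixed
  multiple of R^d (M^k)^d w k, and divergence of that series pushes the weight over the bound. As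
  \<rho>^d = w, weight is the volume of the excluded balls up to a constant.\<close>

lemma selection:
  fixes M \<kappa> R :: real and w :: "nat \<Rightarrow> real" and P :: "nat \<Rightarrow> 'a set"
  defines "d \<equiv> DIM('a)" and "\<rho> \<equiv> \<lambda>k. w k powr (1 / DIM('a))"
  assumes M: "2 \<le> M" "8 * 6 ^ d / \<kappa> \<le> M" and \<kappa>: "0 < \<kappa>" and R: "0 < R" "(1 / M) ^ k0 \<le> R"
    and fin: "\<And>k. k0 \<le> k \<Longrightarrow> finite (P k)"
    and card: "\<And>k. k0 \<le> k \<Longrightarrow> \<kappa> * R ^ d * (M ^ k) ^ d \<le> card (P k)"
    and near: "\<And>k a. k0 \<le> k \<Longrightarrow> a \<in> P k \<Longrightarrow> nrm (a - c) \<le> R"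
    and sep: "\<And>k a b. k0 \<le> k \<Longrightarrow> a \<in> P k \<Longrightarrow> b \<in> P k \<Longrightarrow> a \<noteq> b \<Longrightarrow> (1 / M) ^ k \<le> nrm (a - b)"
    and w: "\<And>k. 0 < w k" "\<And>k. w k \<le> ((1 / M) ^ k) ^ d" "antimono w"
    and div: "\<not> summable (\<lambda>k. (M ^ k) ^ d * w k)"
  obtains n where "\<kappa> / (4 * 4 ^ d) * R ^ d < (\<Sum>(a, k)\<in>select P \<rho> k0 n. w k)"
proof (rule ccontr)
  assume "\<not> thesis"
  with that have W: "(\<Sum>(a, k)\<in>select P \<rho> k0 n. w k) \<le> \<kappa> / (4 * 4 ^ d) * R ^ d" for n
    by (meson not_le)
  let ?S = "select P \<rho> k0"
  have d: "0 < d" unfolding d_def by simp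
  have \<rho>d: "\<rho> k ^ d = w k" for k
    using w(1)[of k] d unfolding \<rho>_def d_def[symmetric]
    by (simp add: powr_realpow[symmetric] powr_powr)
  have p4: "(4::real) ^ d = 2 ^ d * 2 ^ d" and p6: "(6::real) ^ d = 2 ^ d * 3 ^ d"
    by (simp_all flip: power_mult_distrib)
  have \<rho>pos: "0 < \<rho> k" for k using w(1)[of k] by (simp add: \<rho>_def)
  have \<rho>le: "\<rho> k \<le> (1 / M) ^ k" for k
  proof (rule power_le_imp_le_base[of _ "d - 1"])
    show "\<rho> k ^ Suc (d - 1) \<le> ((1 / M) ^ k) ^ Suc (d - 1)" using d w(2)[of k] \<rho>d[of k] by simp
  qed (use M in simp)
  have finS: "finite (?S n)" for n by (rule finite_select[OF fin])
  have cardP: "card (P k) \<le> 3 ^ d * R ^ d * (M ^ k) ^ d" if "k0 \<le> k" for k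
  proof -
    have s: "(1 / M) ^ k \<le> R"
    proof -
      have "(1 / M) ^ k \<le> (1 / M) ^ k0" using M that by (intro power_decreasing) auto
      then show ?thesis using R by linarith
    qed
    have "card (P k) * ((1 / M) ^ k) ^ d \<le> (2 * R + (1 / M) ^ k) ^ d"
      unfolding d_def using fin[OF that] sep[OF that] near[OF that] M R
      by (intro packing_count[where x = c]) auto
    also have "\<dots> \<le> (3 * R) ^ d" using s M R by (intro power_mono) auto
    finally have "card (P k) * ((1 / M) ^ k) ^ d * (M ^ k) ^ d \<le> (3 * R) ^ d * (M ^ k) ^ d"
      using M by (intro mult_right_mono) auto
    moreover have "((1 / M) ^ k) ^ d * (M ^ k) ^ d = 1" using M by (simp add: power_divide)
    ultimately show ?thesis by (simp add: power_mult_distrib mult.assoc)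
  qed
  \<comment> \<open>Levels grow geometrically, so the points kept before level k0 + n are only a
    fraction of order M^-d of what that level can hold.\<close>
  have cardS: "card (?S n) \<le> 3 ^ d * R ^ d * (2 / M ^ d * (M ^ (k0 + n)) ^ d)" for n
  proof -
    have "?S n \<subseteq> (SIGMA k:{k0..<k0 + n}. P k)\<inverse>"
      by (auto dest: select_level)
    then have "card (?S n) \<le> card ((SIGMA k:{k0..<k0 + n}. P k)\<inverse>)"
      by (intro card_mono) (auto simp: fin)
    also have "\<dots> = (\<Sum>k\<in>{k0..<k0+n}. card (P k))" by (simp add: fin)
    finally have "real (card (?S n)) \<le> (\<Sum>k\<in>{k0..<k0+n}. real (card (P k)))"
      by (metis of_nat_le_iff of_nat_sum)
    also have "\<dots> \<le> (\<Sum>k\<in>{k0..<k0+n}. 3 ^ d * R ^ d * (M ^ d) ^ k)"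
      using cardP by (intro sum_mono) (auto simp: power_mult[symmetric] mult.commute)
    also have "\<dots> \<le> (\<Sum>k<k0+n. 3 ^ d * R ^ d * (M ^ d) ^ k)"
      using R M by (intro sum_mono2) auto
    also have "\<dots> = 3 ^ d * R ^ d * (\<Sum>k<k0+n. (M ^ d) ^ k)" by (simp add: sum_distrib_left)
    also have "\<dots> \<le> 3 ^ d * R ^ d * (2 / M ^ d * (M ^ d) ^ (k0 + n))"
    proof (intro mult_left_mono geometric_sum_le)
      have "M ^ 1 \<le> M ^ d" using M d by (intro power_increasing) auto
      then show "2 \<le> M ^ d" using M by simp
    qed (use R in auto)
    finally show ?thesis by (simp add: power_mult[symmetric] mult.commute)
  qed
  have step: "(\<Sum>(a, k)\<in>?S n. w k) + \<kappa> / 2 * R ^ d * ((M ^ (k0 + n)) ^ d * w (k0 + n)) \<le> (\<Sum>(a, k)\<in>?S (Suc n). w k)" for n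
  proof -
    let ?k = "k0 + n"
    define bad where "bad = (\<lambda>x. {a \<in> P ?k. nrm (a - fst x) < \<rho> (snd x)})"
    define new where "new = P ?k - (\<Union>x\<in>?S n. bad x)"
    have Mk: "((1 / M) ^ ?k) ^ d * (M ^ ?k) ^ d = 1" using M by (simp add: power_divide)
    have "{(a, ?k) | a. a \<in> P ?k \<and> (\<forall>(b, i) \<in> ?S n. \<rho> i \<le> nrm (a - b))} = (\<lambda>a. (a, ?k)) ` new"
      unfolding new_def bad_def by (auto simp: not_less image_iff case_prod_beta)
    then have Suc: "?S (Suc n) = ?S n \<union> (\<lambda>a. (a, ?k)) ` new" by simp
    \<comment> \<open>A large excluded ball costs in proportion to its weight; one below the spacing
      of the level costs at most 2^d points.\<close>
    have cb: "card (bad x) \<le> 4 ^ d * w (snd x) * (M ^ ?k) ^ d + 2 ^ d" if "x \<in> ?S n" for x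
    proof -
      have "card (bad x) * ((1 / M) ^ ?k) ^ d \<le> (2 * \<rho> (snd x) + (1 / M) ^ ?k) ^ d"
        unfolding d_def bad_def using fin[of ?k] sep[of ?k] M \<rho>pos[of "snd x"]
        by (intro packing_count[where x = "fst x"]) auto
      also have "\<dots> \<le> (2 * max (2 * \<rho> (snd x)) ((1 / M) ^ ?k)) ^ d"
        using M \<rho>pos[of "snd x"] by (intro power_mono) auto
      also have "\<dots> = 2 ^ d * max (2 * \<rho> (snd x)) ((1 / M) ^ ?k) ^ d" by (rule power_mult_distrib)
      also have "\<dots> \<le> 2 ^ d * ((2 * \<rho> (snd x)) ^ d + ((1 / M) ^ ?k) ^ d)"
        using M \<rho>pos[of "snd x"] by (intro mult_left_mono) (auto simp: max_def)
      also have "\<dots> = 4 ^ d * w (snd x) + 2 ^ d * ((1 / M) ^ ?k) ^ d"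
        using p4 by (simp add: power_mult_distrib \<rho>d ring_distribs)
      finally have "card (bad x) * ((1 / M) ^ ?k) ^ d * (M ^ ?k) ^ d \<le> (4 ^ d * w (snd x) + 2 ^ d * ((1 / M) ^ ?k) ^ d) * (M ^ ?k) ^ d"
        using M by (intro mult_right_mono) auto
      then show ?thesis using Mk by (simp add: mult.assoc ring_distribs)
    qed
    have "card (\<Union>x\<in>?S n. bad x) \<le> (\<Sum>x\<in>?S n. card (bad x))" by (rule card_UN_le[OF finS])
    then have "real (card (\<Union>x\<in>?S n. bad x)) \<le> (\<Sum>x\<in>?S n. real (card (bad x)))"
      by (metis of_nat_le_iff of_nat_sum)
    also have "\<dots> \<le> (\<Sum>x\<in>?S n. 4 ^ d * w (snd x) * (M ^ ?k) ^ d + 2 ^ d)" by (intro sum_mono cb)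
    also have "\<dots> = 4 ^ d * (M ^ ?k) ^ d * (\<Sum>(a, k)\<in>?S n. w k) + 2 ^ d * real (card (?S n))"
      by (simp add: sum.distrib sum_distrib_left case_prod_beta algebra_simps)
    \<comment> \<open>The first term uses the assumed bound on the weight, the second the count of
      selected points. Each comes to at most a quarter of the constant \<kappa>: the first by the
      denominator 4 * 4^d, the second because 2^d * 3^d = 6^d and M is at least 8 * 6^d /
      \<kappa>.\<close>
    also have "\<dots> \<le> 4 ^ d * (M ^ ?k) ^ d * (\<kappa> / (4 * 4 ^ d) * R ^ d) + 2 ^ d * (3 ^ d * R ^ d * (2 / M ^ d * (M ^ ?k) ^ d))"
      using M by (intro add_mono mult_left_mono W cardS) auto
    also have "\<dots> = (\<kappa> / 4 + 2 * 6 ^ d / M ^ d) * (R ^ d * (M ^ ?k) ^ d)"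
      using p4 p6 by (simp add: field_simps)
    also have "\<dots> \<le> (\<kappa> / 4 + \<kappa> / 4) * (R ^ d * (M ^ ?k) ^ d)"
    proof -
      have "2 * 6 ^ d / M ^ d \<le> 2 * 6 ^ d / M"
        using M d by (intro divide_left_mono) (auto simp: self_le_power)
      also have "\<dots> \<le> \<kappa> / 4" using M \<kappa> by (simp add: field_simps)
      finally show ?thesis using R M by (intro mult_right_mono add_left_mono) auto
    qed
    finally have "real (card (\<Union>x\<in>?S n. bad x)) \<le> \<kappa> / 2 * (R ^ d * (M ^ ?k) ^ d)" by simp
    moreover have "real (card (P ?k)) \<le> card new + card (\<Union>x\<in>?S n. bad x)"
    proof -
      have "P ?k \<subseteq> new \<union> (\<Union>x\<in>?S n. bad x)" by (auto simp: new_def)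
      then have "card (P ?k) \<le> card (new \<union> (\<Union>x\<in>?S n. bad x))"
        by (intro card_mono) (auto simp: new_def bad_def fin finS)
      also have "\<dots> \<le> card new + card (\<Union>x\<in>?S n. bad x)" by (rule card_Un_le)
      finally show ?thesis by linarith
    qed
    ultimately have cn: "\<kappa> / 2 * (R ^ d * (M ^ ?k) ^ d) \<le> card new"
      using card[of ?k] by (simp add: algebra_simps)
    have "(\<Sum>(a, k)\<in>?S (Suc n). w k) = (\<Sum>(a, k)\<in>?S n. w k) + (\<Sum>(a, k)\<in>(\<lambda>a. (a, ?k)) ` new. w k)"
      unfolding Suc by (rule sum.union_disjoint)
        (auto simp: finS new_def fin dest: select_level)
    also have "(\<Sum>(a, k)\<in>(\<lambda>a. (a, ?k)) ` new. w k) = card new * w ?k"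
      by (subst sum.reindex) (auto simp: inj_on_def)
    finally show ?thesis
      using mult_right_mono[OF cn, of "w ?k"] w(1)[of ?k] by (simp add: algebra_simps)
  qed
  have "(\<Sum>i<n. \<kappa> / 2 * R ^ d * ((M ^ (k0 + i)) ^ d * w (k0 + i))) \<le> (\<Sum>(a, k)\<in>?S n. w k)" for n
  proof (induction n)
    case (Suc n)
    then show ?case using step[of n] by simp
  qed simp
  then have bd: "(\<Sum>i<n. \<kappa> / 2 * R ^ d * ((M ^ (k0 + i)) ^ d * w (k0 + i))) \<le> \<kappa> / (4 * 4 ^ d) * R ^ d" for n
    using W[of n] order.trans by blast
  have "summable (\<lambda>i. \<kappa> / 2 * R ^ d * ((M ^ (k0 + i)) ^ d * w (k0 + i)))"
    using \<kappa> R M w(1) less_imp_le[OF w(1)] by (intro summableI_nonneg_bounded[OF _ bd]) auto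
  then have "summable (\<lambda>i. (M ^ (i + k0)) ^ d * w (i + k0))"
    using \<kappa> R by (subst (asm) summable_cmult_iff) (auto simp: add.commute)
  then show False using div summable_iff_shift[of "\<lambda>k. (M ^ k) ^ d * w k" k0] by blast
qed

end

section \<open>One-step mass estimate in a regular system\<close>

locale regular_approximation = euclidean_norm nrm for nrm :: "'a::euclidean_space \<Rightarrow> real" +
  fixes U A :: "'a set" and H :: "'a \<Rightarrow> real" and \<phi> :: "real \<Rightarrow> real"
  assumes open_U: "open U" and regular: "regular_system nrm A H U"
    and \<phi>_pos: "\<And>x. 0 \<le> x \<Longrightarrow> 0 < \<phi> x" and \<phi>_anti: "antimono_on {0..} \<phi>"
begin

lemma admissible: "admissible nrm A H"
  using regular by (simp add: regular_system_def)

lemma H_pos: "a \<in> A \<Longrightarrow> 0 < H a" and countable_A: "countable A"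
  using admissible by (auto simp: admissible_def)

lemma \<phi>_le: "0 \<le> x \<Longrightarrow> x \<le> y \<Longrightarrow> \<phi> y \<le> \<phi> x"
  using \<phi>_anti by (auto simp: monotone_on_def)

lemma regular_ball:
  obtains \<kappa> where "0 < \<kappa>"
    "\<And>c R. 0 < R \<Longrightarrow> nball nrm c R \<subseteq> U \<Longrightarrow> \<exists>h0. \<forall>h>h0. \<exists>P \<subseteq> A \<inter> nball nrm c R. finite P \<and>
       \<kappa> * R ^ DIM('a) * h ^ DIM('a) \<le> card P \<and> (\<forall>a\<in>P. H a \<le> h) \<and>
       (\<forall>a\<in>P. \<forall>b\<in>P. a \<noteq> b \<longrightarrow> 1 / h \<le> nrm (a - b))"
proof -
  obtain \<kappa> where \<kappa>: "\<kappa> > 0" and reg: "\<forall>B. is_open_ball nrm B \<and> B \<subseteq> U \<longrightarrow>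
        (\<exists>hB>0. \<forall>h>hB. \<exists>ABh. ABh \<subseteq> A \<inter> B \<and> finite ABh \<and>
            real (card ABh) \<ge> \<kappa> * (enn2real (ediam nrm B)) ^ DIM('a) * h ^ DIM('a) \<and>
            (\<forall>a\<in>ABh. H a \<le> h) \<and>
            (\<forall>a\<in>ABh. \<forall>a'\<in>ABh. a \<noteq> a' \<longrightarrow> nrm (a - a') \<ge> 1 / h))"
    using regular unfolding regular_system_def by (elim conjE exE) (rule that)
  show ?thesis
  proof
    show "0 < \<kappa> / 2 ^ DIM('a)" using \<kappa> by simp
    fix c and R :: real assume R: "0 < R" "nball nrm c R \<subseteq> U"
    let ?B = "nball nrm c R"
    have "is_open_ball nrm ?B" using R unfolding is_open_ball_def by blast
    from reg[THEN spec, THEN mp, OF conjI[OF this R(2)]] obtain hB where hB: "hB > 0" and P: "\<And>h. h > hB \<Longrightarrow> \<exists>ABh. ABh \<subseteq> A \<inter> ?B \<and> finite ABh \<and>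
            real (card ABh) \<ge> \<kappa> * (enn2real (ediam nrm ?B)) ^ DIM('a) * h ^ DIM('a) \<and>
            (\<forall>a\<in>ABh. H a \<le> h) \<and>
            (\<forall>a\<in>ABh. \<forall>a'\<in>ABh. a \<noteq> a' \<longrightarrow> nrm (a - a') \<ge> 1 / h)" by blast
    have "ediam nrm ?B < \<infinity>" using ediam_nball(1)[OF R(1), of c] by (simp add: le_less_trans)
    then have "R / 2 \<le> enn2real (ediam nrm ?B)"
      using ediam_nball(2)[OF R(1), of c] R(1) by (cases "ediam nrm ?B") (auto simp: ennreal_le_iff)
    then have "(R / 2) ^ DIM('a) \<le> enn2real (ediam nrm ?B) ^ DIM('a)"
      using R by (intro power_mono) auto
    then have "\<kappa> / 2 ^ DIM('a) * R ^ DIM('a) * h ^ DIM('a) \<le> \<kappa> * (enn2real (ediam nrm ?B)) ^ DIM('a) * h ^ DIM('a)"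
      if "h > hB" for h
      using mult_left_mono[of "(R/2)^DIM('a)" "enn2real (ediam nrm ?B) ^ DIM('a)" "\<kappa> * h ^ DIM('a)"] \<kappa> hB that
      by (simp add: power_divide mult_ac)
    then show "\<exists>h0. \<forall>h>h0. \<exists>P \<subseteq> A \<inter> nball nrm c R. finite P \<and>
       \<kappa> / 2 ^ DIM('a) * R ^ DIM('a) * h ^ DIM('a) \<le> card P \<and> (\<forall>a\<in>P. H a \<le> h) \<and>
       (\<forall>a\<in>P. \<forall>b\<in>P. a \<noteq> b \<longrightarrow> 1 / h \<le> nrm (a - b))"
      using P by (meson order.trans)
  qed
qed

text \<open>N is a finite set of centres to be avoided, which forces new approximants at each
  generation. Closures inside Q allow nested branches to be intersected by compactness, and halving
  sends their diameters to 0.\<close>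

definition subcubes :: "'a set \<Rightarrow> 'a set \<Rightarrow> 'a set set \<Rightarrow> bool" where
  "subcubes N Q K \<longleftrightarrow> finite K \<and> disjoint K \<and> (\<forall>q\<in>K. dyadic_cube q \<and> closure q \<subseteq> Q \<and> dm q \<le> dm Q / 2 \<and>
     (\<exists>a\<in>A - N. q \<subseteq> nball nrm a (\<phi> (H a))))"

text \<open>A mass distribution bound in covering form: dominating the cubes of K from inside Q
  costs at least c times the value of Q itself. Arbitrary dominating families L are allowed, since a
  cube of a cover may swallow several members of K.\<close>

definition heavy :: "(real \<Rightarrow> real) \<Rightarrow> real \<Rightarrow> 'a set \<Rightarrow> 'a set set \<Rightarrow> bool" where
  "heavy g c Q K \<longleftrightarrow> (\<forall>L. finite L \<longrightarrow> (\<forall>l\<in>L. dyadic_cube l \<and> l \<subseteq> Q) \<longrightarrow> (\<forall>q\<in>K. \<exists>l\<in>L. q \<subseteq> l) \<longrightarrow>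
     c * g (dm Q) \<le> (\<Sum>l\<in>L. g (dm l)))"

text \<open>Discrete form of the divergence of the integral of \<eta>^(d-1) g(\<phi>(\<eta>)),
  sampled at powers of M; the minimum keeps the argument in the range where g is controlled.\<close>

definition divergent :: "real \<Rightarrow> real \<Rightarrow> (real \<Rightarrow> real) \<Rightarrow> bool" where
  "divergent M \<epsilon> g \<longleftrightarrow> \<not> summable (\<lambda>k. (M ^ k) ^ DIM('a) * g (min (\<phi> (M ^ k)) \<epsilon>))"

text \<open>The greedy selection in Q carries total weight at least of order (dm Q)^d = t * g(dm Q).
  A cube l of a dominating family receives weight at most 8^d * t * g(dm l), so summing over the
  family and cancelling t gives the bound, with c independent of Q and N.\<close>

lemma heavy_subcubes:
  obtains M where "2 \<le> M" "\<And>g \<epsilon>. dgauge_on DIM('a) \<epsilon> g \<Longrightarrow> divergent M \<epsilon> g \<Longrightarrow>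
     \<exists>c>0. \<forall>Q N. dyadic_cube Q \<longrightarrow> Q \<subseteq> U \<longrightarrow> dm Q \<le> \<epsilon> \<longrightarrow> finite N \<longrightarrow> (\<exists>K. subcubes N Q K \<and> heavy g c Q K)"
proof -
  define d where "d = DIM('a)"
  have d: "0 < d" by (simp add: d_def)
  obtain \<kappa> where \<kappa>: "0 < \<kappa>" and reg:
    "\<And>c R. 0 < R \<Longrightarrow> nball nrm c R \<subseteq> U \<Longrightarrow> \<exists>h0. \<forall>h>h0. \<exists>P \<subseteq> A \<inter> nball nrm c R. finite P \<and>
       \<kappa> * R ^ d * h ^ d \<le> card P \<and> (\<forall>a\<in>P. H a \<le> h) \<and>
       (\<forall>a\<in>P. \<forall>b\<in>P. a \<noteq> b \<longrightarrow> 1 / h \<le> nrm (a - b))"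
    unfolding d_def by (rule regular_ball) blast
  obtain \<tau> where \<tau>: "\<tau> > 0" "\<And>Q. dyadic_cube Q \<Longrightarrow> \<exists>c. nball nrm c (\<tau> * dm Q) \<subseteq> Q"
    by (rule nball_in_dyadic_cube) blast
  \<comment> \<open>Half of each level is given up to leave room for removing the finite set
    N.\<close>
  define \<kappa>1 where "\<kappa>1 = \<kappa> / 2"
  have \<kappa>1: "0 < \<kappa>1" using \<kappa> by (simp add: \<kappa>1_def)
  define M where "M = max 2 (8 * 6 ^ d / \<kappa>1)"
  have M: "2 \<le> M" "8 * 6 ^ d / \<kappa>1 \<le> M" by (auto simp: M_def)
  show ?thesis
  proof
    show "2 \<le> M" by fact
    fix g \<epsilon> assume g: "dgauge_on DIM('a) \<epsilon> g" and div: "divergent M \<epsilon> g"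
    note g = g[folded d_def]
    note gD = dgauge_onD[OF g]
    define c0 where "c0 = \<kappa>1 / (4 * 4 ^ d)"
    have c0: "0 < c0" using \<kappa>1 by (simp add: c0_def)
    \<comment> \<open>c0 comes from the selection, (\<tau>/2)^d from writing R^d in terms of dm Q,
      and 8^d from the weight that one dominating cube can receive.\<close>
    define C where "C = c0 * (\<tau> / 2) ^ d / 8 ^ d"
    have "\<exists>K. subcubes N Q K \<and> heavy g C Q K"
      if Q: "dyadic_cube Q" "Q \<subseteq> U" "dm Q \<le> \<epsilon>" and N: "finite N" for Q N
    proof -
      have dmQ: "0 < dm Q" using Q by (simp add: dm_pos)
      have gQ: "0 < g (dm Q)" using gD(2) dmQ Q by blast
      obtain c where c: "nball nrm c (\<tau> * dm Q) \<subseteq> Q" using \<tau> Q by blast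
      define R where "R = \<tau> * dm Q / 2"
      have R: "0 < R" "nball nrm c (2 * R) \<subseteq> Q" using \<tau> dmQ c by (auto simp: R_def)
      \<comment> \<open>With this normalization t * g meets r^d at r = dm Q and dominates it at
        smaller scales, so that weights compare with volume and with g at once.\<close>
      define t where "t = dm Q ^ d / g (dm Q)"
      have t: "0 < t" using dmQ gQ by (simp add: t_def)
      have tg: "l ^ d \<le> t * g l" if "0 < l" "l \<le> dm Q" for l
        using gD(4)[OF that Q(3)] that gQ dmQ by (simp add: t_def field_simps)
      define r where "r k = min (\<phi> (M ^ k)) \<epsilon>" for k
      have r: "0 < r k" "r k \<le> \<epsilon>" "r k \<le> \<phi> (M ^ k)" for k
        using \<phi>_pos[of "M ^ k"] M gD(1) by (auto simp: r_def)
      have r_anti: "r k \<le> r i" if "i \<le> k" for i k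
      proof -
        have "M ^ i \<le> M ^ k" using M that by (intro power_increasing) auto
        then have "\<phi> (M ^ k) \<le> \<phi> (M ^ i)" using M by (intro \<phi>_le) auto
        then show ?thesis by (auto simp: r_def)
      qed
      define w where "w k = min (t * g (r k)) (((1 / M) ^ k) ^ d)" for k
      have w: "0 < w k" "w k \<le> ((1 / M) ^ k) ^ d" "w k \<le> t * g (r k)" for k
        using t gD(2) r M by (auto simp: w_def)
      have w_anti: "antimono w"
      proof (rule antimonoI)
        fix i k :: nat assume ik: "i \<le> k"
        have "t * g (r k) \<le> t * g (r i)" using t gD(3) r r_anti[OF ik] by (intro mult_left_mono) auto
        moreover have "((1 / M) ^ k) ^ d \<le> ((1 / M) ^ i) ^ d"
          using M ik by (intro power_mono power_decreasing) auto
        ultimately show "w k \<le> w i" by (auto simp: w_def)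
      qed
      have w_div: "\<not> summable (\<lambda>k. (M ^ k) ^ d * w k)"
      proof -
        have "(M ^ k) ^ d * w k = min (t * ((M ^ k) ^ d * g (r k))) 1" for k
        proof -
          have "(M ^ k) ^ d * ((1 / M) ^ k) ^ d = 1" using M by (simp add: power_divide)
          moreover have "(M ^ k) ^ d * w k = min ((M ^ k) ^ d * (t * g (r k))) ((M ^ k) ^ d * ((1 / M) ^ k) ^ d)"
            unfolding w_def using M by (simp add: min_mult_distrib_left)
          ultimately show ?thesis by (simp add: mult_ac)
        qed
        moreover have "\<not> summable (\<lambda>k. t * ((M ^ k) ^ d * g (r k)))"
          using div t unfolding divergent_def r_def d_def by (subst summable_cmult_iff) auto
        then have "\<not> summable (\<lambda>k. min (t * ((M ^ k) ^ d * g (r k))) 1)"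
          using t M less_imp_le[OF gD(2)[OF r(1,2)]] by (intro not_summable_min_1) auto
        ultimately show ?thesis by simp
      qed
      define \<rho> where "\<rho> k = w k powr (1 / DIM('a))" for k
      have \<rho>d: "\<rho> k ^ d = w k" for k
        using w(1)[of k] d unfolding \<rho>_def d_def[symmetric]
        by (simp add: powr_realpow[symmetric] powr_powr)
      have \<rho>: "0 < \<rho> k" for k using w(1)[of k] by (simp add: \<rho>_def)
      have \<rho>_le: "\<rho> k \<le> (1 / M) ^ k" for k
      proof (rule power_le_imp_le_base[of _ "d - 1"])
        show "\<rho> k ^ Suc (d - 1) \<le> ((1 / M) ^ k) ^ Suc (d - 1)" using d w(2)[of k] \<rho>d[of k] by simp
      qed (use M in simp)
      have \<rho>_anti: "\<rho> k \<le> \<rho> i" if "i \<le> k" for i k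
        unfolding \<rho>_def using antimonoD[OF w_anti that] w(1)[of k] by (intro powr_mono2) auto
      have "nball nrm c R \<subseteq> nball nrm c (2 * R)" using R(1) by (auto simp: mem_nball)
      then have "nball nrm c R \<subseteq> U" using R(2) Q(2) by blast
      from reg[OF R(1) this] obtain h0 where h0: "\<And>h. h > h0 \<Longrightarrow> \<exists>P \<subseteq> A \<inter> nball nrm c R. finite P \<and>
         \<kappa> * R ^ d * h ^ d \<le> card P \<and> (\<forall>a\<in>P. H a \<le> h) \<and>
         (\<forall>a\<in>P. \<forall>b\<in>P. a \<noteq> b \<longrightarrow> 1 / h \<le> nrm (a - b))" by blast
      \<comment> \<open>From this level on the regularity estimate holds, the spacing is at most R
        and dm Q, and N has at most half the guaranteed number of points.\<close>
      obtain k0 where k0: "Max {h0, 1 / R, 1 / dm Q, card N / (\<kappa>1 * R ^ d)} < M ^ k0"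
        using real_arch_pow[of M "Max {h0, 1 / R, 1 / dm Q, card N / (\<kappa>1 * R ^ d)}"] M by auto
      have Mk: "M ^ k0 \<le> M ^ k" if "k0 \<le> k" for k using M that by (intro power_increasing) auto
      have small: "(1 / M) ^ k \<le> R" "(1 / M) ^ k \<le> dm Q" "h0 < M ^ k" if "k0 \<le> k" for k
      proof -
        have "1 / R < M ^ k" "1 / dm Q < M ^ k" "h0 < M ^ k" using k0 Mk[OF that] by auto
        then show "(1 / M) ^ k \<le> R" "(1 / M) ^ k \<le> dm Q" "h0 < M ^ k"
          using R dmQ M by (auto simp: power_divide field_simps)
      qed
      have cN: "card N \<le> \<kappa>1 * R ^ d * (M ^ k) ^ d" if "k0 \<le> k" for k
      proof -
        have "card N / (\<kappa>1 * R ^ d) < M ^ k" using k0 Mk[OF that] by auto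
        also have "M ^ k \<le> (M ^ k) ^ d" using M d by (intro self_le_power) auto
        finally show ?thesis using \<kappa>1 R by (simp add: field_simps)
      qed
      have "\<exists>P \<subseteq> A \<inter> nball nrm c R. finite P \<and>
         \<kappa> * R ^ d * (M ^ k) ^ d \<le> card P \<and> (\<forall>a\<in>P. H a \<le> M ^ k) \<and>
         (\<forall>a\<in>P. \<forall>b\<in>P. a \<noteq> b \<longrightarrow> 1 / M ^ k \<le> nrm (a - b))" if "k0 \<le> k" for k
        using h0 small(3)[OF that] by blast
      then obtain P0 where P0: "\<And>k. k0 \<le> k \<Longrightarrow> P0 k \<subseteq> A \<inter> nball nrm c R \<and> finite (P0 k) \<and>
         \<kappa> * R ^ d * (M ^ k) ^ d \<le> card (P0 k) \<and> (\<forall>a\<in>P0 k. H a \<le> M ^ k) \<and>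
         (\<forall>a\<in>P0 k. \<forall>b\<in>P0 k. a \<noteq> b \<longrightarrow> 1 / M ^ k \<le> nrm (a - b))"
        by metis
      define P where "P k = P0 k - N" for k
      have P: "finite (P k)" "\<kappa>1 * R ^ d * (M ^ k) ^ d \<le> card (P k)"
        "\<And>a. a \<in> P k \<Longrightarrow> a \<in> A - N \<and> nrm (a - c) < R \<and> H a \<le> M ^ k"
        "\<And>a b. a \<in> P k \<Longrightarrow> b \<in> P k \<Longrightarrow> a \<noteq> b \<Longrightarrow> (1 / M) ^ k \<le> nrm (a - b)" if "k0 \<le> k" for k
      proof -
        have "card (P0 k) - card N \<le> card (P k)" unfolding P_def by (rule diff_card_le_card_Diff[OF N])
        then have "real (card (P0 k)) \<le> card (P k) + card N" by linarith
        then show "\<kappa>1 * R ^ d * (M ^ k) ^ d \<le> card (P k)"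
          using P0[OF that] cN[OF that] unfolding \<kappa>1_def by (simp add: field_simps)
      qed (use P0[OF that] in \<open>auto simp: P_def mem_nball power_divide\<close>)
      obtain n where n: "c0 * R ^ d < (\<Sum>(a, k)\<in>select P \<rho> k0 n. w k)"
      proof (rule selection[of M \<kappa>1 R k0 P c w, folded \<rho>_def, folded d_def, folded c0_def])
        show "nrm (a - c) \<le> R" if "k0 \<le> k" "a \<in> P k" for k a using P(3)[OF that] by simp
      qed (use M \<kappa>1 R(1) small(1)[of k0] P(1,2,4) w w_anti w_div in auto)
      define S where "S = select P \<rho> k0 n"
      have finS: "finite S" unfolding S_def using P(1) by (rule finite_select)
      have S: "k0 \<le> k" "a \<in> P k" if "(a, k) \<in> S" for a k
        using that select_level unfolding S_def by blast+
      have sepS: "max (\<rho> (snd x)) (\<rho> (snd y)) \<le> nrm (fst x - fst y)" if "x \<in> S" "y \<in> S" "x \<noteq> y" for x y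
        using that unfolding S_def
        by (intro select_separated[of k0 P \<rho>] order.trans[OF \<rho>_le] P(4) \<rho>_anti) auto
      \<comment> \<open>The cubes must fit into balls of radius r k and be disjoint, which \<rho> k
        controls. A quarter of r' achieves both, and dyadic rounding loses another factor 2: hence
        the 8 in the lower bound.\<close>
      define r' where "r' k = min (r k) (\<rho> k)" for k
      have r': "0 < r' k" for k using r \<rho> by (simp add: r'_def)
      have "\<exists>j::int. r' k / 8 < udiam * 2 powr (- real_of_int j) \<and> udiam * 2 powr (- real_of_int j) \<le> r' k / 4" for k
      proof -
        obtain j :: int where "r' k / 4 / 2 < udiam * 2 powr (- real_of_int j)" "udiam * 2 powr (- real_of_int j) \<le> r' k / 4"
          by (rule cub_diam_less[of "r' k / 4"]) (use r'[of k] in auto)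
        then show ?thesis by auto
      qed
      then obtain j :: "nat \<Rightarrow> int" where j: "\<And>k. r' k / 8 < udiam * 2 powr (- real_of_int (j k)) \<and> udiam * 2 powr (- real_of_int (j k)) \<le> r' k / 4"
        by metis
      define q where "q x = cub (j (snd x)) (fst x)" for x :: "'a \<times> nat"
      have q: "dyadic_cube (q x)" "fst x \<in> q x" "r' (snd x) / 8 < dm (q x)" "dm (q x) \<le> r' (snd x) / 4" for x
        using j[of "snd x"] by (auto simp: q_def dm_cub)
      have qlt: "dm (q x) < \<rho> (snd x) / 2" "dm (q x) < r (snd x)" for x
        using q(4)[of x] \<rho>[of "snd x"] r(1)[of "snd x"] unfolding r'_def by linarith+
      have disj: "q x \<inter> q y = {}" if "x \<in> S" "y \<in> S" "x \<noteq> y" for x y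
      proof (rule ccontr)
        assume "q x \<inter> q y \<noteq> {}"
        then obtain z where z: "z \<in> q x" "z \<in> q y" by blast
        have "nrm (fst x - fst y) \<le> nrm (fst x - z) + nrm (z - fst y)" by (rule nrm_diff_triangle)
        also have "\<dots> \<le> dm (q x) + dm (q y)" using z q(1,2) by (intro add_mono nrm_le_dm) auto
        also have "\<dots> < max (\<rho> (snd x)) (\<rho> (snd y))" using qlt[of x] qlt[of y] by auto
        finally show False using sepS[OF that] by simp
      qed
      have clQ: "closure (q x) \<subseteq> Q" and dmq: "dm (q x) \<le> dm Q / 2"
        and ball: "\<exists>a\<in>A - N. q x \<subseteq> nball nrm a (\<phi> (H a))" if x: "x \<in> S" for x
      proof -
        obtain a k where ak: "x = (a, k)" by force
        note S = S[OF x[unfolded ak]]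
        note Pa = P(3)[OF S]
        have "dm (q x) < (1 / M) ^ k / 2" using qlt(1)[of x] \<rho>_le[of k] ak by auto
        then have l: "dm (q x) < R" "dm (q x) < dm Q / 2" using small[OF S(1)] R dmQ by auto
        show "closure (q x) \<subseteq> Q"
        proof
          fix y assume "y \<in> closure (q x)"
          then have "nrm (y - a) \<le> dm (q x)" using q ak by (intro closure_dyadic_cube) auto
          then have "nrm (y - c) < 2 * R" using nrm_diff_triangle[of y c a] l Pa by linarith
          then show "y \<in> Q" using R(2) by (auto simp: mem_nball)
        qed
        show "dm (q x) \<le> dm Q / 2" using l by simp
        have "q x \<subseteq> nball nrm a (\<phi> (H a))"
        proof
          fix y assume "y \<in> q x"
          then have "nrm (y - a) \<le> dm (q x)" using q[of x] ak by (intro nrm_le_dm) auto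
          also have "\<dots> < r k" using qlt(2)[of x] ak by simp
          also have "\<dots> \<le> \<phi> (M ^ k)" by (rule r)
          also have "\<dots> \<le> \<phi> (H a)" using Pa H_pos[of a] by (intro \<phi>_le) auto
          finally show "y \<in> nball nrm a (\<phi> (H a))" by (simp add: mem_nball)
        qed
        then show "\<exists>a\<in>A - N. q x \<subseteq> nball nrm a (\<phi> (H a))" using Pa by blast
      qed
      have "subcubes N Q (q ` S)"
        unfolding subcubes_def
      proof (intro conjI)
        show "disjoint (q ` S)" using disj by (force simp: pairwise_def disjnt_def)
      qed (use finS clQ dmq ball q in auto)
      moreover have "heavy g C Q (q ` S)"
        unfolding heavy_def
      proof (intro allI impI)
        fix L assume L: "finite L" "\<forall>l\<in>L. dyadic_cube l \<and> l \<subseteq> Q" "\<forall>q\<in>q ` S. \<exists>l\<in>L. q \<subseteq> l"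
        define T where "T l = {x \<in> S. q x \<subseteq> l}" for l
        have mass: "(\<Sum>x\<in>T l. w (snd x)) \<le> 8 ^ d * (t * g (dm l))" if l: "l \<in> L" for l
        proof -
          have dl: "dyadic_cube l" "0 < dm l" "dm l \<le> dm Q" using l L dm_pos dm_mono Q by auto
          have lt: "dm l ^ d \<le> t * g (dm l)" using tg dl by blast
          have gl: "0 < g (dm l)" using gD(2) dl Q by auto
          have finT: "finite (T l)" using finS by (simp add: T_def)
          show ?thesis
          \<comment> \<open>If l contains one selected cube, the doubling property or t * g \<ge>
            r^d compares the two. If it contains two, separation makes every radius \<rho> in it at
            most dm l, and packing bounds their total weight by a multiple of (dm l)^d.\<close>
          proof (cases "\<exists>x. T l \<subseteq> {x}")
            case True
            then consider "T l = {}" | x where "T l = {x}" by auto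
            then show ?thesis
            proof cases
              case 1 then show ?thesis using t gl by simp
            next
              case 2
              then have "q x \<subseteq> l" by (auto simp: T_def)
              then have "dm (q x) \<le> dm l" using q dl by (intro dm_mono) auto
              then have r'l: "r' (snd x) \<le> 8 * dm l" using q(3)[of x] by linarith
              have "w (snd x) \<le> 8 ^ d * (t * g (dm l))"
              proof (cases "r (snd x) \<le> \<rho> (snd x)")
                case True
                then have "r (snd x) \<le> 8 * dm l" using r'l by (simp add: r'_def)
                then have "g (r (snd x)) \<le> 8 ^ d * g (dm l)"
                  using dgauge_on_scale[OF g r(1) _ _ dl(2) _ r(2)] dl Q by auto
                then have "t * g (r (snd x)) \<le> t * (8 ^ d * g (dm l))" using t by (intro mult_left_mono) auto
                then show ?thesis using w(3)[of "snd x"] by (simp add: mult_ac)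
              next
                case False
                then have "\<rho> (snd x) \<le> 8 * dm l" using r'l by (simp add: r'_def)
                then have "\<rho> (snd x) ^ d \<le> (8 * dm l) ^ d" using \<rho>[of "snd x"] by (intro power_mono) auto
                also have "\<dots> = 8 ^ d * dm l ^ d" by (rule power_mult_distrib)
                also have "\<dots> \<le> 8 ^ d * (t * g (dm l))" using lt by (intro mult_left_mono) auto
                finally show ?thesis by (simp add: \<rho>d)
              qed
              then show ?thesis using 2 by simp
            qed
          next
            case False
            then have two: "\<exists>y\<in>T l. y \<noteq> x" for x by blast
            obtain x0 where x0: "x0 \<in> T l" using two by blast
            have inl: "fst x \<in> l" if "x \<in> T l" for x using that q(2)[of x] by (auto simp: T_def)
            have \<rho>l: "\<rho> (snd x) \<le> dm l" if x: "x \<in> T l" for x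
            proof -
              obtain y where y: "y \<in> T l" "y \<noteq> x" using two by blast
              then have "max (\<rho> (snd x)) (\<rho> (snd y)) \<le> nrm (fst x - fst y)"
                using x by (intro sepS) (auto simp: T_def)
              also have "\<dots> \<le> dm l" using inl x y dl by (intro nrm_le_dm) auto
              finally show ?thesis by simp
            qed
            have "(\<Sum>x\<in>T l. \<rho> (snd x) ^ DIM('a)) \<le> (2 * dm l + dm l) ^ DIM('a)"
            proof (rule packing[where p = fst and x = "fst x0"])
              show "inj_on fst (T l)"
              proof (rule inj_onI, rule ccontr)
                fix x y assume "x \<in> T l" "y \<in> T l" "fst x = fst y" "x \<noteq> y"
                then show False using sepS[of x y] \<rho>[of "snd x"] by (auto simp: T_def)
              qed
              show "max (\<rho> (snd x)) (\<rho> (snd y)) \<le> nrm (fst x - fst y)" if "x \<in> T l" "y \<in> T l" "x \<noteq> y" for x y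
                using that by (intro sepS) (auto simp: T_def)
              show "nrm (fst x - fst x0) \<le> dm l" if "x \<in> T l" for x
                using inl that x0 dl by (intro nrm_le_dm) auto
            qed (use finT \<rho> \<rho>l dl in auto)
            then have "(\<Sum>x\<in>T l. w (snd x)) \<le> 3 ^ d * dm l ^ d"
              unfolding d_def[symmetric] \<rho>d by (simp add: power_mult_distrib)
            also have "\<dots> \<le> 8 ^ d * dm l ^ d" using dl by (intro mult_right_mono power_mono) auto
            also have "\<dots> \<le> 8 ^ d * (t * g (dm l))" using lt by (intro mult_left_mono) auto
            finally show ?thesis .
          qed
        qed
        have "c0 * R ^ d \<le> (\<Sum>x\<in>S. w (snd x))" using n by (simp add: S_def case_prod_beta)
        also have "\<dots> \<le> (\<Sum>x\<in>(\<Union>l\<in>L. T l). w (snd x))"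
        proof (rule sum_mono2)
          show "finite (\<Union>l\<in>L. T l)" using L finS by (auto simp: T_def)
          show "S \<subseteq> (\<Union>l\<in>L. T l)" using L(3) by (auto simp: T_def)
        qed (use less_imp_le[OF w(1)] in auto)
        also have "\<dots> \<le> (\<Sum>l\<in>L. \<Sum>x\<in>T l. w (snd x))"
          using L(1) finS less_imp_le[OF w(1)] by (intro sum_UN_le) (auto simp: T_def)
        also have "\<dots> \<le> (\<Sum>l\<in>L. 8 ^ d * (t * g (dm l)))" by (intro sum_mono mass)
        also have "\<dots> = 8 ^ d * t * (\<Sum>l\<in>L. g (dm l))" by (simp add: sum_distrib_left mult.assoc)
        finally have "c0 * (\<tau> / 2) ^ d * dm Q ^ d \<le> 8 ^ d * (dm Q ^ d / g (dm Q)) * (\<Sum>l\<in>L. g (dm l))"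
          by (simp add: R_def t_def power_mult_distrib power_divide mult_ac)
        then show "C * g (dm Q) \<le> (\<Sum>l\<in>L. g (dm l))"
          unfolding C_def using dmQ gQ by (simp add: field_simps)
      qed
      ultimately show ?thesis by blast
    qed
    moreover have "0 < C" using c0 \<tau> by (simp add: C_def)
    ultimately show "\<exists>c>0. \<forall>Q N. dyadic_cube Q \<longrightarrow> Q \<subseteq> U \<longrightarrow> dm Q \<le> \<epsilon> \<longrightarrow> finite N \<longrightarrow> (\<exists>K. subcubes N Q K \<and> heavy g c Q K)"
      by blast
  qed
qed

end

section \<open>Sharpening the constant\<close>

text \<open>Sums over index sets are read as measures of a weighted counting space, so that
  splitting and regrouping them are instances of (sub)additivity.\<close>

lemma emeasure_density_count_space:
  "emeasure (density (count_space UNIV) f) I = (\<integral>\<^sup>+i. f i \<partial>count_space I)"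
  by (cases "I = UNIV") (simp_all add: emeasure_density nn_integral_count_space_indicator)

lemma nn_integral_count_space_Un_le:
  "(\<integral>\<^sup>+i. f i \<partial>count_space (I \<union> J)) \<le> (\<integral>\<^sup>+i. f i \<partial>count_space I) + (\<integral>\<^sup>+i. f i \<partial>count_space J)"
  by (simp add: emeasure_subadditive flip: emeasure_density_count_space)

lemma nn_integral_count_space_inj:
  "inj_on g I \<Longrightarrow> (\<integral>\<^sup>+i. f i \<partial>count_space (g ` I)) = (\<integral>\<^sup>+i. f (g i) \<partial>count_space I)"
  by (subst nn_integral_bij_count_space[symmetric, of g I]) (auto simp: inj_on_imp_bij_betw)

lemma nn_integral_count_space_UN:
  assumes "countable K" "disjoint_family_on X K"
  shows "(\<integral>\<^sup>+i. f i \<partial>count_space (\<Union>k\<in>K. X k)) = (\<integral>\<^sup>+k. (\<integral>\<^sup>+i. f i \<partial>count_space (X k)) \<partial>count_space K)"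
  using assms emeasure_UN_countable[of K X "density (count_space UNIV) f"]
  by (simp add: emeasure_density_count_space)

text \<open>Covers arise as families over convenient countable index types, whereas the definitions
  ask for sequences. Vacant positions are filled with the empty set, which costs nothing when f {} =
  0.\<close>

lemma countable_family_sequence:
  fixes D :: "'i \<Rightarrow> 'b set"
  assumes "countable I"
  obtains C :: "nat \<Rightarrow> 'b set" where "\<And>n. C n = {} \<or> (\<exists>i\<in>I. C n = D i)" "(\<Union>n. C n) = (\<Union>i\<in>I. D i)"
    "\<And>f :: 'b set \<Rightarrow> ennreal. f {} = 0 \<Longrightarrow> (\<Sum>n. f (C n)) = (\<integral>\<^sup>+i. f (D i) \<partial>count_space I)"
proof
  let ?g = "to_nat_on I"
  have inj: "inj_on ?g I" using assms by (rule inj_on_to_nat_on)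
  define C where "C n = (if n \<in> ?g ` I then D (inv_into I ?g n) else {})" for n
  have Cg: "C (?g i) = D i" if "i \<in> I" for i using that inj by (simp add: C_def)
  show "C n = {} \<or> (\<exists>i\<in>I. C n = D i)" for n by (auto simp: C_def inv_into_into)
  show "(\<Union>n. C n) = (\<Union>i\<in>I. D i)"
  proof
    show "(\<Union>n. C n) \<subseteq> (\<Union>i\<in>I. D i)" using Cg by (fastforce simp: C_def split: if_splits)
    show "(\<Union>i\<in>I. D i) \<subseteq> (\<Union>n. C n)" using Cg by blast
  qed
  fix f :: "'b set \<Rightarrow> ennreal" assume f: "f {} = 0"
  have "(\<Sum>n. f (C n)) = (\<integral>\<^sup>+n. f (C n) \<partial>count_space UNIV)" by (simp add: nn_integral_count_space_nat)
  also have "\<dots> = (\<integral>\<^sup>+n. f (C n) \<partial>count_space (?g ` I))"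
    by (rule nn_integral_count_space_eq) (auto simp: C_def f)
  also have "\<dots> = (\<integral>\<^sup>+i. f (C (?g i)) \<partial>count_space I)" using inj by (rule nn_integral_count_space_inj)
  also have "\<dots> = (\<integral>\<^sup>+i. f (D i) \<partial>count_space I)" by (rule nn_integral_cong) (simp add: Cg)
  finally show "(\<Sum>n. f (C n)) = (\<integral>\<^sup>+i. f (D i) \<partial>count_space I)" .
qed

text \<open>Cross-multiplied monotonicity of \<open>min v t / v\<close>. Summed over truncation
  levels it yields the sublinearity of \<theta>, both for damping and for boosting.\<close>

lemma min_div_antimono:
  fixes u v t :: real assumes "0 < u" "u \<le> v" "0 \<le> t"
  shows "min v t * u \<le> min u t * v"
proof (cases "t \<le> u")
  case True then show ?thesis using assms by (simp add: min_def mult_left_mono)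
next
  case False then show ?thesis using assms by (auto simp: min_def mult_left_mono mult_right_mono mult.commute)
qed

text \<open>The damping function \<open>\<theta>(v) = \<Sum>j. 2^-j min v (t j)\<close> is sublinear,
  and the truncation levels \<open>t j\<close> are chosen so that the series still diverges.\<close>

lemma divergent_damping:
  fixes m r :: "nat \<Rightarrow> real"
  assumes g: "dgauge_on d \<epsilon> g" and m: "\<And>k. 0 \<le> m k" and r: "\<And>k. 0 < r k" "\<And>k. r k \<le> \<epsilon>"
    and div: "\<not> summable (\<lambda>k. m k * g (r k))"
    and unbounded: "\<And>B. \<exists>\<delta>>0. \<forall>x. 0 < x \<longrightarrow> x \<le> \<delta> \<longrightarrow> B \<le> g x / x ^ d"
  obtains g' where "dgauge_on d \<epsilon> g'" "\<not> summable (\<lambda>k. m k * g' (r k))"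
    "\<And>B. \<exists>\<delta>>0. \<forall>x. 0 < x \<longrightarrow> x \<le> \<delta> \<longrightarrow> x \<le> \<epsilon> \<longrightarrow> B * g' x \<le> g x"
proof -
  note gD = dgauge_onD[OF g]
  define u where "u x = g x / x ^ d" for x
  have u: "0 < u x" if "0 < x" "x \<le> \<epsilon>" for x using gD(2)[OF that] that by (simp add: u_def)
  have gu: "g x = x ^ d * u x" if "0 < x" for x using that by (simp add: u_def)
  have pos: "0 \<le> m k * g (r k)" for k
    by (rule mult_nonneg_nonneg[OF m less_imp_le[OF gD(2)[OF r]]])
  \<comment> \<open>Partial sums up to K j reach 4^j; the weight 2^-j in \<theta> still leaves 2^j,
    so the damped partial sums are unbounded.\<close>
  have "\<exists>K. 4 ^ j \<le> (\<Sum>k<K. m k * g (r k))" for j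
  proof (rule ccontr)
    assume "\<not> ?thesis"
    then have "(\<Sum>k<K. m k * g (r k)) \<le> 4 ^ j" for K by (simp add: not_le less_imp_le)
    then have "summable (\<lambda>k. m k * g (r k))" by (rule summableI_nonneg_bounded[OF pos])
    then show False using div by simp
  qed
  then obtain K where K: "\<And>j. 4 ^ j \<le> (\<Sum>k<K j. m k * g (r k))" by metis
  \<comment> \<open>Large enough for the truncation at t j to be inactive at all k < K j; the
    summand 1 keeps the levels away from 0.\<close>
  define t where "t j = 1 + (\<Sum>k<K j. u (r k))" for j
  have u_r: "0 \<le> u (r k)" for k using u r less_imp_le by blast
  have t: "1 \<le> t j" for j unfolding t_def using u_r by (simp add: sum_nonneg)
  have ut: "u (r k) \<le> t j" if "k < K j" for j k
  proof -
    have "u (r k) \<le> (\<Sum>k<K j. u (r k))" using that u_r by (intro member_le_sum) auto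
    then show ?thesis by (simp add: t_def)
  qed
  define \<theta> where "\<theta> v = (\<Sum>j. (1/2) ^ j * min v (t j))" for v
  have geo: "summable (\<lambda>j. (1/2::real) ^ j * v)" for v
    by (intro summable_mult2 summable_geometric) simp
  have sm: "summable (\<lambda>j. (1/2) ^ j * min v (t j))" if "0 \<le> v" for v
    by (rule summable_comparison_test'[OF geo[of v], of 0])
       (use that t order_trans[OF zero_le_one t] in \<open>auto simp: abs_mult intro!: mult_left_mono\<close>)
  have \<theta>_term: "(1/2) ^ j * min v (t j) \<le> \<theta> v" if "0 \<le> v" for v j
    unfolding \<theta>_def using that t order_trans[OF zero_le_one t]
    by (intro order_trans[OF _ sum_le_suminf[OF sm, of v "{j}"]]) auto
  have \<theta>_pos: "0 < \<theta> v" if "0 < v" for v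
    using \<theta>_term[of v 0] that t[of 0] by simp
  have \<theta>_mono: "\<theta> v \<le> \<theta> v'" if "0 \<le> v" "v \<le> v'" for v v'
    unfolding \<theta>_def using that by (intro suminf_le sm mult_left_mono) auto
  have \<theta>_sub: "\<theta> v' * v \<le> \<theta> v * v'" if "0 < v" "v \<le> v'" for v v'
  proof -
    have "\<theta> v' * v = (\<Sum>j. (1/2) ^ j * min v' (t j) * v)"
      unfolding \<theta>_def using that by (intro suminf_mult2 sm) auto
    also have "\<dots> \<le> (\<Sum>j. (1/2) ^ j * min v (t j) * v')"
    proof (intro suminf_le)
      fix j
      have "min v' (t j) * v \<le> min v (t j) * v'" using that t[of j] by (intro min_div_antimono) auto
      then show "(1/2) ^ j * min v' (t j) * v \<le> (1/2) ^ j * min v (t j) * v'"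
        by (simp add: mult.assoc)
    qed (use that in \<open>auto intro!: summable_mult2 sm\<close>)
    also have "\<dots> = \<theta> v * v'"
      unfolding \<theta>_def using that by (intro suminf_mult2[symmetric] sm) auto
    finally show ?thesis .
  qed
  \<comment> \<open>For fixed J the terms below J stay bounded and the remaining ones sum to at most
    2 * 2^-J * v, so \<theta>(v)/v tends to 0.\<close>
  have \<theta>_small: "\<exists>v0. \<forall>v\<ge>v0. B * \<theta> v \<le> v" if "0 < B" for B
  proof -
    obtain J where J: "(1/2::real) ^ J < 1 / (4 * B)"
      using real_arch_pow_inv[of "1 / (4 * B)" "1/2"] \<open>0 < B\<close> by auto
    define c where "c = (\<Sum>j<J. (1/2) ^ j * t j)"
    have "\<theta> v \<le> c + v * (2 * (1/2) ^ J)" if "0 \<le> v" for v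
    proof -
      have "\<theta> v = (\<Sum>j<J. (1/2) ^ j * min v (t j)) + (\<Sum>j. (1/2) ^ (j + J) * min v (t (j + J)))"
        unfolding \<theta>_def using suminf_split_initial_segment[OF sm[OF that], of J] by simp
      also have "(\<Sum>j<J. (1/2) ^ j * min v (t j)) \<le> c"
        unfolding c_def by (intro sum_mono mult_left_mono) auto
      also have "(\<Sum>j. (1/2) ^ (j + J) * min v (t (j + J))) \<le> (\<Sum>j. (1/2) ^ j * ((1/2) ^ J * v))"
      proof (intro suminf_le)
        show "summable (\<lambda>j. (1/2) ^ (j + J) * min v (t (j + J)))"
          using summable_ignore_initial_segment[OF sm[OF that], of J] by simp
      qed (auto simp: power_add intro!: geo mult_left_mono)
      also have "\<dots> = (\<Sum>j. (1/2::real) ^ j) * ((1/2) ^ J * v)"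
        by (intro suminf_mult2[symmetric] summable_geometric) simp
      also have "(\<Sum>j. (1/2::real) ^ j) = 2" by (subst suminf_geometric) auto
      finally show ?thesis by (simp add: mult_ac)
    qed
    note le = this
    have "B * \<theta> v \<le> v" if v: "2 * B * c \<le> v" for v
    proof -
      have "0 \<le> c" unfolding c_def using order_trans[OF zero_le_one t] by (intro sum_nonneg) auto
      then have "0 \<le> 2 * B * c" using \<open>0 < B\<close> by simp
      then have v0: "0 \<le> v" using v by linarith
      then have "B * \<theta> v \<le> B * (c + v * (2 * (1/2) ^ J))" using le \<open>0 < B\<close> by (intro mult_left_mono) auto
      also have "\<dots> \<le> B * (c + v * (2 * (1 / (4 * B))))"
        using J v0 \<open>0 < B\<close> by (intro mult_left_mono add_left_mono) auto
      also have "\<dots> = B * c + v / 2" using \<open>0 < B\<close> by (simp add: field_simps)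
      also have "\<dots> \<le> v" using v by simp
      finally show ?thesis .
    qed
    then show ?thesis by blast
  qed
  \<comment> \<open>\<theta> acts on the ratio g(x)/x^d: since \<theta> increases, the new ratio
    still decreases; since \<theta>(v)/v decreases, the new gauge still increases.\<close>
  define g' where "g' x = x ^ d * \<theta> (u x)" for x
  show ?thesis
  proof
    show "dgauge_on d \<epsilon> g'"
      unfolding dgauge_on_def
    proof (intro conjI allI impI)
      show "0 < \<epsilon>" by (rule gD)
      show "0 < g' x" if "0 < x" "x \<le> \<epsilon>" for x using that u \<theta>_pos by (simp add: g'_def)
      fix x y assume xy: "0 < x" "x \<le> y" "y \<le> \<epsilon>"
      have uxy: "0 < u x" "0 < u y" "u y \<le> u x" using gD(4)[OF xy] xy u by (auto simp: u_def)
      have "g' x * u y = x ^ d * (\<theta> (u x) * u y)" by (simp add: g'_def)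
      also have "\<dots> \<le> x ^ d * (\<theta> (u y) * u x)"
        using \<theta>_sub[of "u y" "u x"] uxy xy by (intro mult_left_mono) auto
      also have "\<dots> = \<theta> (u y) * g x" using xy by (simp add: gu)
      also have "\<dots> \<le> \<theta> (u y) * g y" using gD(3)[OF xy] \<theta>_pos uxy less_imp_le by (intro mult_left_mono) auto
      also have "\<dots> = g' y * u y" using xy by (simp add: gu g'_def)
      finally show "g' x \<le> g' y" using uxy by simp
      show "g' y / y ^ d \<le> g' x / x ^ d" using \<theta>_mono[of "u y" "u x"] uxy xy by (simp add: g'_def)
    qed
    show "\<not> summable (\<lambda>k. m k * g' (r k))"
    proof
      assume s: "summable (\<lambda>k. m k * g' (r k))"
      have nn: "0 \<le> m k * g' (r k)" for k
        using m[of k] r(1)[of k] \<theta>_pos[OF u[OF r], of k] by (simp add: g'_def)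
      have "2 ^ j \<le> (\<Sum>k. m k * g' (r k))" for j
      proof -
        have "(2::real) ^ j = (1/2) ^ j * 4 ^ j" by (simp flip: power_mult_distrib)
        also have "\<dots> \<le> (1/2) ^ j * (\<Sum>k<K j. m k * g (r k))" by (intro mult_left_mono K) simp
        also have "\<dots> = (\<Sum>k<K j. m k * (r k ^ d * ((1/2) ^ j * u (r k))))"
          using r by (simp add: sum_distrib_left gu mult_ac)
        also have "\<dots> \<le> (\<Sum>k<K j. m k * g' (r k))"
        proof (intro sum_mono)
          fix k assume "k \<in> {..<K j}"
          then have "u (r k) \<le> t j" using ut by simp
          then have "(1/2) ^ j * u (r k) \<le> \<theta> (u (r k))" using \<theta>_term[OF u_r[of k], of j] by (simp add: min_def)
          then show "m k * (r k ^ d * ((1/2) ^ j * u (r k))) \<le> m k * g' (r k)"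
            unfolding g'_def using m[of k] r(1)[of k] by (intro mult_left_mono) auto
        qed
        also have "\<dots> \<le> (\<Sum>k. m k * g' (r k))" using nn by (intro sum_le_suminf[OF s]) auto
        finally show ?thesis .
      qed
      moreover obtain j where "(\<Sum>k. m k * g' (r k)) < 2 ^ j"
        using real_arch_pow[of 2] by auto
      ultimately show False by (meson not_le)
    qed
    fix B :: real
    define B' where "B' = max B 1"
    have "0 < B'" by (simp add: B'_def)
    obtain v0 where v0: "\<And>v. v0 \<le> v \<Longrightarrow> B' * \<theta> v \<le> v" using \<theta>_small[OF \<open>0 < B'\<close>] by blast
    obtain \<delta> where \<delta>: "\<delta> > 0" "\<And>x. 0 < x \<Longrightarrow> x \<le> \<delta> \<Longrightarrow> v0 \<le> g x / x ^ d" using unbounded by blast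
    have "B * g' x \<le> g x" if x: "0 < x" "x \<le> \<delta>" "x \<le> \<epsilon>" for x
    proof -
      have "B * \<theta> (u x) \<le> B' * \<theta> (u x)"
        using \<theta>_pos[OF u[OF x(1,3)]] by (intro mult_right_mono) (auto simp: B'_def)
      also have "\<dots> \<le> u x" using \<delta>(2)[OF x(1,2)] by (intro v0) (simp add: u_def)
      finally have "x ^ d * (B * \<theta> (u x)) \<le> x ^ d * u x" using x by (intro mult_left_mono) auto
      then show ?thesis using gu[OF x(1)] by (simp add: g'_def mult_ac)
    qed
    then show "\<exists>\<delta>>0. \<forall>x. 0 < x \<longrightarrow> x \<le> \<delta> \<longrightarrow> x \<le> \<epsilon> \<longrightarrow> B * g' x \<le> g x" using \<delta>(1) by blast
  qed
qed

lemma (in euclidean_norm) dyadic_subdivision: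
  assumes Q: "dyadic_cube Q" and "0 < \<delta>"
  obtains \<R> where "finite \<R>" "disjoint \<R>" "\<Union>\<R> = Q"
    "\<And>R. R \<in> \<R> \<Longrightarrow> dyadic_cube R \<and> dm R \<le> \<delta>" "\<And>l R. dyadic_cube l \<Longrightarrow> R \<in> \<R> \<Longrightarrow> l \<subseteq> R \<or> R \<subseteq> l \<or> l \<inter> R = {}"
proof -
  obtain i x where Qx: "Q = cub i x" using Q by (rule dyadic_cubeE)
  obtain j1 where j1: "udiam * 2 powr (- real_of_int j1) \<le> \<delta>" using cub_diam_less[OF \<open>0 < \<delta>\<close>] by blast
  define j where "j = max i j1"
  show ?thesis
  proof
    have sub: "cub j y \<subseteq> Q" if "y \<in> Q" for y
      using cub_antimono[of i j y] cub_eqI[of y i x] that by (simp add: Qx j_def)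
    have "Q \<subseteq> nball nrm x (dm Q + 1)"
    proof
      fix y assume "y \<in> Q"
      then have "nrm (y - x) \<le> dm Q" using Q by (intro nrm_le_dm) (auto simp: Qx)
      then show "y \<in> nball nrm x (dm Q + 1)" by (simp add: mem_nball)
    qed
    then show "finite (cub j ` Q)" using dm_pos[OF Q] by (intro cubes_count(1)) auto
    show "disjoint (cub j ` Q)" by (auto simp: pairwise_def disjnt_def dest: cub_eqI)
    show "\<Union>(cub j ` Q) = Q" using sub by auto
    fix R assume R: "R \<in> cub j ` Q"
    have "udiam * 2 powr (- real_of_int j) \<le> udiam * 2 powr (- real_of_int j1)"
      using udiam_pos by (intro mult_left_mono) (auto simp: j_def)
    then have "udiam * 2 powr (- real_of_int j) \<le> \<delta>" using j1 by linarith
    then show "dyadic_cube R \<and> dm R \<le> \<delta>" using R by (auto simp: dm_cub)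
    then show "l \<subseteq> R \<or> R \<subseteq> l \<or> l \<inter> R = {}" if "dyadic_cube l" for l
      using dyadic_cubes_nested that by blast
  qed
qed

context regular_approximation begin

definition unbounded :: "(real \<Rightarrow> real) \<Rightarrow> bool" where
  "unbounded g \<longleftrightarrow> (\<forall>B. \<exists>\<delta>>0. \<forall>x. 0 < x \<longrightarrow> x \<le> \<delta> \<longrightarrow> B \<le> g x / x ^ DIM('a))"

text \<open>Passing to a damped gauge \<open>g'\<close> and to a deep dyadic level, where \<open>g\<close> dominates a large multiple
  of \<open>g'\<close>, turns the constant \<open>c\<close> into \<open>1\<close>.\<close>

lemma heavy_subcubes_exact:
  obtains M where "2 \<le> M" "\<And>g \<epsilon> Q N. dgauge_on DIM('a) \<epsilon> g \<Longrightarrow> divergent M \<epsilon> g \<Longrightarrow> unbounded g \<Longrightarrow>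
     dyadic_cube Q \<Longrightarrow> Q \<subseteq> U \<Longrightarrow> dm Q \<le> \<epsilon> \<Longrightarrow> finite N \<Longrightarrow> \<exists>K. subcubes N Q K \<and> heavy g 1 Q K"
proof -
  obtain M where M: "2 \<le> M" and hs: "\<And>g \<epsilon>. dgauge_on DIM('a) \<epsilon> g \<Longrightarrow> divergent M \<epsilon> g \<Longrightarrow>
     \<exists>c>0. \<forall>Q N. dyadic_cube Q \<longrightarrow> Q \<subseteq> U \<longrightarrow> dm Q \<le> \<epsilon> \<longrightarrow> finite N \<longrightarrow> (\<exists>K. subcubes N Q K \<and> heavy g c Q K)"
    by (rule heavy_subcubes) blast
  define d where "d = DIM('a)"
  show ?thesis
  proof
    show "2 \<le> M" by fact
    fix g :: "real \<Rightarrow> real" and \<epsilon> :: real and Q N :: "'a set"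
    assume g: "dgauge_on DIM('a) \<epsilon> g" and div: "divergent M \<epsilon> g" and unb: "unbounded g"
      and Q: "dyadic_cube Q" "Q \<subseteq> U" "dm Q \<le> \<epsilon>" and N: "finite N"
    note gD = dgauge_onD[OF g]
    obtain g' where g': "dgauge_on DIM('a) \<epsilon> g'" "divergent M \<epsilon> g'"
      "\<And>B. \<exists>\<delta>>0. \<forall>x. 0 < x \<longrightarrow> x \<le> \<delta> \<longrightarrow> x \<le> \<epsilon> \<longrightarrow> B * g' x \<le> g x"
    proof (rule divergent_damping[OF g, of "\<lambda>k. (M ^ k) ^ DIM('a)" "\<lambda>k. min (\<phi> (M ^ k)) \<epsilon>"])
      show "0 < min (\<phi> (M ^ k)) \<epsilon>" for k using \<phi>_pos[of "M ^ k"] gD(1) M by simp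
      show "\<not> summable (\<lambda>k. (M ^ k) ^ DIM('a) * g (min (\<phi> (M ^ k)) \<epsilon>))" using div by (simp add: divergent_def)
      show "\<exists>\<delta>>0. \<forall>x. 0 < x \<longrightarrow> x \<le> \<delta> \<longrightarrow> B \<le> g x / x ^ DIM('a)" for B using unb by (simp add: unbounded_def)
    qed (use M that in \<open>auto simp: divergent_def\<close>)
    note g'D = dgauge_onD[OF g'(1)]
    obtain c where c: "0 < c" and hs': "\<And>Q N. dyadic_cube Q \<Longrightarrow> Q \<subseteq> U \<Longrightarrow> dm Q \<le> \<epsilon> \<Longrightarrow> finite N \<Longrightarrow> \<exists>K. subcubes N Q K \<and> heavy g' c Q K"
      using hs[OF g'(1,2)] by blast
    have dmQ: "0 < dm Q" using dm_pos Q by blast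
    have gQ: "0 < g (dm Q)" "0 < g' (dm Q)" using gD(2) g'D(2) dmQ Q by auto
    \<comment> \<open>Chosen so that B * c * g'(dm Q) = g(dm Q): the gain of g over g' on pieces of
      diameter at most \<delta> cancels the loss c exactly.\<close>
    define B where "B = g (dm Q) / (c * g' (dm Q))"
    obtain \<delta> where \<delta>: "\<delta> > 0" "\<And>x. 0 < x \<Longrightarrow> x \<le> \<delta> \<Longrightarrow> x \<le> \<epsilon> \<Longrightarrow> B * g' x \<le> g x" using g'(3) by blast
    obtain \<R> where R: "finite \<R>" "disjoint \<R>" "\<Union>\<R> = Q"
      "\<And>R. R \<in> \<R> \<Longrightarrow> dyadic_cube R \<and> dm R \<le> \<delta>"
      and R_nest: "\<And>l R. dyadic_cube l \<Longrightarrow> R \<in> \<R> \<Longrightarrow> l \<subseteq> R \<or> R \<subseteq> l \<or> l \<inter> R = {}"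
      using dyadic_subdivision[OF Q(1) \<delta>(1)] by blast
    have RQ: "R \<subseteq> Q" "dm R \<le> dm Q" "0 < dm R" if "R \<in> \<R>" for R
      using R(3,4) that Q(1) dm_mono[of R Q] dm_pos by auto
    have "\<exists>K. subcubes N R K \<and> heavy g' c R K" if "R \<in> \<R>" for R
      using RQ[OF that] R(4)[OF that] Q N by (intro hs') auto
    then obtain K where K: "\<And>R. R \<in> \<R> \<Longrightarrow> subcubes N R (K R) \<and> heavy g' c R (K R)" by metis
    have Ksub: "q \<subseteq> R" "closure q \<subseteq> R" "dyadic_cube q" if "R \<in> \<R>" "q \<in> K R" for R q
      using K[OF that(1)] that(2) closure_subset[of q] unfolding subcubes_def by blast+
    have R_disj: "R \<inter> R' = {}" if "R \<in> \<R>" "R' \<in> \<R>" "R \<noteq> R'" for R R'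
      using R(2) that by (auto simp: pairwise_def disjnt_def)
    have "subcubes N Q (\<Union>R\<in>\<R>. K R)"
      unfolding subcubes_def
    proof (intro conjI ballI)
      show "finite (\<Union>R\<in>\<R>. K R)" using K R(1) by (auto simp: subcubes_def)
      show "disjoint (\<Union>R\<in>\<R>. K R)"
      proof (rule pairwiseI)
        fix p q assume "p \<in> (\<Union>R\<in>\<R>. K R)" "q \<in> (\<Union>R\<in>\<R>. K R)" and ne: "p \<noteq> q"
        then obtain R R' where RR: "R \<in> \<R>" "p \<in> K R" "R' \<in> \<R>" "q \<in> K R'" by blast
        show "disjnt p q"
        proof (cases "R = R'")
          case True
          then show ?thesis using K[OF RR(1)] RR ne unfolding subcubes_def pairwise_def by blast
        next
          case False
          then show ?thesis using R_disj[OF RR(1,3)] Ksub[OF RR(1,2)] Ksub[OF RR(3,4)]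
            unfolding disjnt_def by blast
        qed
      qed
      fix q assume "q \<in> (\<Union>R\<in>\<R>. K R)"
      then obtain R where Rq: "R \<in> \<R>" "q \<in> K R" by blast
      then have *: "dm q \<le> dm R / 2" "\<exists>a\<in>A - N. q \<subseteq> nball nrm a (\<phi> (H a))"
        using K unfolding subcubes_def by blast+
      show "dyadic_cube q" "closure q \<subseteq> Q" using Ksub[OF Rq] RQ[OF Rq(1)] by auto
      show "dm q \<le> dm Q / 2" using * RQ(2)[OF Rq(1)] by simp
      show "\<exists>a\<in>A - N. q \<subseteq> nball nrm a (\<phi> (H a))" by fact
    qed
    moreover have "heavy g 1 Q (\<Union>R\<in>\<R>. K R)"
      unfolding heavy_def
    proof (intro allI impI)
      fix L assume L: "finite L" "\<forall>l\<in>L. dyadic_cube l \<and> l \<subseteq> Q" "\<forall>q\<in>(\<Union>R\<in>\<R>. K R). \<exists>l\<in>L. q \<subseteq> l"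
      have Lpos: "0 < dm l" "dm l \<le> dm Q" if "l \<in> L" for l
        using L that dm_pos dm_mono Q(1) by auto
      \<comment> \<open>G is the least value of g(r)/r^d up to scale dm Q, so it suffices to pay G
        times the volume of Q. A cube of L that contains a whole piece pays for itself; a piece
        contained in no such cube is paid for by the cubes of L inside it.\<close>
      define G where "G = g (dm Q) / dm Q ^ DIM('a)"
      define big where "big = {l \<in> L. \<exists>R\<in>\<R>. R \<subseteq> l}"
      define unc where "unc = {R \<in> \<R>. \<not> (\<exists>l\<in>big. R \<subseteq> l)}"
      define sub where "sub R = {l \<in> L. l \<subseteq> R}" for R
      have fin: "finite big" "finite unc" "finite (sub R)" for R
        using L R by (auto simp: big_def unc_def sub_def)
      have big_le: "G * dm l ^ DIM('a) \<le> g (dm l)" if "l \<in> big" for l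
        using gD(4)[of "dm l" "dm Q"] Lpos[of l] that Q by (auto simp: big_def G_def field_simps)
      have unc_le: "G * dm R ^ DIM('a) \<le> (\<Sum>l\<in>sub R. g (dm l))" if RU: "R \<in> unc" for R
      proof -
        have RR: "R \<in> \<R>" using RU by (simp add: unc_def)
        have "c * g' (dm R) \<le> (\<Sum>l\<in>sub R. g' (dm l))"
        proof -
          have "\<exists>l\<in>sub R. q \<subseteq> l" if q: "q \<in> K R" for q
          proof -
            obtain l where l: "l \<in> L" "q \<subseteq> l" using L(3) q RR by blast
            moreover have "l \<inter> R \<noteq> {}" using l Ksub[OF RR q] dyadic_cube_nonempty[of q] by blast
            moreover have "\<not> R \<subseteq> l" using RU l RR by (auto simp: unc_def big_def)
            ultimately have "l \<subseteq> R" using R_nest[of l R] L(2) RR by blast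
            then show ?thesis using l by (auto simp: sub_def)
          qed
          then show ?thesis
            using K[OF RR] fin(3)[of R] L(2) unfolding heavy_def by (auto simp: sub_def)
        qed
        then have "B * (c * g' (dm R)) \<le> B * (\<Sum>l\<in>sub R. g' (dm l))"
          using gQ c by (intro mult_left_mono) (auto simp: B_def)
        also have "\<dots> = (\<Sum>l\<in>sub R. B * g' (dm l))" by (rule sum_distrib_left)
        also have "\<dots> \<le> (\<Sum>l\<in>sub R. g (dm l))"
        proof (intro sum_mono \<delta>(2))
          fix l assume l: "l \<in> sub R"
          then show "0 < dm l" "dm l \<le> \<epsilon>" using Lpos[of l] Q by (auto simp: sub_def)
          have "dm l \<le> dm R" using l L(2) R(4)[OF RR] by (intro dm_mono) (auto simp: sub_def)
          then show "dm l \<le> \<delta>" using R(4)[OF RR] by simp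
        qed
        finally have 1: "g (dm Q) / g' (dm Q) * g' (dm R) \<le> (\<Sum>l\<in>sub R. g (dm l))"
          using c by (simp add: B_def)
        have "g' (dm Q) / dm Q ^ DIM('a) \<le> g' (dm R) / dm R ^ DIM('a)"
          using g'D(4)[of "dm R" "dm Q"] RQ[OF RR] Q by simp
        then have "dm R ^ DIM('a) / dm Q ^ DIM('a) \<le> g' (dm R) / g' (dm Q)"
          using RQ(3)[OF RR] dmQ gQ by (simp add: field_simps)
        then have "g (dm Q) * (dm R ^ DIM('a) / dm Q ^ DIM('a)) \<le> g (dm Q) * (g' (dm R) / g' (dm Q))"
          using gQ by (intro mult_left_mono) auto
        then show ?thesis using 1 by (simp add: G_def)
      qed
      have bu: "big \<inter> unc = {}" by (auto simp: unc_def)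
      have Qcov: "Q \<subseteq> \<Union>(big \<union> unc)" using R(3) by (auto simp: unc_def)
      have "dm Q ^ DIM('a) \<le> (\<Sum>l\<in>big \<union> unc. dm l ^ DIM('a))"
        using fin Q Qcov L(2) R(4) by (intro dm_power_subadditive) (auto simp: big_def unc_def)
      then have "G * dm Q ^ DIM('a) \<le> G * (\<Sum>l\<in>big \<union> unc. dm l ^ DIM('a))"
        using gQ dmQ by (intro mult_left_mono) (auto simp: G_def)
      also have "\<dots> = (\<Sum>l\<in>big. G * dm l ^ DIM('a)) + (\<Sum>l\<in>unc. G * dm l ^ DIM('a))"
        using fin bu by (simp add: sum.union_disjoint sum_distrib_left ring_distribs)
      also have "\<dots> \<le> (\<Sum>l\<in>big. g (dm l)) + (\<Sum>R\<in>unc. \<Sum>l\<in>sub R. g (dm l))"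
        by (intro add_mono sum_mono big_le unc_le)
      also have "(\<Sum>R\<in>unc. \<Sum>l\<in>sub R. g (dm l)) = (\<Sum>l\<in>(\<Union>R\<in>unc. sub R). g (dm l))"
      proof (rule sum.UNION_disjoint[symmetric])
        show "\<forall>R\<in>unc. \<forall>R'\<in>unc. R \<noteq> R' \<longrightarrow> sub R \<inter> sub R' = {}"
        proof (intro ballI impI)
          fix R R' assume "R \<in> unc" "R' \<in> unc" "R \<noteq> R'"
          then have "R \<inter> R' = {}" using R_disj by (auto simp: unc_def)
          then show "sub R \<inter> sub R' = {}" using L(2) dyadic_cube_nonempty by (fastforce simp: sub_def)
        qed
      qed (use fin in auto)
      also have "(\<Sum>l\<in>big. g (dm l)) + (\<Sum>l\<in>(\<Union>R\<in>unc. sub R). g (dm l)) = (\<Sum>l\<in>big \<union> (\<Union>R\<in>unc. sub R). g (dm l))"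
      proof (rule sum.union_disjoint[symmetric])
        have False if asm: "l \<in> big" "R \<in> unc" "l \<in> sub R" for l R
        proof -
          obtain R' where R': "R' \<in> \<R>" "R' \<subseteq> l" using asm by (auto simp: big_def)
          then have "R' \<subseteq> R" using asm by (auto simp: sub_def)
          then have "R' = R" using R_disj[of R' R] R' asm(2) R(4)[of R'] dyadic_cube_nonempty[of R'] by (auto simp: unc_def)
          then show False using asm R' by (auto simp: unc_def)
        qed
        then show "big \<inter> (\<Union>R\<in>unc. sub R) = {}" by blast
      qed (use fin in auto)
      also have "\<dots> \<le> (\<Sum>l\<in>L. g (dm l))"
      proof (rule sum_mono2)
        show "0 \<le> g (dm l)" if "l \<in> L - (big \<union> (\<Union>R\<in>unc. sub R))" for l
          using gD(2)[of "dm l"] Lpos[of l] that Q by auto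
      qed (use L in \<open>auto simp: big_def sub_def\<close>)
      finally show "1 * g (dm Q) \<le> (\<Sum>l\<in>L. g (dm l))" using dmQ by (simp add: G_def)
    qed
    ultimately show "\<exists>K. subcubes N Q K \<and> heavy g 1 Q K" by blast
  qed
qed

end

section \<open>Net contents of the limsup set\<close>

context euclidean_norm begin

lemma compact_closure_dyadic_cube:
  fixes Q :: "'a set" assumes Q: "dyadic_cube Q" shows "compact (closure Q)"
proof -
  obtain x where x: "x \<in> Q" using dyadic_cube_nonempty[OF Q] by blast
  have "closure Q \<subseteq> nball nrm x (dm Q + 1)"
  proof
    fix y assume "y \<in> closure Q"
    then show "y \<in> nball nrm x (dm Q + 1)"
      using closure_dyadic_cube[OF Q x, of y] by (simp add: mem_nball)
  qed
  then have "bounded (closure Q)" using bounded_nball bounded_subset by blast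
  then show ?thesis by (simp add: compact_eq_bounded_closed)
qed

lemma Minf_mono: "E \<subseteq> E' \<Longrightarrow> Minf nrm h E \<le> Minf nrm h E'"
  unfolding Minf_def by (intro INF_superset_mono) auto

lemma Minf_le_family:
  assumes "countable I" "h 0 = 0" "E \<subseteq> (\<Union>i\<in>I. D i)"
    and "\<And>i. i \<in> I \<Longrightarrow> D i = {} \<or> dyadic_cube (D i) \<and> ediam nrm (D i) < eps_h DIM('a) h"
  shows "Minf nrm h E \<le> (\<integral>\<^sup>+i. h (ediam nrm (D i)) \<partial>count_space I)"
proof -
  obtain C :: "nat \<Rightarrow> 'a set" where C: "\<And>n. C n = {} \<or> (\<exists>i\<in>I. C n = D i)" "(\<Union>n. C n) = (\<Union>i\<in>I. D i)"
    "\<And>f :: 'a set \<Rightarrow> ennreal. f {} = 0 \<Longrightarrow> (\<Sum>n. f (C n)) = (\<integral>\<^sup>+i. f (D i) \<partial>count_space I)"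
    using countable_family_sequence[OF assms(1), of D] by blast
  have "C n = {} \<or> dyadic_cube (C n) \<and> ediam nrm (C n) < eps_h DIM('a) h" for n
    using C(1)[of n] assms(4) by metis
  then have "Minf nrm h E \<le> (\<Sum>n. h (ediam nrm (C n)))"
    unfolding Minf_def using assms(3) C(2) by (intro INF_lower) auto
  also have "\<dots> = (\<integral>\<^sup>+i. h (ediam nrm (D i)) \<partial>count_space I)"
    using C(3)[of "\<lambda>S. h (ediam nrm S)"] assms(2) by simp
  finally show ?thesis .
qed

lemma eps_h_less:
  assumes "s < eps_h d h"
  obtains e :: real where "s < ennreal e" "mono_on {0..ennreal e} h"
  using assms unfolding eps_h_def less_Sup_iff by auto

text \<open>Covering Q by itself is best possible. A larger cube costs more because h is monotone up
  to \<open>eps_h\<close>, even where h is no longer described by g; if no cube contains Q, those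
  meeting it lie inside, and the decreasing ratio to r^d reduces the claim to volume.\<close>

lemma Minf_dyadic_cube_ge:
  assumes h: "h 0 = 0" "\<And>r. 0 < r \<Longrightarrow> r \<le> \<epsilon> \<Longrightarrow> h (ennreal r) = ennreal (g r)"
    and g: "dgauge_on DIM('a) \<epsilon> g" and Q: "dyadic_cube Q" "dm Q \<le> \<epsilon>"
  shows "ennreal (g (dm Q)) \<le> Minf nrm h Q"
  unfolding Minf_def
proof (rule INF_greatest)
  fix C :: "nat \<Rightarrow> 'a set"
  assume "C \<in> {C. Q \<subseteq> (\<Union>n. C n) \<and> (\<forall>n. C n = {} \<or> dyadic_cube (C n) \<and> ediam nrm (C n) < eps_h DIM('a) h)}"
  then have C: "Q \<subseteq> (\<Union>n. C n)" "\<And>n. C n \<noteq> {} \<Longrightarrow> dyadic_cube (C n) \<and> ediam nrm (C n) < eps_h DIM('a) h" by auto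
  note gD = dgauge_onD[OF g]
  have dmQ: "0 < dm Q" using Q dm_pos by blast
  show "ennreal (g (dm Q)) \<le> (\<Sum>n. h (ediam nrm (C n)))"
  proof (cases "\<exists>n. Q \<subseteq> C n")
    case True
    then obtain n where n: "Q \<subseteq> C n" by blast
    then have "C n \<noteq> {}" using dyadic_cube_nonempty Q by blast
    then obtain e where e: "ediam nrm (C n) < ennreal e" "mono_on {0..ennreal e} h"
      using C(2)[of n] eps_h_less by blast
    have "ediam nrm Q \<le> ediam nrm (C n)" using n by (rule ediam_mono)
    then have "h (ediam nrm Q) \<le> h (ediam nrm (C n))"
      using e by (intro mono_onD[OF e(2)]) auto
    also have "\<dots> \<le> (\<Sum>n. h (ediam nrm (C n)))"
      using sum_le_suminf[of "\<lambda>n. h (ediam nrm (C n))" "{n}"] by simp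
    finally show ?thesis using h(2)[of "dm Q"] dmQ Q by (simp add: ediam_eq_dm)
  next
    case False
    define C' where "C' n = (if C n \<inter> Q = {} then {} else C n)" for n
    have C': "C' n = {} \<or> dyadic_cube (C' n)" for n using C(2)[of n] by (auto simp: C'_def)
    have sub: "C' n \<subseteq> Q" for n
      using dyadic_cubes_nested[of "C n" Q] C(2)[of n] False Q by (auto simp: C'_def)
    have cov: "Q \<subseteq> (\<Union>n. C' n)" using C(1) by (fastforce simp: C'_def)
    define G where "G = g (dm Q) / dm Q ^ DIM('a)"
    have G: "0 \<le> G" using gD(2)[of "dm Q"] dmQ Q by (simp add: G_def)
    have le: "ennreal G * ennreal (dm (C' n) ^ DIM('a)) \<le> h (ediam nrm (C n))" for n
    proof (cases "C' n = {}")
      case True then show ?thesis by (simp add: zero_power)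
    next
      case False
      then have n: "C' n = C n" "dyadic_cube (C n)" "C n \<subseteq> Q" using C'[of n] sub[of n] by (auto simp: C'_def split: if_splits)
      then have d: "0 < dm (C n)" "dm (C n) \<le> dm Q" using dm_pos dm_mono Q by auto
      then have "G \<le> g (dm (C n)) / dm (C n) ^ DIM('a)" unfolding G_def using gD(4) Q by auto
      then have "G * dm (C n) ^ DIM('a) \<le> g (dm (C n))" using d by (simp add: field_simps)
      then show ?thesis using n d h(2)[of "dm (C n)"] Q G by (simp add: ediam_eq_dm ennreal_mult'[symmetric] ennreal_leI)
    qed
    have "ennreal (g (dm Q)) = ennreal G * ennreal (dm Q ^ DIM('a))"
      using dmQ G by (simp add: ennreal_mult'[symmetric]) (simp add: G_def)
    also have "\<dots> \<le> ennreal G * (\<Sum>n. ennreal (dm (C' n) ^ DIM('a)))"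
      using Q C' cov by (intro mult_left_mono dm_power_subadditive_countable) auto
    also have "\<dots> = (\<Sum>n. ennreal G * ennreal (dm (C' n) ^ DIM('a)))" by simp
    also have "\<dots> \<le> (\<Sum>n. h (ediam nrm (C n)))" by (intro suminf_le le) auto
    finally show ?thesis .
  qed
qed

end

section \<open>Coverings of the limsup set\<close>

context regular_approximation begin

definition F :: "'a set" where
  "F = {x. infinite {a\<in>A. nrm (x - a) < \<phi> (H a)}}"

text \<open>A finite exhaustion of A: infinitely many approximants means one outside every
  \<open>initial m\<close>.\<close>

definition initial :: "nat \<Rightarrow> 'a set" where
  "initial m = {a \<in> A. to_nat_on A a < m}"

lemma finite_initial: "finite (initial m)"
proof -
  have "to_nat_on A ` initial m \<subseteq> {..<m}" by (auto simp: initial_def)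
  then have "finite (to_nat_on A ` initial m)" by (rule finite_subset) simp
  moreover have "inj_on (to_nat_on A) (initial m)"
    by (rule inj_on_subset[OF inj_on_to_nat_on[OF countable_A]]) (auto simp: initial_def)
  ultimately show ?thesis by (rule finite_imageD)
qed

lemma mem_F_iff: "x \<in> F \<longleftrightarrow> (\<forall>m. \<exists>a\<in>A - initial m. nrm (x - a) < \<phi> (H a))"
proof
  assume "x \<in> F"
  then have inf: "infinite {a\<in>A. nrm (x - a) < \<phi> (H a)}" by (simp add: F_def)
  show "\<forall>m. \<exists>a\<in>A - initial m. nrm (x - a) < \<phi> (H a)"
  proof
    fix m
    have "infinite ({a\<in>A. nrm (x - a) < \<phi> (H a)} - initial m)"
      using inf finite_initial by (rule Diff_infinite_finite[rotated])
    then obtain a where "a \<in> {a\<in>A. nrm (x - a) < \<phi> (H a)} - initial m"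
      using infinite_imp_nonempty by blast
    then show "\<exists>a\<in>A - initial m. nrm (x - a) < \<phi> (H a)" by blast
  qed
next
  assume *: "\<forall>m. \<exists>a\<in>A - initial m. nrm (x - a) < \<phi> (H a)"
  show "x \<in> F" unfolding F_def
  proof (rule CollectI, rule notI)
    let ?S = "{a\<in>A. nrm (x - a) < \<phi> (H a)}"
    assume fin: "finite ?S"
    obtain m where m: "\<forall>n\<in>to_nat_on A ` ?S. n < m"
      using finite_nat_set_iff_bounded[of "to_nat_on A ` ?S"] fin by blast
    obtain a where "a \<in> A - initial m" "nrm (x - a) < \<phi> (H a)" using * by blast
    then show False using m by (auto simp: initial_def)
  qed
qed

text \<open>A cube that is neither covered nor paid for by the cubes inside it has a child with the same defect;
  the limit point of such a branch lies in \<open>F\<close> but in no cube of the cover.\<close>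

lemma cover_mass:
  fixes C :: "nat \<Rightarrow> 'a set"
  assumes g: "\<And>r. 0 < r \<Longrightarrow> r \<le> \<epsilon> \<Longrightarrow> 0 < g r"
    and step: "\<And>q N. dyadic_cube q \<Longrightarrow> q \<subseteq> U \<Longrightarrow> dm q \<le> \<epsilon> \<Longrightarrow> finite N \<Longrightarrow> \<exists>K. subcubes N q K \<and> heavy g 1 q K"
    and Q: "dyadic_cube Q" "Q \<subseteq> U" "dm Q \<le> \<epsilon>"
    and C: "\<And>n. C n \<noteq> {} \<Longrightarrow> dyadic_cube (C n)" "F \<inter> Q \<subseteq> (\<Union>n. C n)" and not_in: "\<And>n. \<not> Q \<subseteq> C n"
  shows "ennreal (g (dm Q)) \<le> (\<integral>\<^sup>+n. ennreal (g (dm (C n))) \<partial>count_space {n. C n \<noteq> {} \<and> C n \<subseteq> Q})"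
proof (rule ccontr)
  \<comment> \<open>\<mu> charges the index n and not the set C n, so a repeated cube counts with
    its multiplicity, as it does in the sum of a cover.\<close>
  define \<mu> where "\<mu> = density (count_space UNIV) (\<lambda>n. ennreal (g (dm (C n))))"
  define inside where "inside q = {n. C n \<noteq> {} \<and> C n \<subseteq> q}" for q
  define good where "good q \<longleftrightarrow> (\<exists>n. q \<subseteq> C n) \<or> ennreal (g (dm q)) \<le> emeasure \<mu> (inside q)" for q
  \<comment> \<open>m is the generation counter for dependent choice; the passage to a child at
    generation m excludes the centres in \<open>initial m\<close>.\<close>
  define P where "P m q \<longleftrightarrow> dyadic_cube q \<and> q \<subseteq> Q \<and> \<not> good q" for m :: nat and q
  have sets_\<mu>: "I \<in> sets \<mu>" for I by (simp add: \<mu>_def)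
  have child: "\<exists>q'. P (Suc m) q' \<and> closure q' \<subseteq> q \<and> dm q' \<le> dm q / 2 \<and> (\<exists>a\<in>A - initial m. q' \<subseteq> nball nrm a (\<phi> (H a)))"
    if Pq: "P m q" for q m
  proof (rule ccontr)
    assume no: "\<not> ?thesis"
    have q: "dyadic_cube q" "q \<subseteq> Q" "\<not> good q" using Pq by (auto simp: P_def)
    have dq: "dm q \<le> dm Q" "0 < dm q" using q Q dm_mono dm_pos by auto
    obtain K where K: "subcubes (initial m) q K" "heavy g 1 q K"
      using step[OF q(1) _ _ finite_initial, of m] q Q dq by auto
    have Kq: "dyadic_cube k" "closure k \<subseteq> q" "k \<subseteq> q" "k \<noteq> {}" if "k \<in> K" for k
      using K(1) that closure_subset[of k] dyadic_cube_nonempty unfolding subcubes_def by blast+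
    have K_disj: "k \<inter> k' = {}" if "k \<in> K" "k' \<in> K" "k \<noteq> k'" for k k'
      using K(1) that by (auto simp: subcubes_def pairwise_def disjnt_def)
    have good: "good k" if "k \<in> K" for k
    proof (rule ccontr)
      assume "\<not> good k"
      then have "P (Suc m) k" using Kq[OF that] q by (auto simp: P_def)
      then show False using no K(1) that Kq(2)[OF that] unfolding subcubes_def by blast
    qed
    \<comment> \<open>A child covered by some C n is traded for that cube, which lies in q because
      no cube of the cover contains q. The other children are paid for by the cubes inside
      them.\<close>
    define Kc where "Kc = {k \<in> K. \<exists>n. k \<subseteq> C n}"
    have fin: "finite K" "finite Kc" using K(1) by (auto simp: subcubes_def Kc_def)
    have "\<exists>n. k \<subseteq> C n" if "k \<in> Kc" for k using that by (simp add: Kc_def)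
    then obtain n where n: "\<And>k. k \<in> Kc \<Longrightarrow> k \<subseteq> C (n k)" by metis
    have nin: "n k \<in> inside q" if "k \<in> Kc" for k
    proof -
      have k: "k \<noteq> {}" "k \<subseteq> q" using that Kq by (auto simp: Kc_def)
      then have ne: "C (n k) \<noteq> {}" "C (n k) \<inter> q \<noteq> {}" using n[OF that] by auto
      have "\<not> q \<subseteq> C (n k)" using q(3) by (auto simp: good_def)
      then have "C (n k) \<subseteq> q" using dyadic_cubes_nested[OF C(1)[OF ne(1)] q(1) ne(2)] by blast
      then show ?thesis using ne by (simp add: inside_def)
    qed
    define L where "L = C ` n ` Kc \<union> (K - Kc)"
    have L: "dyadic_cube l \<and> l \<subseteq> q" if l: "l \<in> L" for l
    proof (cases "l \<in> K")
      case True then show ?thesis using Kq by blast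
    next
      case False
      then obtain k where "k \<in> Kc" "l = C (n k)" using l by (auto simp: L_def)
      then show ?thesis using nin[of k] C(1)[of "n k"] by (auto simp: inside_def)
    qed
    have gpos: "0 \<le> g (dm l)" if "dyadic_cube l" "l \<subseteq> q" for l
    proof (rule less_imp_le, rule g)
      show "0 < dm l" using that dm_pos by blast
      show "dm l \<le> \<epsilon>" using dm_mono[OF that(1) q(1) that(2)] dq Q by linarith
    qed
    have gC: "0 \<le> g (dm (C i))" if "i \<in> n ` Kc" for i
      using that nin C(1) gpos by (auto simp: inside_def)
    have finL: "finite L" using fin by (auto simp: L_def)
    have "1 * g (dm q) \<le> (\<Sum>l\<in>L. g (dm l))"
    proof -
      have "\<exists>l\<in>L. k \<subseteq> l" if "k \<in> K" for k
      proof (cases "k \<in> Kc")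
        case True
        then have "C (n k) \<in> L" by (auto simp: L_def)
        then show ?thesis using n[OF True] by blast
      next
        case False
        then have "k \<in> L" using that by (simp add: L_def)
        then show ?thesis by blast
      qed
      then show ?thesis using K(2)[unfolded heavy_def, rule_format, OF finL L] by simp
    qed
    also have "\<dots> \<le> (\<Sum>l\<in>C ` n ` Kc. g (dm l)) + (\<Sum>l\<in>K - Kc. g (dm l))"
    proof -
      have "(\<Sum>l\<in>L. g (dm l)) + (\<Sum>l\<in>C ` n ` Kc \<inter> (K - Kc). g (dm l)) = (\<Sum>l\<in>C ` n ` Kc. g (dm l)) + (\<Sum>l\<in>K - Kc. g (dm l))"
        unfolding L_def using fin by (intro sum.union_inter) auto
      moreover have "0 \<le> (\<Sum>l\<in>C ` n ` Kc \<inter> (K - Kc). g (dm l))"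
        using Kq gpos by (intro sum_nonneg) auto
      ultimately show ?thesis by linarith
    qed
    \<comment> \<open>Two indices may carry the same cube, so the sum over cubes is bounded by the
      sum over indices.\<close>
    also have "(\<Sum>l\<in>C ` n ` Kc. g (dm l)) \<le> (\<Sum>i\<in>n ` Kc. g (dm (C i)))"
      using fin gC sum_image_le[of "n ` Kc" "\<lambda>l. g (dm l)" C] by simp
    finally have "ennreal (g (dm q)) \<le> ennreal ((\<Sum>i\<in>n ` Kc. g (dm (C i))) + (\<Sum>l\<in>K - Kc. g (dm l)))"
      by (intro ennreal_leI) simp
    also have "\<dots> = (\<Sum>i\<in>n ` Kc. ennreal (g (dm (C i)))) + (\<Sum>l\<in>K - Kc. ennreal (g (dm l)))"
    proof -
      have gK: "0 \<le> g (dm l)" if "l \<in> K - Kc" for l using that Kq gpos by auto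
      have "(\<Sum>i\<in>n ` Kc. ennreal (g (dm (C i)))) = ennreal (\<Sum>i\<in>n ` Kc. g (dm (C i)))"
        by (rule sum_ennreal) (rule gC)
      moreover have "(\<Sum>l\<in>K - Kc. ennreal (g (dm l))) = ennreal (\<Sum>l\<in>K - Kc. g (dm l))"
        by (rule sum_ennreal) (rule gK)
      moreover have "0 \<le> (\<Sum>i\<in>n ` Kc. g (dm (C i)))" "0 \<le> (\<Sum>l\<in>K - Kc. g (dm l))"
        by (rule sum_nonneg, rule gC, simp, rule sum_nonneg, rule gK, simp)
      ultimately show ?thesis by (simp only: ennreal_plus)
    qed
    also have "(\<Sum>i\<in>n ` Kc. ennreal (g (dm (C i)))) = emeasure \<mu> (n ` Kc)"
      using fin by (simp add: \<mu>_def emeasure_density_count_space nn_integral_count_space_finite)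
    also have "(\<Sum>l\<in>K - Kc. ennreal (g (dm l))) \<le> (\<Sum>l\<in>K - Kc. emeasure \<mu> (inside l))"
    proof (rule sum_mono)
      fix l assume "l \<in> K - Kc"
      then show "ennreal (g (dm l)) \<le> emeasure \<mu> (inside l)" using good[of l] by (auto simp: good_def Kc_def)
    qed
    also have "(\<Sum>l\<in>K - Kc. emeasure \<mu> (inside l)) = emeasure \<mu> (\<Union>l\<in>K - Kc. inside l)"
    proof (rule sum_emeasure)
      show "disjoint_family_on inside (K - Kc)"
        unfolding disjoint_family_on_def
      proof (intro ballI impI)
        fix k k' assume "k \<in> K - Kc" "k' \<in> K - Kc" "k \<noteq> k'"
        then have "k \<inter> k' = {}" using K_disj by auto
        then show "inside k \<inter> inside k' = {}" by (auto simp: inside_def)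
      qed
    qed (use fin sets_\<mu> in auto)
    also have "emeasure \<mu> (n ` Kc) + emeasure \<mu> (\<Union>l\<in>K - Kc. inside l) = emeasure \<mu> (n ` Kc \<union> (\<Union>l\<in>K - Kc. inside l))"
    proof (rule plus_emeasure)
      \<comment> \<open>An index counted in both parts would have a cube that contains one child and
        lies in another, contrary to their disjointness.\<close>
      have False if "k \<in> Kc" "l \<in> K - Kc" "n k \<in> inside l" for k l
      proof -
        have "k \<subseteq> l" "k \<noteq> {}" using that n[of k] Kq[of k] by (auto simp: inside_def Kc_def)
        then show False using K_disj[of k l] that by (auto simp: Kc_def)
      qed
      then show "n ` Kc \<inter> (\<Union>l\<in>K - Kc. inside l) = {}" by blast
    qed (use sets_\<mu> in auto)
    also have "\<dots> \<le> emeasure \<mu> (inside q)"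
    proof (rule emeasure_mono)
      have "inside l \<subseteq> inside q" if "l \<in> K" for l using Kq(3)[OF that] by (auto simp: inside_def)
      then show "n ` Kc \<union> (\<Union>l\<in>K - Kc. inside l) \<subseteq> inside q" using nin by blast
    qed (use sets_\<mu> in auto)
    finally show False using q(3) by (simp add: good_def)
  qed
  assume "\<not> ennreal (g (dm Q)) \<le> (\<integral>\<^sup>+n. ennreal (g (dm (C n))) \<partial>count_space {n. C n \<noteq> {} \<and> C n \<subseteq> Q})"
  then have "P 0 Q" using Q not_in by (auto simp: P_def good_def \<mu>_def emeasure_density_count_space inside_def)
  have "\<exists>q. \<forall>m. P m (q m) \<and> (closure (q (Suc m)) \<subseteq> q m \<and> dm (q (Suc m)) \<le> dm (q m) / 2 \<and>
      (\<exists>a\<in>A - initial m. q (Suc m) \<subseteq> nball nrm a (\<phi> (H a))))"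
    by (rule dependent_nat_choice) (use \<open>P 0 Q\<close> child in auto)
  then obtain q where q: "\<And>m. P m (q m)" "\<And>m. closure (q (Suc m)) \<subseteq> q m \<and> dm (q (Suc m)) \<le> dm (q m) / 2 \<and>
      (\<exists>a\<in>A - initial m. q (Suc m) \<subseteq> nball nrm a (\<phi> (H a)))"
    by auto
  have qd: "dyadic_cube (q m)" "q m \<subseteq> Q" "\<not> good (q m)" for m using q(1) by (auto simp: P_def)
  have "\<Inter>(range (\<lambda>m. closure (q m))) \<noteq> {}"
  proof (rule compact_nest)
    show "closure (q m) \<noteq> {}" for m using dyadic_cube_nonempty[OF qd(1), of m] by simp
    have "closure (q (Suc m)) \<subseteq> closure (q m)" for m using q(2)[of m] closure_subset[of "q m"] by blast
    then show "closure (q n) \<subseteq> closure (q m)" if "m \<le> n" for m n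
      using that by (rule lift_Suc_antimono_le)
  qed (use qd compact_closure_dyadic_cube in auto)
  then obtain x where "\<And>m. x \<in> closure (q m)" by blast
  \<comment> \<open>The closure of each cube lies in its predecessor, so a point common to all
    closures lies in the cubes themselves.\<close>
  then have x: "x \<in> q m" for m using q(2)[of m] by blast
  have "x \<in> F" unfolding mem_F_iff
  proof
    fix m
    obtain a where "a \<in> A - initial m" "q (Suc m) \<subseteq> nball nrm a (\<phi> (H a))" using q(2) by blast
    then show "\<exists>a\<in>A - initial m. nrm (x - a) < \<phi> (H a)" using x[of "Suc m"]
      by (intro bexI[of _ a]) (auto simp: mem_nball)
  qed
  moreover have "x \<in> Q" using x[of 0] qd(2) by blast
  ultimately obtain n where n: "x \<in> C n" using C(2) by blast
  then have Cn: "dyadic_cube (C n)" using C(1) by blast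
  \<comment> \<open>No q m lies in C n, so nesting puts C n inside every q m, although the diameters
    of the q m tend to 0.\<close>
  have sub: "C n \<subseteq> q m" for m
    using dyadic_cubes_nested[OF Cn qd(1)[of m]] x[of m] n qd(3)[of m] by (auto simp: good_def)
  have dmle: "dm (q m) \<le> dm (q 0) * (1/2) ^ m" for m
  proof (induction m)
    case (Suc m)
    then show ?case using q(2)[of m] by simp
  qed simp
  have d0: "0 < dm (q 0)" "0 < dm (C n)" using dm_pos qd Cn by auto
  obtain m where "(1/2) ^ m < dm (C n) / dm (q 0)"
    using real_arch_pow_inv[of "dm (C n) / dm (q 0)" "1/2"] d0 by auto
  then have "dm (q 0) * (1/2) ^ m < dm (C n)" using d0 by (simp add: field_simps)
  then show False using dmle[of m] dm_mono[OF Cn qd(1) sub, of m] by linarith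
qed

text \<open>A cover of F \<inter> V becomes a cover of V at no greater cost: cut V into small dyadic
  cubes, add those lying in no C n, and drop every C n inside an added cube. By
  \<open>cover_mass\<close> the dropped cubes pay for the added ones.\<close>

lemma Minf_F_Int:
  assumes h: "h 0 = 0" "\<And>r. 0 < r \<Longrightarrow> r \<le> \<epsilon> \<Longrightarrow> h (ennreal r) = ennreal (g r)" "ennreal \<epsilon> < eps_h DIM('a) h"
    and g: "dgauge_on DIM('a) \<epsilon> g"
    and step: "\<And>q N. dyadic_cube q \<Longrightarrow> q \<subseteq> U \<Longrightarrow> dm q \<le> \<epsilon> \<Longrightarrow> finite N \<Longrightarrow> \<exists>K. subcubes N q K \<and> heavy g 1 q K"
    and V: "open V" "V \<subseteq> U"
  shows "Minf nrm h (F \<inter> V) = Minf nrm h V"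
proof (rule antisym)
  show "Minf nrm h (F \<inter> V) \<le> Minf nrm h V" by (rule Minf_mono) auto
  note gD = dgauge_onD[OF g]
  obtain \<Q> where \<Q>: "countable \<Q>" "disjoint \<Q>" "\<Union>\<Q> = V" "\<And>Q. Q \<in> \<Q> \<Longrightarrow> dyadic_cube Q \<and> dm Q \<le> \<epsilon>"
    using dyadic_partition[OF V(1) gD(1)] by blast
  show "Minf nrm h V \<le> Minf nrm h (F \<inter> V)"
    unfolding Minf_def[of nrm h "F \<inter> V"]
  proof (rule INF_greatest)
    fix C :: "nat \<Rightarrow> 'a set"
    assume "C \<in> {C. F \<inter> V \<subseteq> (\<Union>n. C n) \<and> (\<forall>n. C n = {} \<or> dyadic_cube (C n) \<and> ediam nrm (C n) < eps_h DIM('a) h)}"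
    then have C: "F \<inter> V \<subseteq> (\<Union>n. C n)" "\<And>n. C n = {} \<or> dyadic_cube (C n) \<and> ediam nrm (C n) < eps_h DIM('a) h" by auto
    define \<Q>' where "\<Q>' = {Q \<in> \<Q>. \<forall>n. \<not> Q \<subseteq> C n}"
    define inside where "inside Q = {n. C n \<noteq> {} \<and> C n \<subseteq> Q}" for Q
    define J where "J = UNIV - (\<Union>Q\<in>\<Q>'. inside Q)"
    let ?f = "\<lambda>n. h (ediam nrm (C n))"
    have cQ': "countable \<Q>'" using \<Q>(1) by (rule countable_subset[rotated]) (auto simp: \<Q>'_def)
    have inQ: "h (ediam nrm Q) \<le> (\<integral>\<^sup>+n. ?f n \<partial>count_space (inside Q))" if Q: "Q \<in> \<Q>'" for Q
    proof -
      have Qd: "dyadic_cube Q" "dm Q \<le> \<epsilon>" "Q \<subseteq> V" "\<And>n. \<not> Q \<subseteq> C n" using Q \<Q>(3,4) by (auto simp: \<Q>'_def)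
      have "h (ediam nrm Q) = ennreal (g (dm Q))" using Qd dm_pos[of Q] h(2) by (simp add: ediam_eq_dm)
      also have "\<dots> \<le> (\<integral>\<^sup>+n. ennreal (g (dm (C n))) \<partial>count_space (inside Q))"
        unfolding inside_def using C Qd V(2)
        by (intro cover_mass[where \<epsilon> = \<epsilon>] gD(2) step) auto
      also have "\<dots> = (\<integral>\<^sup>+n. ?f n \<partial>count_space (inside Q))"
      proof (intro nn_integral_cong)
        fix n assume "n \<in> space (count_space (inside Q))"
        then have n: "C n \<subseteq> Q" "dyadic_cube (C n)" using C(2)[of n] by (auto simp: inside_def)
        then have "dm (C n) \<le> \<epsilon>" "0 < dm (C n)" using dm_mono[OF n(2) Qd(1) n(1)] Qd(2) dm_pos by auto
        then show "ennreal (g (dm (C n))) = ?f n" using h(2) n by (simp add: ediam_eq_dm)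
      qed
      finally show ?thesis .
    qed
    have disj: "disjoint_family_on inside \<Q>'"
      using \<Q>(2) unfolding disjoint_family_on_def \<Q>'_def inside_def pairwise_def disjnt_def by blast
    define I where "I = Inl ` J \<union> Inr ` \<Q>'"
    define D where "D i = (case i of Inl n \<Rightarrow> C n | Inr Q \<Rightarrow> Q)" for i
    have "Minf nrm h V \<le> (\<integral>\<^sup>+i. h (ediam nrm (D i)) \<partial>count_space I)"
    proof (rule Minf_le_family)
      show "countable I" using cQ' by (auto simp: I_def)
      show "V \<subseteq> (\<Union>i\<in>I. D i)"
      proof
        fix x assume "x \<in> V"
        then obtain Q where Q: "Q \<in> \<Q>" "x \<in> Q" using \<Q>(3) by blast
        show "x \<in> (\<Union>i\<in>I. D i)"
        proof (cases "Q \<in> \<Q>'")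
          case True
          then have "Inr Q \<in> I" "x \<in> D (Inr Q)" using Q by (auto simp: I_def D_def)
          then show ?thesis by blast
        next
          case False
          then obtain n where n: "Q \<subseteq> C n" using Q by (auto simp: \<Q>'_def)
          \<comment> \<open>If C n lay in an added cube, that cube would meet Q and hence equal it,
            but Q is not an added cube.\<close>
          have "n \<in> J"
          proof (rule ccontr)
            assume "n \<notin> J"
            then obtain Q' where Q': "Q' \<in> \<Q>'" "C n \<subseteq> Q'" by (auto simp: J_def inside_def)
            then have "Q \<inter> Q' \<noteq> {}" using n Q by blast
            then have "Q = Q'" using \<Q>(2) Q Q' by (auto simp: \<Q>'_def pairwise_def disjnt_def)
            then show False using Q' False by blast
          qed
          then have "Inl n \<in> I" "x \<in> D (Inl n)" using Q n by (auto simp: I_def D_def)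
          then show ?thesis by blast
        qed
      qed
      fix i assume "i \<in> I"
      then consider n where "i = Inl n" | Q where "i = Inr Q" "Q \<in> \<Q>'" by (auto simp: I_def)
      then show "D i = {} \<or> dyadic_cube (D i) \<and> ediam nrm (D i) < eps_h DIM('a) h"
      proof cases
        case 2
        then have "dyadic_cube Q" "dm Q \<le> \<epsilon>" using \<Q>(4) by (auto simp: \<Q>'_def)
        then show ?thesis using 2 h(3) le_less_trans[OF ennreal_leI[of "dm Q" \<epsilon>]] by (simp add: D_def ediam_eq_dm)
      qed (use C(2) in \<open>auto simp: D_def\<close>)
    qed (rule h)
    also have "\<dots> \<le> (\<integral>\<^sup>+i. h (ediam nrm (D i)) \<partial>count_space (Inl ` J)) + (\<integral>\<^sup>+i. h (ediam nrm (D i)) \<partial>count_space (Inr ` \<Q>'))"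
      unfolding I_def by (rule nn_integral_count_space_Un_le)
    also have "\<dots> = (\<integral>\<^sup>+n. ?f n \<partial>count_space J) + (\<integral>\<^sup>+Q. h (ediam nrm Q) \<partial>count_space \<Q>')"
      by (simp add: nn_integral_count_space_inj D_def)
    also have "(\<integral>\<^sup>+Q. h (ediam nrm Q) \<partial>count_space \<Q>') \<le> (\<integral>\<^sup>+Q. (\<integral>\<^sup>+n. ?f n \<partial>count_space (inside Q)) \<partial>count_space \<Q>')"
      using inQ by (intro nn_integral_mono) auto
    also have "\<dots> = (\<integral>\<^sup>+n. ?f n \<partial>count_space (\<Union>Q\<in>\<Q>'. inside Q))"
      using cQ' disj by (rule nn_integral_count_space_UN[symmetric])
    also have "(\<integral>\<^sup>+n. ?f n \<partial>count_space J) + \<dots> = (\<integral>\<^sup>+n. ?f n \<partial>count_space UNIV)"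
    proof -
      have "emeasure (density (count_space UNIV) ?f) J + emeasure (density (count_space UNIV) ?f) (\<Union>Q\<in>\<Q>'. inside Q) =
         emeasure (density (count_space UNIV) ?f) (J \<union> (\<Union>Q\<in>\<Q>'. inside Q))"
        by (rule plus_emeasure) (auto simp: J_def)
      moreover have "J \<union> (\<Union>Q\<in>\<Q>'. inside Q) = UNIV" by (auto simp: J_def)
      ultimately show ?thesis unfolding emeasure_density_count_space by simp
    qed
    also have "\<dots> = (\<Sum>n. ?f n)" by (rule nn_integral_count_space_nat)
    finally show "Minf nrm h V \<le> (\<Sum>n. ?f n)" by (simp add: add_left_mono)
  qed
qed

end

section \<open>Normalized gauges and condensation\<close>

lemma power_interval_unique:
  fixes M :: real
  assumes "1 < M" "M ^ (k0 + i) \<le> \<eta>" "\<eta> < M ^ (k0 + Suc i)" "M ^ (k0 + j) \<le> \<eta>" "\<eta> < M ^ (k0 + Suc j)"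
  shows "i = j"
proof -
  have "M ^ (k0 + i) < M ^ (k0 + Suc j)" "M ^ (k0 + j) < M ^ (k0 + Suc i)" using assms(2-) by linarith+
  then have "k0 + i < k0 + Suc j" "k0 + j < k0 + Suc i" using assms(1) power_less_imp_less_exp by blast+
  then show ?thesis by simp
qed

lemma power_interval_exists:
  fixes M :: real
  assumes "1 < M" "M ^ k0 \<le> \<eta>" obtains i where "M ^ (k0 + i) \<le> \<eta>" "\<eta> < M ^ (k0 + Suc i)"
proof -
  define P where "P n \<longleftrightarrow> \<eta> < M ^ (k0 + n)" for n
  obtain n where "\<eta> < M ^ n" using real_arch_pow[OF assms(1)] by blast
  also have "M ^ n \<le> M ^ (k0 + n)" using assms(1) by (intro power_increasing) auto
  finally have "P n" by (simp add: P_def)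
  then have L: "P (LEAST n. P n)" by (rule LeastI)
  then obtain i where i: "(LEAST n. P n) = Suc i" using assms(2) by (cases "LEAST n. P n") (auto simp: P_def)
  then have "\<not> P i" using not_less_Least[of i P] by simp
  then show ?thesis using that[of i] L i by (simp add: P_def)
qed

text \<open>Cauchy condensation on the intervals [M^k, M^(k+1)): the integrand is sandwiched between
  step functions built from endpoint values, and M \<ge> 2 makes the length of an interval at least
  its left endpoint.\<close>

lemma condensation:
  fixes G :: "real \<Rightarrow> real" and M :: real
  assumes M: "2 \<le> M" and d: "0 < d" and G: "\<And>x. M ^ k0 \<le> x \<Longrightarrow> 0 \<le> G x" "\<And>x y. M ^ k0 \<le> x \<Longrightarrow> x \<le> y \<Longrightarrow> G y \<le> G x"
  shows "(\<integral>\<^sup>+\<eta>\<in>{M ^ k0..}. ennreal (\<eta> ^ (d - 1) * G \<eta>) \<partial>lborel) < \<infinity> \<longleftrightarrow> summable (\<lambda>k. (M ^ k) ^ d * G (M ^ k))"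
    (is "?I < \<infinity> \<longleftrightarrow> ?S")
proof
  define a where "a k = M ^ (k0 + k)" for k
  have a: "0 < a k" "M ^ k0 \<le> a k" "a k \<le> a (Suc k)" for k
    using M by (auto simp: a_def intro!: power_increasing)
  have len: "emeasure lborel {a k..<a (Suc k)} = ennreal (a (Suc k) - a k)" for k using a by simp
  have aS: "a (Suc k) = M * a k" for k by (simp add: a_def)
  have dS: "x ^ d = x ^ (d - 1) * x" for x :: real using d by (cases d) auto
  let ?f = "\<lambda>\<eta>. ennreal (\<eta> ^ (d - 1) * G \<eta>) * indicator {M ^ k0..} \<eta>"
  show ?S if fin: "?I < \<infinity>"
  proof -
    define c where "c k = a k ^ (d - 1) * G (a (Suc k))" for k
    have c: "0 \<le> c k" for k using a(1)[of k] G(1)[OF a(2)[of "Suc k"]] by (simp add: c_def)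
    have point: "(\<Sum>k<n. ennreal (c k) * indicator {a k..<a (Suc k)} \<eta>) \<le> ?f \<eta>" for n \<eta>
    proof (cases "\<exists>i<n. \<eta> \<in> {a i..<a (Suc i)}")
      case True
      then obtain i where i: "i < n" "\<eta> \<in> {a i..<a (Suc i)}" by blast
      have "indicator {a k..<a (Suc k)} \<eta> = (if k = i then 1 else 0 :: ennreal)" for k
      proof (cases "\<eta> \<in> {a k..<a (Suc k)}")
        case True
        have "k = i"
          using power_interval_unique[of M k0 k \<eta> i] True i(2) M
          unfolding a_def atLeastLessThan_iff by linarith
        then show ?thesis using True by simp
      next
        case False
        then show ?thesis using i(2) by auto
      qed
      then have "(\<Sum>k<n. ennreal (c k) * indicator {a k..<a (Suc k)} \<eta>) = (\<Sum>k<n. if k = i then ennreal (c i) else 0)"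
        by (intro sum.cong) simp_all
      also have "\<dots> = ennreal (c i)" using i by simp
      also have "\<dots> \<le> ennreal (\<eta> ^ (d - 1) * G \<eta>)"
        using i a[of i] G(1)[of "\<eta>"] G(2)[of \<eta> "a (Suc i)"] G(1)[of "a (Suc i)"] a[of "Suc i"]
        unfolding c_def by (intro ennreal_leI mult_mono power_mono) auto
      also have "\<dots> = ?f \<eta>" using i a(2)[of i] by (auto simp: indicator_def)
      finally show ?thesis .
    next
      case False
      then have "(\<Sum>k<n. ennreal (c k) * indicator {a k..<a (Suc k)} \<eta>) = 0"
        by (intro sum.neutral) (auto simp: indicator_def)
      then show ?thesis by simp
    qed
    have term_nonneg: "0 \<le> c k * (a (Suc k) - a k)" for k using c a by simp
    have bd: "(\<Sum>k<n. c k * (a (Suc k) - a k)) \<le> enn2real ?I" for n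
    proof -
      have diff: "0 \<le> a (Suc k) - a k" for k using a(3)[of k] by simp
      have "ennreal (\<Sum>k<n. c k * (a (Suc k) - a k)) = (\<Sum>k<n. ennreal (c k * (a (Suc k) - a k)))"
        by (rule sum_ennreal[symmetric]) (rule term_nonneg)
      also have "\<dots> = (\<Sum>k<n. ennreal (c k) * emeasure lborel {a k..<a (Suc k)})"
        by (simp only: len ennreal_mult[OF c diff])
      also have "\<dots> = (\<integral>\<^sup>+\<eta>. (\<Sum>k<n. ennreal (c k) * indicator {a k..<a (Suc k)} \<eta>) \<partial>lborel)"
        by (subst nn_integral_sum) (auto simp: nn_integral_cmult_indicator)
      also have "\<dots> \<le> ?I" by (intro nn_integral_mono point)
      finally have "ennreal (\<Sum>k<n. c k * (a (Suc k) - a k)) \<le> ?I" .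
      then have "enn2real (ennreal (\<Sum>k<n. c k * (a (Suc k) - a k))) \<le> enn2real ?I"
        using fin by (intro enn2real_mono) auto
      then show ?thesis by (simp add: sum_nonneg term_nonneg)
    qed
    have "summable (\<lambda>k. c k * (a (Suc k) - a k))"
      by (rule summableI_nonneg_bounded[OF term_nonneg bd])
    then have "summable (\<lambda>k. M ^ d * (c k * (a (Suc k) - a k)))" by (rule summable_mult)
    then have "summable (\<lambda>k. a (Suc k) ^ d * G (a (Suc k)))"
    proof (rule summable_comparison_test'[of _ 0])
      fix k
      have "a k \<le> a (Suc k) - a k" using M a(1)[of k] by (simp add: aS)
      then have "(a k ^ (d - 1) * G (a (Suc k))) * a k \<le> c k * (a (Suc k) - a k)"
        using c[of k] unfolding c_def by (intro mult_left_mono) auto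
      then have "M ^ d * (a k ^ d * G (a (Suc k))) \<le> M ^ d * (c k * (a (Suc k) - a k))"
        using M by (intro mult_left_mono) (auto simp: dS[of "a k"] mult_ac)
      then show "norm (a (Suc k) ^ d * G (a (Suc k))) \<le> M ^ d * (c k * (a (Suc k) - a k))"
        using G(1)[OF a(2)[of "Suc k"]] a(1)[of "Suc k"] by (simp add: abs_mult) (simp add: aS power_mult_distrib mult_ac)
    qed
    then have "summable (\<lambda>k. (M ^ (k + (k0 + 1))) ^ d * G (M ^ (k + (k0 + 1))))"
      by (simp add: a_def add_ac)
    then show ?thesis using summable_iff_shift[of "\<lambda>k. (M ^ k) ^ d * G (M ^ k)" "k0 + 1"] by blast
  qed
  show "?I < \<infinity>" if s: ?S
  proof -
    define c where "c k = a (Suc k) ^ (d - 1) * G (a k)" for k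
    have c: "0 \<le> c k" for k using a(1)[of "Suc k"] G(1)[OF a(2)[of k]] by (simp add: c_def)
    have point: "?f \<eta> \<le> (\<Sum>k. ennreal (c k) * indicator {a k..<a (Suc k)} \<eta>)" for \<eta>
    proof (cases "M ^ k0 \<le> \<eta>")
      case True
      obtain i where i: "\<eta> \<in> {a i..<a (Suc i)}"
        using power_interval_exists[of M k0 \<eta>] True M by (auto simp: a_def)
      have "?f \<eta> = ennreal (\<eta> ^ (d - 1) * G \<eta>)" using True by simp
      also have "\<dots> \<le> ennreal (c i) * indicator {a i..<a (Suc i)} \<eta>"
        using i a[of i] G(1)[of "\<eta>"] G(2)[of "a i" \<eta>] True
        unfolding c_def by (auto intro!: ennreal_leI mult_mono power_mono)
      also have "\<dots> \<le> (\<Sum>k. ennreal (c k) * indicator {a k..<a (Suc k)} \<eta>)"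
        by (rule order.trans[OF _ sum_le_suminf[of "\<lambda>k. ennreal (c k) * indicator {a k..<a (Suc k)} \<eta>" "{i}"]]) (simp_all del: sum_mult_indicator)
      finally show ?thesis .
    qed simp
    have "?I \<le> (\<integral>\<^sup>+\<eta>. (\<Sum>k. ennreal (c k) * indicator {a k..<a (Suc k)} \<eta>) \<partial>lborel)"
      by (intro nn_integral_mono point)
    also have "\<dots> = (\<Sum>k. ennreal (c k) * emeasure lborel {a k..<a (Suc k)})"
      by (subst nn_integral_suminf) (auto simp: nn_integral_cmult_indicator)
    also have "\<dots> \<le> (\<Sum>k. ennreal (M ^ d * (a k ^ d * G (a k))))"
    proof (intro suminf_le)
      fix k
      have "c k * (a (Suc k) - a k) \<le> c k * a (Suc k)" using c[of k] a(1)[of k] by (intro mult_left_mono) auto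
      also have "\<dots> = M ^ d * (a k ^ d * G (a k))"
        using dS[of "a (Suc k)"] unfolding c_def by (simp add: aS power_mult_distrib mult_ac)
      finally show "ennreal (c k) * emeasure lborel {a k..<a (Suc k)} \<le> ennreal (M ^ d * (a k ^ d * G (a k)))"
        using c[of k] a(3)[of k] unfolding len by (simp add: ennreal_mult'[symmetric] ennreal_leI)
    qed auto
    also have "\<dots> < \<infinity>"
    proof -
      have "summable (\<lambda>k. (M ^ (k + k0)) ^ d * G (M ^ (k + k0)))"
        using s summable_iff_shift[of "\<lambda>k. (M ^ k) ^ d * G (M ^ k)" k0] by blast
      then have "summable (\<lambda>k. M ^ d * (a k ^ d * G (a k)))"
        by (intro summable_mult) (simp add: a_def add.commute)
      moreover have "0 \<le> M ^ d * (a k ^ d * G (a k))" for k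
        using M a[of k] G(1)[OF a(2)[of k]] by simp
      ultimately show ?thesis by (subst suminf_ennreal2) auto
    qed
    finally show ?thesis .
  qed
qed

section \<open>Normalization of gauges\<close>

lemma le_ennreal_less_top: "x \<le> ennreal s \<Longrightarrow> x < top"
  by (rule le_less_trans[OF _ ennreal_less_top])

text \<open>The antimonotone factor left of \<open>dnorm\<close> when r^d is split off.\<close>

definition dratio :: "nat \<Rightarrow> (ennreal \<Rightarrow> ennreal) \<Rightarrow> ennreal \<Rightarrow> ennreal" where
  "dratio d g r = (INF \<rho>\<in>{0<..r}. g \<rho> / \<rho> ^ d)"

lemma dratio_antimono: "r \<le> s \<Longrightarrow> dratio d g s \<le> dratio d g r"
  unfolding dratio_def by (intro INF_superset_mono) auto

lemma dratio_le: "0 < \<rho> \<Longrightarrow> \<rho> \<le> r \<Longrightarrow> dratio d g r \<le> g \<rho> / \<rho> ^ d"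
  unfolding dratio_def by (intro INF_lower) auto

lemma dnorm_eq: "0 < r \<Longrightarrow> dnorm d g (ennreal r) = ennreal (r ^ d) * dratio d g (ennreal r)"
  by (simp add: dnorm_def dratio_def ennreal_power)

lemma dnorm_0 [simp]: "dnorm d g 0 = 0"
  by (simp add: dnorm_def)

lemma pos_times_divide_cancel:
  "0 < r \<Longrightarrow> ennreal r * (x / ennreal r) = x"
  by (subst ennreal_times_divide, subst mult.commute) (auto intro!: mult_divide_eq_ennreal)

lemma dnorm_le:
  assumes "0 < r" shows "dnorm d g (ennreal r) \<le> g (ennreal r)"
proof -
  have "dnorm d g (ennreal r) \<le> ennreal (r ^ d) * (g (ennreal r) / ennreal r ^ d)"
    unfolding dnorm_eq[OF assms] using assms by (intro mult_left_mono dratio_le) auto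
  also have "\<dots> = g (ennreal r)" using assms by (simp add: pos_times_divide_cancel ennreal_power)
  finally show ?thesis .
qed

text \<open>Each \<rho> in the infimum at s is tested separately: those up to r already occur in the
  infimum at r, and for r < \<rho> \<le> s monotonicity of g gives g r \<le> g \<rho> \<le> s^d * g
  \<rho> / \<rho>^d.\<close>

lemma dnorm_mono:
  assumes g: "mono_on {0..\<epsilon>} g" and "0 < r" "r \<le> s" "ennreal s \<le> \<epsilon>"
  shows "dnorm d g (ennreal r) \<le> dnorm d g (ennreal s)"
proof -
  have s: "0 < s" using assms by linarith
  have "dnorm d g (ennreal r) / ennreal (s ^ d) \<le> dratio d g (ennreal s)"
    unfolding dratio_def[of d g "ennreal s"]
  proof (rule INF_greatest)
    fix \<rho> assume \<rho>: "\<rho> \<in> {0<..ennreal s}"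
    then have "\<rho> < top" by (auto intro: le_ennreal_less_top)
    then obtain x where x: "\<rho> = ennreal x" "0 < x" "x \<le> s"
      using \<rho> s by (cases \<rho>) (auto simp: ennreal_le_iff)
    have "dnorm d g (ennreal r) \<le> ennreal (s ^ d) * (g \<rho> / \<rho> ^ d)"
    proof (cases "x \<le> r")
      case True
      have "dnorm d g (ennreal r) = ennreal (r ^ d) * dratio d g (ennreal r)" by (rule dnorm_eq[OF assms(2)])
      also have "\<dots> \<le> ennreal (s ^ d) * (g \<rho> / \<rho> ^ d)"
        using x True assms by (intro mult_mono dratio_le) (auto simp: ennreal_leI power_mono)
      finally show ?thesis .
    next
      case False
      have "ennreal x \<le> ennreal s" using x by (intro ennreal_leI) auto
      then have "ennreal x \<le> \<epsilon>" using assms(4) by (rule order.trans)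
      have "ennreal r \<le> \<epsilon>" using ennreal_leI[OF assms(3)] assms(4) by (rule order.trans)
      with \<open>ennreal x \<le> \<epsilon>\<close> have "g (ennreal r) \<le> g \<rho>" using False x by (intro mono_onD[OF g]) (auto simp: ennreal_leI)
      then have "dnorm d g (ennreal r) \<le> g \<rho>" using dnorm_le[OF assms(2), of d g] by (rule order.trans[rotated])
      also have "\<dots> = ennreal (x ^ d) * (g \<rho> / \<rho> ^ d)" using x by (simp add: pos_times_divide_cancel ennreal_power)
      also have "\<dots> \<le> ennreal (s ^ d) * (g \<rho> / \<rho> ^ d)" using x by (intro mult_right_mono ennreal_leI power_mono) auto
      finally show ?thesis .
    qed
    then have "dnorm d g (ennreal r) / ennreal (s ^ d) \<le> ennreal (s ^ d) * (g \<rho> / \<rho> ^ d) / ennreal (s ^ d)"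
      by (rule divide_right_mono_ennreal)
    also have "\<dots> = g \<rho> / \<rho> ^ d" using s by (subst mult.commute) (auto intro!: mult_divide_eq_ennreal)
    finally show "dnorm d g (ennreal r) / ennreal (s ^ d) \<le> g \<rho> / \<rho> ^ d" .
  qed
  then have "ennreal (s ^ d) * (dnorm d g (ennreal r) / ennreal (s ^ d)) \<le> ennreal (s ^ d) * dratio d g (ennreal s)"
    by (rule mult_left_mono) simp
  then show ?thesis using s by (simp add: pos_times_divide_cancel dnorm_eq)
qed

text \<open>A lower bound for g(r)/r^d near 0 holds at all smaller scales at once, hence for their
  infimum: normalizing preserves it.\<close>

lemma ell_gtD:
  assumes "ennreal c < ell d g"
  shows "\<exists>\<delta>>0. \<forall>r. 0 < r \<longrightarrow> r \<le> \<delta> \<longrightarrow> ennreal (c * r ^ d) \<le> dnorm d g (ennreal r)"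
proof -
  have "\<forall>\<^sub>F r in at_right 0. ennreal c < g (ennreal r) / ennreal r ^ d"
    using assms unfolding ell_def by (rule less_LiminfD)
  then obtain b where b: "0 < b" "\<And>r. 0 < r \<Longrightarrow> r < b \<Longrightarrow> ennreal c < g (ennreal r) / ennreal r ^ d"
    unfolding eventually_at_right_field by auto
  have 1: "ennreal c \<le> dratio d g (ennreal r)" if r: "0 < r" "r \<le> b / 2" for r
    unfolding dratio_def
  proof (rule INF_greatest)
    fix \<rho> assume \<rho>: "\<rho> \<in> {0<..ennreal r}"
    then have "\<rho> < top" by (auto intro: le_ennreal_less_top)
    then obtain x where x: "\<rho> = ennreal x" "0 < x" "x \<le> r"
      using \<rho> r by (cases \<rho>) (auto simp: ennreal_le_iff)
    then show "ennreal c \<le> g \<rho> / \<rho> ^ d" using less_imp_le[OF b(2)[of x]] r b(1) by simp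
  qed
  have 2: "ennreal (c * r ^ d) \<le> dnorm d g (ennreal r)" if r: "0 < r" "r \<le> b / 2" for r
  proof -
    have "ennreal (c * r ^ d) = ennreal (r ^ d) * ennreal c" using r by (simp add: ennreal_mult'' mult.commute)
    also have "\<dots> \<le> dnorm d g (ennreal r)" unfolding dnorm_eq[OF r(1)] by (intro mult_left_mono 1 r) auto
    finally show ?thesis .
  qed
  show ?thesis using b(1) 2 by (intro exI[of _ "b / 2"]) auto
qed

text \<open>Bridge from an extended-real gauge g to a real G that equals its normalization on (0,
  \<epsilon>]. Properties of g itself are recorded as well, because Hausdorff measures are formed
  with g and not with \<open>dnorm\<close>.\<close>

definition represents :: "nat \<Rightarrow> (ennreal \<Rightarrow> ennreal) \<Rightarrow> real \<Rightarrow> (real \<Rightarrow> real) \<Rightarrow> bool" where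
  "represents d g \<epsilon> G \<longleftrightarrow> dgauge_on d \<epsilon> G \<and> (\<forall>r. 0 < r \<longrightarrow> r \<le> \<epsilon> \<longrightarrow> dnorm d g (ennreal r) = ennreal (G r)) \<and>
     mono_on {0..ennreal \<epsilon>} g \<and> (\<forall>r. 0 < r \<longrightarrow> r \<le> \<epsilon> \<longrightarrow> g (ennreal r) < top) \<and>
     (\<forall>c>0. \<exists>\<delta>>0. \<forall>r. 0 < r \<longrightarrow> r \<le> \<delta> \<longrightarrow> g (ennreal r) \<le> ennreal c)"

lemma representsD:
  assumes "represents d g \<epsilon> G"
  shows "dgauge_on d \<epsilon> G" "0 < r \<Longrightarrow> r \<le> \<epsilon> \<Longrightarrow> dnorm d g (ennreal r) = ennreal (G r)"
    "mono_on {0..ennreal \<epsilon>} g" "0 < c \<Longrightarrow> \<exists>\<delta>>0. \<forall>r. 0 < r \<longrightarrow> r \<le> \<delta> \<longrightarrow> g (ennreal r) \<le> ennreal c"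
  using assms unfolding represents_def by blast+

text \<open>\<epsilon> is limited by three requirements: g monotone, g finite (from its limit 0),
  and the normalization positive (from a positive \<open>ell\<close>).\<close>

lemma gauge_represents:
  assumes g: "gauge g" and l: "0 < ell d g"
  obtains \<epsilon> G where "represents d g \<epsilon> G"
proof -
  obtain e0 where e0: "0 < e0" "mono_on {0..e0} g" using g by (auto simp: gauge_def)
  have lim: "(g \<longlongrightarrow> 0) (at 0)" using g by (simp add: gauge_def)
  have near0: "\<exists>\<delta>>0. \<forall>r. 0 < r \<longrightarrow> r \<le> \<delta> \<longrightarrow> g (ennreal r) \<le> ennreal c" if c: "0 < c" for c
  proof -
    have "\<forall>\<^sub>F x in at 0. g x < ennreal c" using lim c by (intro order_tendstoD) auto
    moreover have "filterlim ennreal (at 0) (at_right 0)"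
    proof (rule filterlim_atI)
      show "(ennreal \<longlongrightarrow> 0) (at_right 0)" using tendsto_ennrealI[of "\<lambda>x. x" 0 "at_right 0"] by (simp add: tendsto_ident_at)
      show "\<forall>\<^sub>F x in at_right 0. ennreal x \<noteq> 0" using eventually_at_right_less[of "0::real"] by (auto elim!: eventually_mono)
    qed
    ultimately have "\<forall>\<^sub>F r in at_right 0. g (ennreal r) < ennreal c" by (rule eventually_compose_filterlim)
    then obtain b where "0 < b" "\<And>r. 0 < r \<Longrightarrow> r < b \<Longrightarrow> g (ennreal r) < ennreal c"
      unfolding eventually_at_right_field by auto
    then have "g (ennreal r) \<le> ennreal c" if "0 < r" "r \<le> b / 2" for r
      using that by (intro less_imp_le) simp
    then show ?thesis using \<open>0 < b\<close> by (intro exI[of _ "b / 2"]) simp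
  qed
  obtain e1 where e1: "0 < e1" "\<And>r. 0 < r \<Longrightarrow> r \<le> e1 \<Longrightarrow> g (ennreal r) \<le> ennreal 1" using near0[of 1] by auto
  obtain c' where c': "0 < c'" "c' < ell d g" using dense l by blast
  then obtain c where c: "0 < c" "ennreal c < ell d g"
  proof (cases c')
    case (real r)
    then have "0 < r" using c' by simp
    then show ?thesis using real c' that by blast
  next
    case top
    then show ?thesis using c' by simp
  qed
  obtain e2 where e2: "0 < e2" "\<And>r. 0 < r \<Longrightarrow> r \<le> e2 \<Longrightarrow> ennreal (c * r ^ d) \<le> dnorm d g (ennreal r)"
    using ell_gtD[OF c(2)] by blast
  obtain e3 where e3: "0 < e3" "ennreal e3 \<le> e0"
  proof (cases e0)
    case (real r)
    then have "0 < r" using e0(1) by simp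
    then show ?thesis using that[of r] real by simp
  next
    case top
    then show ?thesis using that[of 1] by simp
  qed
  define \<epsilon> where "\<epsilon> = min e1 (min e2 e3)"
  define G where "G r = enn2real (dnorm d g (ennreal r))" for r
  have fin: "g (ennreal r) < top" "dnorm d g (ennreal r) < top" if "0 < r" "r \<le> \<epsilon>" for r
  proof -
    have "g (ennreal r) \<le> ennreal 1" using e1(2)[of r] that by (simp add: \<epsilon>_def)
    then show g_fin: "g (ennreal r) < top" by (rule le_less_trans) simp
    show "dnorm d g (ennreal r) < top" using dnorm_le[OF that(1)] g_fin by (rule le_less_trans)
  qed
  have G: "dnorm d g (ennreal r) = ennreal (G r)" if "0 < r" "r \<le> \<epsilon>" for r
    using fin[OF that] by (simp add: G_def)
  have mono: "mono_on {0..ennreal \<epsilon>} g"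
  proof (rule mono_on_subset[OF e0(2)])
    have "ennreal \<epsilon> \<le> ennreal e3" by (intro ennreal_leI) (simp add: \<epsilon>_def)
    then have "ennreal \<epsilon> \<le> e0" using e3(2) by (rule order.trans)
    then show "{0..ennreal \<epsilon>} \<subseteq> {0..e0}" by auto
  qed
  have Gpos: "0 < G r" if "0 < r" "r \<le> \<epsilon>" for r
  proof -
    have "ennreal (c * r ^ d) \<le> ennreal (G r)" using e2(2)[of r] that G[OF that] by (simp add: \<epsilon>_def)
    moreover have "0 < ennreal (c * r ^ d)" using c that by simp
    ultimately have "0 < ennreal (G r)" by (rule less_le_trans[rotated])
    then show ?thesis by simp
  qed
  have "dgauge_on d \<epsilon> G" unfolding dgauge_on_def
  proof (intro conjI allI impI)
    show "0 < \<epsilon>" using e1 e2 e3 by (simp add: \<epsilon>_def)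
    fix r s assume rs: "0 < r" "r \<le> s" "s \<le> \<epsilon>"
    then have s: "0 < s" "r \<le> \<epsilon>" by auto
    have "ennreal (G r) \<le> ennreal (G s)"
      using dnorm_mono[OF mono rs(1,2), of d] rs s G ennreal_leI[of s \<epsilon>] by simp
    then show "G r \<le> G s" using Gpos[OF s(1) rs(3)] by (simp add: ennreal_le_iff)
    have "ennreal (G s / s ^ d) = dratio d g (ennreal s)"
    proof -
      have "ennreal (G s / s ^ d) = dnorm d g (ennreal s) / ennreal (s ^ d)"
        using G[OF s(1) rs(3)] Gpos[OF s(1) rs(3)] s by (simp add: divide_ennreal)
      also have "\<dots> = dratio d g (ennreal s)"
        unfolding dnorm_eq[OF s(1)] using s by (subst mult.commute) (auto intro!: mult_divide_eq_ennreal)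
      finally show ?thesis .
    qed
    also have "\<dots> \<le> dratio d g (ennreal r)" using rs by (intro dratio_antimono ennreal_leI)
    also have "\<dots> = ennreal (G r / r ^ d)"
    proof -
      have "ennreal (G r / r ^ d) = dnorm d g (ennreal r) / ennreal (r ^ d)"
        using G[OF rs(1) s(2)] Gpos[OF rs(1) s(2)] rs by (simp add: divide_ennreal)
      also have "\<dots> = dratio d g (ennreal r)"
        unfolding dnorm_eq[OF rs(1)] using rs by (subst mult.commute) (auto intro!: mult_divide_eq_ennreal)
      finally show ?thesis by simp
    qed
    finally show "G s / s ^ d \<le> G r / r ^ d" using Gpos[OF rs(1) s(2)] rs by (subst (asm) ennreal_le_iff) auto
  qed (use Gpos in auto)
  then have "represents d g \<epsilon> G" unfolding represents_def using G mono fin near0 by blast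
  then show ?thesis by (rule that)
qed

lemma represents_unbounded:
  assumes "represents d g \<epsilon> G" "ell d g = top"
  shows "\<exists>\<delta>>0. \<forall>x. 0 < x \<longrightarrow> x \<le> \<delta> \<longrightarrow> B \<le> G x / x ^ d"
proof -
  have "ennreal (max B 1) < ell d g" using assms(2) by simp
  then obtain \<delta> where \<delta>: "0 < \<delta>" "\<And>r. 0 < r \<Longrightarrow> r \<le> \<delta> \<Longrightarrow> ennreal (max B 1 * r ^ d) \<le> dnorm d g (ennreal r)"
    using ell_gtD[of "max B 1" d g] by blast
  note GD = representsD[OF assms(1)] dgauge_onD[OF representsD(1)[OF assms(1)]]
  have "B \<le> G x / x ^ d" if x: "0 < x" "x \<le> min \<delta> \<epsilon>" for x
  proof -
    have "ennreal (max B 1 * x ^ d) \<le> ennreal (G x)" using \<delta>(2)[of x] GD(2)[of x] x by simp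
    then have "max B 1 * x ^ d \<le> G x" using GD(6)[of x] x by (simp add: ennreal_le_iff)
    moreover have "B * x ^ d \<le> max B 1 * x ^ d" using x by (intro mult_right_mono) auto
    ultimately have "B * x ^ d \<le> G x" by linarith
    then show ?thesis using x by (simp add: pos_le_divide_eq)
  qed
  then show ?thesis using \<delta>(1) GD(5) by (intro exI[of _ "min \<delta> \<epsilon>"]) auto
qed

lemma dgauge_on_mono_ennreal:
  assumes h: "h 0 = 0" "\<And>r. 0 < r \<Longrightarrow> r \<le> \<epsilon> \<Longrightarrow> h (ennreal r) = ennreal (G r)" and G: "dgauge_on d \<epsilon> G"
  shows "mono_on {0..ennreal \<epsilon>} h"
proof (rule mono_onI)
  note GD = dgauge_onD[OF G]
  fix r s :: ennreal assume rs: "r \<in> {0..ennreal \<epsilon>}" "s \<in> {0..ennreal \<epsilon>}" "r \<le> s"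
  show "h r \<le> h s"
  proof (cases "r = 0")
    case False
    have "r < top" "s < top" using rs by (auto intro: le_ennreal_less_top)
    then obtain x y where xy: "r = ennreal x" "s = ennreal y" "0 \<le> x" "0 \<le> y" by (auto simp: less_top_ennreal)
    then have "0 < x" "x \<le> y" "y \<le> \<epsilon>" using rs False GD(1) by (auto simp: ennreal_le_iff)
    then show ?thesis using h(2) GD(3) xy by (simp add: ennreal_leI)
  qed (simp add: h)
qed

lemma eps_h_ge:
  assumes h: "h 0 = 0" "\<And>r. 0 < r \<Longrightarrow> r \<le> \<epsilon> \<Longrightarrow> h (ennreal r) = ennreal (G r)" and G: "dgauge_on d \<epsilon> G"
  shows "ennreal \<epsilon> \<le> eps_h d h"
  unfolding eps_h_def
proof (intro Sup_upper CollectI exI[of _ \<epsilon>] conjI allI impI)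
  note GD = dgauge_onD[OF G]
  show "ennreal \<epsilon> = ennreal \<epsilon>" "0 < \<epsilon>" using GD(1) by auto
  show "mono_on {0..ennreal \<epsilon>} h" by (rule dgauge_on_mono_ennreal[OF h G])
  fix r s :: real assume rs: "0 < r" "r \<le> s" "s \<le> \<epsilon>"
  then show "h (ennreal s) / ennreal s ^ d \<le> h (ennreal r) / ennreal r ^ d"
    using h(2) GD(2)[of r] GD(2)[of s] GD(4)[OF rs] by (simp add: ennreal_power divide_ennreal less_imp_le ennreal_leI)
qed

text \<open>A gauge may fail to be measurable away from 0, but its normalization is r^d times an
  antimonotone function, whose superlevel sets are intervals.\<close>

lemma dnorm_measurable:
  "(\<lambda>r. dnorm d g (ennreal r) * indicator {0<..1} r) \<in> borel_measurable borel"
proof -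
  define j where "j r = dratio d g (ennreal r) * indicator {0<..} r" for r :: real
  have "j \<in> borel_measurable borel"
  proof (rule borel_measurableI_greater)
    fix y
    have "is_interval {x. y < j x}"
      unfolding is_interval_1
    proof (intro ballI allI impI)
      fix a b x assume "a \<in> {x. y < j x}" "b \<in> {x. y < j x}" "a \<le> x \<and> x \<le> b"
      then have ab: "y < j a" "y < j b" "a \<le> x" "x \<le> b" by auto
      have "0 < a" using ab(1) by (cases "0 < a") (auto simp: j_def)
      then have "j b \<le> j x" using ab dratio_antimono[of "ennreal x" "ennreal b" d g] by (auto simp: j_def ennreal_leI)
      then show "x \<in> {x. y < j x}" using ab(2) by auto
    qed
    then have "{x. y < j x} \<in> sets borel" by (intro real_interval_borel_measurable) auto
    then show "{x \<in> space borel. y < j x} \<in> sets borel" by simp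
  qed
  then have "(\<lambda>r. ennreal (r ^ d) * j r * indicator {0<..1} r) \<in> borel_measurable borel" by measurable
  also have "(\<lambda>r. ennreal (r ^ d) * j r * indicator {0<..1} r) = (\<lambda>r. dnorm d g (ennreal r) * indicator {0<..1} r)"
    by (auto simp: fun_eq_iff indicator_def j_def dnorm_eq)
  finally show ?thesis .
qed

section \<open>Covers by small balls\<close>

text \<open>The ratio of G to r^d decreases, so the infimum in \<open>dnorm\<close> is attained at
  the right endpoint and normalizing h changes nothing on (0, \<epsilon>].\<close>

lemma represents_self:
  assumes h: "h 0 = 0" "\<And>r. 0 < r \<Longrightarrow> r \<le> \<epsilon> \<Longrightarrow> h (ennreal r) = ennreal (G r)" and G: "dgauge_on d \<epsilon> G"
    and lim: "\<And>c. 0 < c \<Longrightarrow> \<exists>\<delta>>0. \<forall>r. 0 < r \<longrightarrow> r \<le> \<delta> \<longrightarrow> G r \<le> c"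
  shows "represents d h \<epsilon> G"
proof -
  note GD = dgauge_onD[OF G]
  have dn: "dnorm d h (ennreal r) = ennreal (G r)" if r: "0 < r" "r \<le> \<epsilon>" for r
  proof (rule antisym)
    show "dnorm d h (ennreal r) \<le> ennreal (G r)" using dnorm_le[OF r(1), of d h] h(2)[OF r] by simp
    have "ennreal (G r / r ^ d) \<le> dratio d h (ennreal r)"
      unfolding dratio_def
    proof (rule INF_greatest)
      fix \<rho> assume \<rho>: "\<rho> \<in> {0<..ennreal r}"
      then have "\<rho> < top" by (auto intro: le_ennreal_less_top)
      then obtain x where x: "\<rho> = ennreal x" "0 < x" "x \<le> r"
        using \<rho> r by (cases \<rho>) (auto simp: ennreal_le_iff)
      have "h \<rho> / \<rho> ^ d = ennreal (G x / x ^ d)"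
        using x r h(2)[of x] GD(2)[of x] by (simp add: ennreal_power divide_ennreal)
      then show "ennreal (G r / r ^ d) \<le> h \<rho> / \<rho> ^ d"
        using GD(4)[of x r] x r by (simp add: ennreal_leI)
    qed
    then have "ennreal (r ^ d) * ennreal (G r / r ^ d) \<le> dnorm d h (ennreal r)"
      unfolding dnorm_eq[OF r(1)] by (rule mult_left_mono) simp
    then show "ennreal (G r) \<le> dnorm d h (ennreal r)"
      using r GD(2)[OF r] by (simp add: ennreal_mult'[symmetric])
  qed
  have mono: "mono_on {0..ennreal \<epsilon>} h" by (rule dgauge_on_mono_ennreal[OF h G])
  have near0: "\<exists>\<delta>>0. \<forall>r. 0 < r \<longrightarrow> r \<le> \<delta> \<longrightarrow> h (ennreal r) \<le> ennreal c" if c: "0 < c" for c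
  proof -
    obtain \<delta> where "0 < \<delta>" "\<And>r. 0 < r \<Longrightarrow> r \<le> \<delta> \<Longrightarrow> G r \<le> c" using lim[OF c] by blast
    then show ?thesis using GD(1) h(2) by (intro exI[of _ "min \<delta> \<epsilon>"]) (auto intro!: ennreal_leI)
  qed
  show ?thesis unfolding represents_def using G dn mono near0 h(2) by simp
qed

lemma represents_lim:
  assumes "represents d g \<epsilon> G" "0 < c"
  shows "\<exists>\<delta>>0. \<forall>r. 0 < r \<longrightarrow> r \<le> \<delta> \<longrightarrow> r \<le> \<epsilon> \<longrightarrow> G r \<le> c"
proof -
  note GD = representsD[OF assms(1)] dgauge_onD[OF representsD(1)[OF assms(1)]]
  obtain \<delta> where \<delta>: "0 < \<delta>" "\<And>r. 0 < r \<Longrightarrow> r \<le> \<delta> \<Longrightarrow> g (ennreal r) \<le> ennreal c" using GD(4)[OF assms(2)] by blast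
  have "G r \<le> c" if r: "0 < r" "r \<le> \<delta>" "r \<le> \<epsilon>" for r
  proof -
    have "ennreal (G r) \<le> ennreal c" using GD(2)[OF r(1,3)] dnorm_le[OF r(1), of d g] \<delta>(2)[OF r(1,2)] by simp
    then show ?thesis using assms(2) by (simp add: ennreal_le_iff)
  qed
  then show ?thesis using \<delta>(1) by blast
qed

text \<open>Idempotence of normalization, for the places where \<open>dnorm d g\<close> itself
  serves as the gauge of a net content.\<close>

lemma represents_dnorm:
  assumes "represents d g \<epsilon> G"
  shows "represents d (dnorm d g) \<epsilon> G"
proof (rule represents_self)
  note GD = representsD[OF assms] dgauge_onD[OF representsD(1)[OF assms]]
  show "\<exists>\<delta>>0. \<forall>r. 0 < r \<longrightarrow> r \<le> \<delta> \<longrightarrow> G r \<le> c" if c: "0 < c" for c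
  proof -
    obtain \<delta> where "0 < \<delta>" "\<And>r. 0 < r \<Longrightarrow> r \<le> \<delta> \<Longrightarrow> r \<le> \<epsilon> \<Longrightarrow> G r \<le> c"
      using represents_lim[OF assms c] by blast
    then show ?thesis using GD(5) by (intro exI[of _ "min \<delta> \<epsilon>"]) auto
  qed
qed (use representsD[OF assms] in auto)

section \<open>Passing from balls to dyadic cubes\<close>

context euclidean_norm begin

text \<open>The 4 is a product of two factors 2: R + r \<le> 2R in the counting bound, and a dyadic
  diameter exceeding \<rho>/2.\<close>

definition cube_const :: real where "cube_const = udiam ^ DIM('a) * uvol * 4 ^ DIM('a)"

lemma cube_const_pos: "0 < cube_const"
  using udiam_pos uvol_pos by (simp add: cube_const_def)

lemma nball_cubes:
  assumes "0 < \<rho>" "\<rho> \<le> R"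
  obtains \<D> where "finite \<D>" "nball nrm c R \<subseteq> \<Union>\<D>" "\<And>q. q \<in> \<D> \<Longrightarrow> dyadic_cube q \<and> dm q \<le> \<rho>"
    "real (card \<D>) \<le> cube_const * (R / \<rho>) ^ DIM('a)"
proof -
  obtain j :: int where j: "\<rho> / 2 < udiam * 2 powr (- real_of_int j)" "udiam * 2 powr (- real_of_int j) \<le> \<rho>"
    using cub_diam_less[OF assms(1)] by blast
  define r where "r = udiam * 2 powr (- real_of_int j)"
  have r: "\<rho> / 2 < r" "r \<le> \<rho>" "0 < r" using j assms by (auto simp: r_def)
  define \<D> where "\<D> = cub j ` nball nrm c R"
  have c: "finite \<D>" "real (card \<D>) * r ^ DIM('a) \<le> udiam ^ DIM('a) * uvol * (R + r) ^ DIM('a)"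
    unfolding \<D>_def r_def using assms by (intro cubes_count[where c = c and R = R], auto)+
  have "udiam ^ DIM('a) * uvol * (R + r) ^ DIM('a) \<le> udiam ^ DIM('a) * uvol * (2 * R) ^ DIM('a)"
    using r assms udiam_pos uvol_pos by (intro mult_left_mono power_mono) auto
  moreover have "real (card \<D>) * (\<rho> / 2) ^ DIM('a) \<le> real (card \<D>) * r ^ DIM('a)"
    using r assms by (intro mult_left_mono power_mono) auto
  ultimately have "real (card \<D>) * (\<rho> / 2) ^ DIM('a) \<le> udiam ^ DIM('a) * uvol * (2 * R) ^ DIM('a)" using c(2) by linarith
  then have "real (card \<D>) \<le> udiam ^ DIM('a) * uvol * (2 * R) ^ DIM('a) / (\<rho> / 2) ^ DIM('a)"
    using assms by (simp add: pos_le_divide_eq)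
  also have "\<dots> = udiam ^ DIM('a) * uvol * (2 * R / (\<rho> / 2)) ^ DIM('a)" by (simp only: power_divide times_divide_eq_right)
  also have "2 * R / (\<rho> / 2) = 4 * (R / \<rho>)" by simp
  finally have "real (card \<D>) \<le> cube_const * (R / \<rho>) ^ DIM('a)"
    by (simp only: cube_const_def power_mult_distrib mult.assoc)
  moreover have "dyadic_cube q \<and> dm q \<le> \<rho>" if "q \<in> \<D>" for q using that r by (auto simp: \<D>_def dm_cub r_def)
  moreover have "nball nrm c R \<subseteq> \<Union>\<D>" by (auto simp: \<D>_def)
  ultimately show ?thesis using that c(1) by blast
qed

text \<open>g(r) can be much larger than its normalization G(r), so a ball of radius r must not be
  used as it stands. Some \<rho> \<le> r comes within a factor 2 of the infimum defining G(r), and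
  the ball is covered by about (r/\<rho>)^d cubes of diameter at most \<rho>, at total cost of order
  G(r). This is why only the normalization matters for null sets.\<close>

lemma cube_covers:
  fixes c :: "'i \<Rightarrow> 'a" and r :: "'i \<Rightarrow> real"
  assumes rep: "represents DIM('a) g \<epsilon> G" and I: "countable I" and E: "E \<subseteq> (\<Union>i\<in>I. nball nrm (c i) (r i))"
    and r: "\<And>i. i \<in> I \<Longrightarrow> 0 < r i \<and> r i \<le> \<epsilon>"
  obtains J :: "('i \<times> 'a set) set" where "countable J" "E \<subseteq> (\<Union>p\<in>J. snd p)"
    "\<And>p. p \<in> J \<Longrightarrow> fst p \<in> I \<and> dyadic_cube (snd p) \<and> dm (snd p) \<le> r (fst p)"
    "(\<integral>\<^sup>+p. g (ediam nrm (snd p)) \<partial>count_space J) \<le> ennreal (2 * cube_const) * (\<integral>\<^sup>+i. ennreal (G (r i)) \<partial>count_space I)"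
proof -
  define d where "d = DIM('a)"
  note GD = representsD[OF rep, folded d_def] dgauge_onD[OF representsD(1)[OF rep], folded d_def]
  have "\<exists>\<D>. finite \<D> \<and> nball nrm (c i) (r i) \<subseteq> \<Union>\<D> \<and> (\<forall>q\<in>\<D>. dyadic_cube q \<and> dm q \<le> r i) \<and>
    (\<Sum>q\<in>\<D>. g (ediam nrm q)) \<le> ennreal (2 * cube_const) * ennreal (G (r i))" if i: "i \<in> I" for i
  proof -
    have ri: "0 < r i" "r i \<le> \<epsilon>" using r[OF i] by auto
    have Gi: "0 < G (r i)" using GD(6)[OF ri] .
    have "ennreal (r i ^ d) * dratio d g (ennreal (r i)) = ennreal (G (r i))"
      using GD(2)[OF ri] dnorm_eq[OF ri(1), of d g] by simp
    moreover have "ennreal (G (r i)) < ennreal (r i ^ d) * ennreal (2 * G (r i) / r i ^ d)"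
      using Gi ri by (simp add: ennreal_mult'[symmetric] ennreal_less_iff)
    ultimately have "\<not> ennreal (2 * G (r i) / r i ^ d) \<le> dratio d g (ennreal (r i))"
      using mult_left_mono[of "ennreal (2 * G (r i) / r i ^ d)" "dratio d g (ennreal (r i))" "ennreal (r i ^ d)"] by auto
    then have "dratio d g (ennreal (r i)) < ennreal (2 * G (r i) / r i ^ d)" by simp
    then obtain \<rho>' where \<rho>': "\<rho>' \<in> {0<..ennreal (r i)}" "g \<rho>' / \<rho>' ^ d < ennreal (2 * G (r i) / r i ^ d)"
      unfolding dratio_def INF_less_iff by blast
    then have "\<rho>' < top" by (auto intro: le_ennreal_less_top)
    then obtain \<rho> where \<rho>: "\<rho>' = ennreal \<rho>" "0 < \<rho>" "\<rho> \<le> r i"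
      using \<rho>' ri by (cases \<rho>') (auto simp: ennreal_le_iff)
    have "g (ennreal \<rho>) = ennreal (\<rho> ^ d) * (g \<rho>' / \<rho>' ^ d)"
      using \<rho> by (simp add: pos_times_divide_cancel ennreal_power)
    also have "\<dots> \<le> ennreal (\<rho> ^ d) * ennreal (2 * G (r i) / r i ^ d)" using \<rho>'(2) by (intro mult_left_mono) auto
    finally have g\<rho>: "g (ennreal \<rho>) \<le> ennreal (\<rho> ^ d * (2 * G (r i) / r i ^ d))"
      using \<rho> by (subst ennreal_mult') auto
    obtain \<D> where D: "finite \<D>" "nball nrm (c i) (r i) \<subseteq> \<Union>\<D>" "\<And>q. q \<in> \<D> \<Longrightarrow> dyadic_cube q \<and> dm q \<le> \<rho>"
      "real (card \<D>) \<le> cube_const * (r i / \<rho>) ^ d"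
      using nball_cubes[OF \<rho>(2,3)] unfolding d_def by blast
    have gq: "g (ediam nrm q) \<le> ennreal (\<rho> ^ d * (2 * G (r i) / r i ^ d))" if "q \<in> \<D>" for q
    proof -
      have q: "dyadic_cube q" "dm q \<le> \<rho>" using D(3)[OF that] by auto
      have "g (ediam nrm q) \<le> g (ennreal \<rho>)"
        using q \<rho> ri by (intro mono_onD[OF GD(3)]) (auto simp: ediam_eq_dm ennreal_leI)
      then show ?thesis using g\<rho> by (rule order.trans)
    qed
    have "(\<Sum>q\<in>\<D>. g (ediam nrm q)) \<le> of_nat (card \<D>) * ennreal (\<rho> ^ d * (2 * G (r i) / r i ^ d))"
      by (rule sum_bounded_above[OF gq])
    also have "\<dots> = ennreal (real (card \<D>) * (\<rho> ^ d * (2 * G (r i) / r i ^ d)))"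
      by (simp only: ennreal_of_nat_eq_real_of_nat ennreal_mult'[OF of_nat_0_le_iff])
    also have "\<dots> \<le> ennreal (cube_const * (r i / \<rho>) ^ d * (\<rho> ^ d * (2 * G (r i) / r i ^ d)))"
      using D(4) \<rho> Gi ri by (intro ennreal_leI mult_right_mono) auto
    also have "cube_const * (r i / \<rho>) ^ d * (\<rho> ^ d * (2 * G (r i) / r i ^ d)) = 2 * cube_const * G (r i)"
      using \<rho> ri by (simp add: power_divide)
    finally have "(\<Sum>q\<in>\<D>. g (ediam nrm q)) \<le> ennreal (2 * cube_const) * ennreal (G (r i))"
      using cube_const_pos by (simp add: ennreal_mult')
    moreover have "\<forall>q\<in>\<D>. dyadic_cube q \<and> dm q \<le> r i" using D(3) \<rho>(3) by fastforce
    ultimately show ?thesis using D(1,2) by blast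
  qed
  then obtain \<D> where D: "\<And>i. i \<in> I \<Longrightarrow> finite (\<D> i) \<and> nball nrm (c i) (r i) \<subseteq> \<Union>(\<D> i) \<and> (\<forall>q\<in>\<D> i. dyadic_cube q \<and> dm q \<le> r i) \<and>
    (\<Sum>q\<in>\<D> i. g (ediam nrm q)) \<le> ennreal (2 * cube_const) * ennreal (G (r i))"
    by metis
  define J where "J = Sigma I \<D>"
  show ?thesis
  proof
    show "countable J" unfolding J_def using I D by (intro countable_SIGMA) (auto intro: countable_finite)
    show "E \<subseteq> (\<Union>p\<in>J. snd p)"
    proof
      fix x assume "x \<in> E"
      then obtain i where i: "i \<in> I" "x \<in> nball nrm (c i) (r i)" using E by blast
      then obtain q where "q \<in> \<D> i" "x \<in> q" using D by blast
      then show "x \<in> (\<Union>p\<in>J. snd p)" using i by (intro UN_I[of "(i, q)"]) (auto simp: J_def)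
    qed
    show "fst p \<in> I \<and> dyadic_cube (snd p) \<and> dm (snd p) \<le> r (fst p)" if "p \<in> J" for p
      using that D by (auto simp: J_def)
    have "(\<integral>\<^sup>+p. g (ediam nrm (snd p)) \<partial>count_space J) = (\<integral>\<^sup>+p. g (ediam nrm (snd p)) \<partial>count_space (\<Union>i\<in>I. Pair i ` \<D> i))"
      by (rule arg_cong[where f = "\<lambda>J. (\<integral>\<^sup>+p. g (ediam nrm (snd p)) \<partial>count_space J)"]) (auto simp: J_def)
    also have "\<dots> = (\<integral>\<^sup>+i. (\<integral>\<^sup>+p. g (ediam nrm (snd p)) \<partial>count_space (Pair i ` \<D> i)) \<partial>count_space I)"
      using I by (rule nn_integral_count_space_UN) (auto simp: disjoint_family_on_def)
    also have "\<dots> \<le> (\<integral>\<^sup>+i. ennreal (2 * cube_const) * ennreal (G (r i)) \<partial>count_space I)"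
    proof (rule nn_integral_mono)
      fix i assume "i \<in> space (count_space I)"
      then have i: "i \<in> I" by simp
      have "(\<integral>\<^sup>+p. g (ediam nrm (snd p)) \<partial>count_space (Pair i ` \<D> i)) = (\<integral>\<^sup>+q. g (ediam nrm q) \<partial>count_space (\<D> i))"
        by (subst nn_integral_count_space_inj) (auto simp: inj_on_def)
      also have "\<dots> = (\<Sum>q\<in>\<D> i. g (ediam nrm q))" using D[OF i] by (simp add: nn_integral_count_space_finite)
      finally show "(\<integral>\<^sup>+p. g (ediam nrm (snd p)) \<partial>count_space (Pair i ` \<D> i)) \<le> ennreal (2 * cube_const) * ennreal (G (r i))"
        using D[OF i] by simp
    qed
    also have "\<dots> = ennreal (2 * cube_const) * (\<integral>\<^sup>+i. ennreal (G (r i)) \<partial>count_space I)"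
      by (rule nn_integral_cmult) simp
    finally show "(\<integral>\<^sup>+p. g (ediam nrm (snd p)) \<partial>count_space J) \<le> ennreal (2 * cube_const) * (\<integral>\<^sup>+i. ennreal (G (r i)) \<partial>count_space I)" .
  qed
qed

text \<open>Common form of being null for a Hausdorff measure, for a net content and for Lebesgue
  measure. The index type is fixed because types cannot be quantified existentially; a pair holds
  the stage of an exhaustion and a centre.\<close>

definition null_for :: "(real \<Rightarrow> real) \<Rightarrow> 'a set \<Rightarrow> bool" where
  "null_for G E \<longleftrightarrow> (\<forall>\<delta>>0. \<forall>\<eta>>0. \<exists>(I :: (nat \<times> 'a) set) c r. countable I \<and> E \<subseteq> (\<Union>i\<in>I. nball nrm (c i) (r i)) \<and>
     (\<forall>i\<in>I. 0 < r i \<and> r i \<le> \<delta>) \<and> (\<integral>\<^sup>+i. ennreal (G (r i)) \<partial>count_space I) \<le> ennreal \<eta>)"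

lemma ennreal_le_epsilon_mult:
  assumes "0 \<le> K" "\<And>\<eta>. 0 < \<eta> \<Longrightarrow> x \<le> ennreal K * ennreal \<eta>" shows "x = (0::ennreal)"
proof (rule ccontr)
  assume "x \<noteq> 0"
  have "x \<le> ennreal K * ennreal 1" using assms(2)[of 1] by simp
  then have "x < top" by (rule le_less_trans) (simp add: ennreal_mult_less_top)
  then obtain y where y: "x = ennreal y" "0 < y" using \<open>x \<noteq> 0\<close> by (cases x) auto
  have "ennreal y \<le> ennreal (K * (y / (2 * (K + 1))))"
    using assms(2)[of "y / (2 * (K + 1))"] assms(1) y by (subst ennreal_mult') auto
  then have "y \<le> K * (y / (2 * (K + 1)))" using y assms(1) by (subst (asm) ennreal_le_iff) auto
  also have "\<dots> \<le> y / 2" using y assms(1) by (simp add: field_simps)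
  finally show False using y by simp
qed

lemma null_for_cubes:
  assumes rep: "represents DIM('a) g \<epsilon> G" and null: "null_for G E" and "0 < \<delta>" "0 < \<eta>"
  obtains J :: "((nat \<times> 'a) \<times> 'a set) set" where "countable J" "E \<subseteq> (\<Union>p\<in>J. snd p)"
    "\<And>p. p \<in> J \<Longrightarrow> dyadic_cube (snd p) \<and> dm (snd p) \<le> \<delta>"
    "(\<integral>\<^sup>+p. g (ediam nrm (snd p)) \<partial>count_space J) \<le> ennreal (2 * cube_const) * ennreal \<eta>"
proof -
  have "0 < min \<delta> \<epsilon>" using assms(3) dgauge_onD(1)[OF representsD(1)[OF rep]] by simp
  obtain I :: "(nat \<times> 'a) set" and c r where I: "countable I" "E \<subseteq> (\<Union>i\<in>I. nball nrm (c i) (r i))"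
     "\<forall>i\<in>I. 0 < r i \<and> r i \<le> min \<delta> \<epsilon>" "(\<integral>\<^sup>+i. ennreal (G (r i)) \<partial>count_space I) \<le> ennreal \<eta>"
    using null[unfolded null_for_def, rule_format, OF \<open>0 < min \<delta> \<epsilon>\<close> assms(4)] by (elim exE conjE) (rule that)
  obtain J :: "((nat \<times> 'a) \<times> 'a set) set" where J: "countable J" "E \<subseteq> (\<Union>p\<in>J. snd p)"
    "\<And>p. p \<in> J \<Longrightarrow> fst p \<in> I \<and> dyadic_cube (snd p) \<and> dm (snd p) \<le> r (fst p)"
    "(\<integral>\<^sup>+p. g (ediam nrm (snd p)) \<partial>count_space J) \<le> ennreal (2 * cube_const) * (\<integral>\<^sup>+i. ennreal (G (r i)) \<partial>count_space I)"
    by (rule cube_covers[OF rep I(1,2)]) (use I(3) in auto)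
  have "dyadic_cube (snd p) \<and> dm (snd p) \<le> \<delta>" if "p \<in> J" for p using J(3)[OF that] I(3) by force
  moreover have "(\<integral>\<^sup>+p. g (ediam nrm (snd p)) \<partial>count_space J) \<le> ennreal (2 * cube_const) * ennreal \<eta>"
    by (rule order.trans[OF J(4) mult_left_mono[OF I(4)]]) simp
  ultimately show ?thesis by (intro that[OF J(1,2)])
qed

lemma hausdorff_g_null:
  assumes rep: "represents DIM('a) g \<epsilon> G" and null: "null_for G E" and g0: "g 0 = 0"
  shows "hausdorff_g nrm g E = 0"
proof -
  have "(INF C\<in>{C::nat \<Rightarrow> 'a set. E \<subseteq> (\<Union>n. C n) \<and> (\<forall>n. ediam nrm (C n) \<le> ennreal \<delta>)}.
        (\<Sum>n. g (ediam nrm (C n)))) = 0" (is "?inf = 0") if \<delta>: "0 < \<delta>" for \<delta>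
  proof (rule ennreal_le_epsilon_mult[of "2 * cube_const"])
    fix \<eta> :: real assume "0 < \<eta>"
    obtain J :: "((nat \<times> 'a) \<times> 'a set) set" where J: "countable J" "E \<subseteq> (\<Union>p\<in>J. snd p)"
      "\<And>p. p \<in> J \<Longrightarrow> dyadic_cube (snd p) \<and> dm (snd p) \<le> \<delta>"
      "(\<integral>\<^sup>+p. g (ediam nrm (snd p)) \<partial>count_space J) \<le> ennreal (2 * cube_const) * ennreal \<eta>"
      by (rule null_for_cubes[OF rep null \<delta> \<open>0 < \<eta>\<close>]) (rule that)
    obtain C :: "nat \<Rightarrow> 'a set" where C: "\<And>n. C n = {} \<or> (\<exists>i\<in>J. C n = snd i)" "(\<Union>n. C n) = (\<Union>i\<in>J. snd i)"
      "\<And>f :: 'a set \<Rightarrow> ennreal. f {} = 0 \<Longrightarrow> (\<Sum>n. f (C n)) = (\<integral>\<^sup>+i. f (snd i) \<partial>count_space J)"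
      using countable_family_sequence[OF J(1), of snd] by blast
    have "ediam nrm (C n) \<le> ennreal \<delta>" for n
    proof (cases "C n = {}")
      case False
      then obtain p where "p \<in> J" "C n = snd p" using C(1) by blast
      then show ?thesis using J(3)[of p] by (simp add: ediam_eq_dm ennreal_leI)
    qed simp
    then have "?inf \<le> (\<Sum>n. g (ediam nrm (C n)))" using J(2) C(2) by (intro INF_lower) simp
    also have "\<dots> \<le> ennreal (2 * cube_const) * ennreal \<eta>"
      using C(3)[of "\<lambda>S. g (ediam nrm S)"] g0 J(4) by simp
    finally show "?inf \<le> ennreal (2 * cube_const) * ennreal \<eta>" .
  qed (use cube_const_pos in simp)
  then show ?thesis unfolding hausdorff_g_def by (simp add: SUP_eq_const)
qed

lemma Minf_null:
  assumes rep: "represents DIM('a) h \<epsilon> G" and null: "null_for G E"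
    and h: "h 0 = 0" "\<And>r. 0 < r \<Longrightarrow> r \<le> \<epsilon> \<Longrightarrow> h (ennreal r) = ennreal (G r)"
  shows "Minf nrm h E = 0"
proof (rule ennreal_le_epsilon_mult[of "2 * cube_const"])
  note GD = dgauge_onD[OF representsD(1)[OF rep]]
  fix \<eta> :: real assume \<eta>: "0 < \<eta>"
  obtain J :: "((nat \<times> 'a) \<times> 'a set) set" where J: "countable J" "E \<subseteq> (\<Union>p\<in>J. snd p)"
      "\<And>p. p \<in> J \<Longrightarrow> dyadic_cube (snd p) \<and> dm (snd p) \<le> \<epsilon> / 2"
      "(\<integral>\<^sup>+p. h (ediam nrm (snd p)) \<partial>count_space J) \<le> ennreal (2 * cube_const) * ennreal \<eta>"
    by (rule null_for_cubes[OF rep null half_gt_zero[OF GD(1)] \<eta>]) (rule that)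
  have "Minf nrm h E \<le> (\<integral>\<^sup>+p. h (ediam nrm (snd p)) \<partial>count_space J)"
  proof (rule Minf_le_family)
    fix p assume p: "p \<in> J"
    then have "ediam nrm (snd p) < ennreal \<epsilon>" using J(3)[OF p] GD(1) dm_pos[of "snd p"] by (simp add: ediam_eq_dm ennreal_less_iff)
    also have "\<dots> \<le> eps_h DIM('a) h" using h representsD(1)[OF rep] by (intro eps_h_ge) auto
    finally show "snd p = {} \<or> dyadic_cube (snd p) \<and> ediam nrm (snd p) < eps_h DIM('a) h" using J(3)[OF p] by blast
  qed (use J h in auto)
  then show "Minf nrm h E \<le> ennreal (2 * cube_const) * ennreal \<eta>" using J(4) by (rule order.trans)
qed (use cube_const_pos in simp)

lemma lebesgue_null:
  assumes null: "null_for (\<lambda>r. r ^ DIM('a)) E" and E: "E \<in> sets borel"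
  shows "emeasure lborel E = 0"
proof (rule ennreal_le_epsilon_mult[of uvol])
  fix \<eta> :: real assume "0 < \<eta>"
  obtain I :: "(nat \<times> 'a) set" and c r where I: "countable I" "E \<subseteq> (\<Union>i\<in>I. nball nrm (c i) (r i))"
     "\<forall>i\<in>I. 0 < r i \<and> r i \<le> 1" "(\<integral>\<^sup>+i. ennreal (r i ^ DIM('a)) \<partial>count_space I) \<le> ennreal \<eta>"
    using null[unfolded null_for_def, rule_format, OF zero_less_one \<open>0 < \<eta>\<close>] by (elim exE conjE) (rule that)
  obtain C :: "nat \<Rightarrow> 'a set" where C: "\<And>n. C n = {} \<or> (\<exists>i\<in>I. C n = nball nrm (c i) (r i))"
    "(\<Union>n. C n) = (\<Union>i\<in>I. nball nrm (c i) (r i))"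
    "\<And>f :: 'a set \<Rightarrow> ennreal. f {} = 0 \<Longrightarrow> (\<Sum>n. f (C n)) = (\<integral>\<^sup>+i. f (nball nrm (c i) (r i)) \<partial>count_space I)"
    using countable_family_sequence[OF I(1), of "\<lambda>i. nball nrm (c i) (r i)"] by blast
  have Cb: "C n \<in> sets borel" for n
  proof (cases "C n = {}")
    case False
    then obtain i where "C n = nball nrm (c i) (r i)" using C(1) by blast
    then show ?thesis by simp
  qed simp
  have "emeasure lborel E \<le> emeasure lborel (\<Union>n. C n)"
  proof (rule emeasure_mono)
    show "(\<Union>n. C n) \<in> sets lborel" using Cb by (intro sets.countable_UN) auto
  qed (use I(2) C(2) in simp)
  also have "\<dots> \<le> (\<Sum>n. emeasure lborel (C n))"
    using Cb by (intro emeasure_subadditive_countably) auto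
  also have "\<dots> = (\<integral>\<^sup>+i. emeasure lborel (nball nrm (c i) (r i)) \<partial>count_space I)"
    using C(3)[of "emeasure lborel"] by simp
  also have "\<dots> = (\<integral>\<^sup>+i. ennreal uvol * ennreal (r i ^ DIM('a)) \<partial>count_space I)"
  proof (rule nn_integral_cong)
    fix i assume "i \<in> space (count_space I)"
    then have "0 \<le> r i" using I(3) by auto
    then show "emeasure lborel (nball nrm (c i) (r i)) = ennreal uvol * ennreal (r i ^ DIM('a))"
      using emeasure_nball[of "r i" "c i"] uvol_pos by (simp add: ennreal_mult')
  qed
  also have "\<dots> = ennreal uvol * (\<integral>\<^sup>+i. ennreal (r i ^ DIM('a)) \<partial>count_space I)" by (rule nn_integral_cmult) simp
  also have "\<dots> \<le> ennreal uvol * ennreal \<eta>" using I(4) by (intro mult_left_mono) auto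
  finally show "emeasure lborel E \<le> ennreal uvol * ennreal \<eta>" .
qed (use uvol_pos in simp)

text \<open>A set of diameter zero has to be enclosed in a ball of positive, but arbitrarily cheap, radius.\<close>

lemma hausdorff_g_null_imp_null_for:
  assumes rep: "represents DIM('a) g \<epsilon> G" and null: "hausdorff_g nrm g E = 0"
  shows "null_for G E"
  unfolding null_for_def
proof (intro allI impI)
  fix \<delta> \<eta> :: real assume \<delta>: "0 < \<delta>" and \<eta>: "0 < \<eta>"
  define d where "d = DIM('a)"
  note GD = representsD[OF rep, folded d_def] dgauge_onD[OF representsD(1)[OF rep], folded d_def]
  \<comment> \<open>Diameters are doubled below, since an open ball needs a radius strictly above
    the diameter; the doubled value must stay within \<delta> and \<epsilon>.\<close>
  define \<delta>1 where "\<delta>1 = min \<delta> \<epsilon> / 2"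
  have \<delta>1: "0 < \<delta>1" using \<delta> GD(5) by (simp add: \<delta>1_def)
  \<comment> \<open>Doubling costs 2^d, and half of \<eta> is reserved for sets of diameter 0;
    \<gamma> distributes that half over n.\<close>
  define \<eta>1 where "\<eta>1 = \<eta> / 2 ^ (d + 1)"
  have \<eta>1: "0 < \<eta>1" using \<eta> by (simp add: \<eta>1_def)
  let ?S = "{C::nat \<Rightarrow> 'a set. E \<subseteq> (\<Union>n. C n) \<and> (\<forall>n. ediam nrm (C n) \<le> ennreal \<delta>1)}"
  have "(INF C\<in>?S. (\<Sum>n. g (ediam nrm (C n)))) \<le> hausdorff_g nrm g E"
    unfolding hausdorff_g_def using \<delta>1 by (intro SUP_upper) auto
  then have "(INF C\<in>?S. (\<Sum>n. g (ediam nrm (C n)))) < ennreal \<eta>1" using null \<eta>1 by simp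
  then obtain C where C: "C \<in> ?S" "(\<Sum>n. g (ediam nrm (C n))) < ennreal \<eta>1" unfolding INF_less_iff by blast
  define e where "e n = enn2real (ediam nrm (C n))" for n
  have ediam: "ediam nrm (C n) = ennreal (e n)" "e n \<le> \<delta>1" "0 \<le> e n" for n
  proof -
    have le: "ediam nrm (C n) \<le> ennreal \<delta>1" using C by simp
    then show 1: "ediam nrm (C n) = ennreal (e n)" using le_ennreal_less_top by (simp add: e_def)
    show "e n \<le> \<delta>1" "0 \<le> e n" using le \<delta>1 by (auto simp: e_def enn2real_leI)
  qed
  define \<gamma> where "\<gamma> n = \<eta> / 2 * (1/2) ^ Suc n" for n
  have \<gamma>: "0 < \<gamma> n" for n using \<eta> by (simp add: \<gamma>_def)
  have "\<exists>s. 0 < s \<and> s \<le> 2 * \<delta>1 \<and> e n < s \<and> ennreal (G s) \<le> ennreal (2 ^ d) * g (ediam nrm (C n)) + ennreal (\<gamma> n)" for n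
  proof (cases "e n = 0")
    case True
    obtain \<delta>' where \<delta>': "0 < \<delta>'" "\<And>r. 0 < r \<Longrightarrow> r \<le> \<delta>' \<Longrightarrow> r \<le> \<epsilon> \<Longrightarrow> G r \<le> \<gamma> n"
      using represents_lim[OF rep \<gamma>] by blast
    define s where "s = min \<delta>' (2 * \<delta>1)"
    have s: "0 < s" "s \<le> \<delta>'" "s \<le> 2 * \<delta>1" "s \<le> \<epsilon>" using \<delta>' \<delta>1 by (auto simp: s_def \<delta>1_def)
    then have "ennreal (G s) \<le> ennreal (\<gamma> n)" using \<delta>' by (intro ennreal_leI) auto
    also have "\<dots> \<le> ennreal (2 ^ d) * g (ediam nrm (C n)) + ennreal (\<gamma> n)" by simp
    finally show ?thesis using s True by auto
  next
    case False
    then have e: "0 < e n" using ediam(3)[of n] by simp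
    have le: "2 * e n \<le> \<epsilon>" "e n \<le> \<epsilon>" using ediam(2)[of n] e by (auto simp: \<delta>1_def)
    have "G (2 * e n) \<le> 2 ^ d * G (e n)"
      using representsD(1)[OF rep] e le by (intro dgauge_on_scale) (auto simp: d_def)
    then have "ennreal (G (2 * e n)) \<le> ennreal (2 ^ d * G (e n))" by (rule ennreal_leI)
    also have "\<dots> = ennreal (2 ^ d) * dnorm d g (ennreal (e n))"
      using GD(2)[OF e le(2)] by (simp add: ennreal_mult')
    also have "\<dots> \<le> ennreal (2 ^ d) * g (ediam nrm (C n))"
      unfolding ediam(1) by (intro mult_left_mono dnorm_le e) auto
    also have "\<dots> \<le> ennreal (2 ^ d) * g (ediam nrm (C n)) + ennreal (\<gamma> n)" by simp
    finally show ?thesis using e ediam(2)[of n] by (intro exI[of _ "2 * e n"]) auto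
  qed
  then obtain s where s: "\<And>n. 0 < s n \<and> s n \<le> 2 * \<delta>1 \<and> e n < s n \<and> ennreal (G (s n)) \<le> ennreal (2 ^ d) * g (ediam nrm (C n)) + ennreal (\<gamma> n)"
    by metis
  define x where "x n = (SOME y. y \<in> C n)" for n
  have cov: "C n \<subseteq> nball nrm (x n) (s n)" for n
  proof
    fix y assume y: "y \<in> C n"
    then have "x n \<in> C n" unfolding x_def by (rule someI)
    then have "ennreal (nrm (y - x n)) \<le> ennreal (e n)" using nrm_le_ediam[of y "C n" "x n"] y ediam(1)[of n] by simp
    then show "y \<in> nball nrm (x n) (s n)" using s[of n] ediam(3)[of n] by (simp add: mem_nball ennreal_le_iff)
  qed
  define I where "I = (\<lambda>n :: nat. (n, 0 :: 'a)) ` UNIV"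
  have "(\<integral>\<^sup>+i. ennreal (G (s (fst i))) \<partial>count_space I) = (\<integral>\<^sup>+n. ennreal (G (s n)) \<partial>count_space UNIV)"
    unfolding I_def by (subst nn_integral_count_space_inj) (auto simp: inj_on_def)
  also have "\<dots> = (\<Sum>n. ennreal (G (s n)))" by (rule nn_integral_count_space_nat)
  also have "\<dots> \<le> (\<Sum>n. ennreal (2 ^ d) * g (ediam nrm (C n)) + ennreal (\<gamma> n))" using s by (intro suminf_le) auto
  also have "\<dots> = ennreal (2 ^ d) * (\<Sum>n. g (ediam nrm (C n))) + (\<Sum>n. ennreal (\<gamma> n))" by (simp add: suminf_add[symmetric])
  also have "(\<Sum>n. ennreal (\<gamma> n)) = ennreal (\<eta> / 2)"
  proof (rule suminf_ennreal_eq)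
    show "\<gamma> sums (\<eta> / 2)" unfolding \<gamma>_def using sums_mult[OF power_half_series, of "\<eta> / 2"] by simp
  qed (use \<gamma> in \<open>simp add: less_imp_le\<close>)
  also have "ennreal (2 ^ d) * (\<Sum>n. g (ediam nrm (C n))) \<le> ennreal (2 ^ d) * ennreal \<eta>1"
    using C(2) by (intro mult_left_mono) auto
  also have "ennreal (2 ^ d) * ennreal \<eta>1 = ennreal (\<eta> / 2)"
    using \<eta>1 by (simp add: ennreal_mult'[symmetric]) (simp add: \<eta>1_def)
  also have "ennreal (\<eta> / 2) + ennreal (\<eta> / 2) = ennreal \<eta>" using \<eta> by (simp add: ennreal_plus[symmetric] del: ennreal_plus)
  finally have sum: "(\<integral>\<^sup>+i. ennreal (G (s (fst i))) \<partial>count_space I) \<le> ennreal \<eta>" by (simp add: add_right_mono)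
  have "countable I" by (simp add: I_def)
  moreover have "E \<subseteq> (\<Union>i\<in>I. nball nrm (x (fst i)) (s (fst i)))" using C(1) cov by (fastforce simp: I_def)
  moreover have "\<forall>i\<in>I. 0 < s (fst i) \<and> s (fst i) \<le> \<delta>" using s by (force simp: \<delta>1_def)
  ultimately show "\<exists>(I :: (nat \<times> 'a) set) c r. countable I \<and> E \<subseteq> (\<Union>i\<in>I. nball nrm (c i) (r i)) \<and>
     (\<forall>i\<in>I. 0 < r i \<and> r i \<le> \<delta>) \<and> (\<integral>\<^sup>+i. ennreal (G (r i)) \<partial>count_space I) \<le> ennreal \<eta>"
    using sum by (intro exI[of _ I] exI[of _ "\<lambda>i. x (fst i)"] exI[of _ "\<lambda>i. s (fst i)"]) auto
qed

end

section \<open>Natural covers of the limsup set\<close>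

locale optimal_regular_approximation = regular_approximation +
  assumes optimal: "optimal_system nrm A H U"
begin

lemma finite_level: "finite {a \<in> A. nrm a < R \<and> H a \<le> h}"
proof -
  obtain m :: nat where m: "max (max R h) 1 \<le> real m" using real_arch_simple by blast
  then have "finite {a\<in>A. nrm a < real m \<and> H a \<le> real m}" using admissible by (auto simp: admissible_def)
  then show ?thesis by (rule rev_finite_subset) (use m in auto)
qed

text \<open>In a fixed ball optimality allows at most a constant times M^((k+1)d) points with H
  between M^k and M^(k+1), so the balls of that level cost at most a constant times the k-th term of
  the convergent series, and tails are cheap. The constant depends on the ball, so U is exhausted by
  countably many balls with geometrically decreasing budgets.\<close>

lemma null_for_F:
  assumes van: "\<And>c. 0 < c \<Longrightarrow> \<exists>x0\<ge>0. \<phi> x0 \<le> c" and G: "dgauge_on DIM('a) \<epsilon> G" and M: "2 \<le> M"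
    and S: "summable (\<lambda>k. (M ^ k) ^ DIM('a) * G (min (\<phi> (M ^ k)) \<epsilon>))"
  shows "null_for G (F \<inter> U)"
  unfolding null_for_def
proof (intro allI impI)
  fix \<delta> \<eta> :: real assume \<delta>: "0 < \<delta>" and \<eta>: "0 < \<eta>"
  define d where "d = DIM('a)"
  note GD = dgauge_onD[OF G]
  define y where "y k = (M ^ k) ^ d * G (min (\<phi> (M ^ k)) \<epsilon>)" for k
  have Sy: "summable y" using S by (simp add: y_def[abs_def] d_def)
  have Mpos: "0 < M ^ k" for k using M by simp
  have rpos: "0 < min (\<phi> (M ^ k)) \<epsilon>" for k using \<phi>_pos[of "M ^ k"] Mpos[of k] GD(1) by simp
  have y0: "0 \<le> y k" for k using GD(2)[OF rpos, of k] Mpos[of k] by (simp add: y_def)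
  \<comment> \<open>A centre that approximates a point of norm below m can be as far as \<phi> 0
    from it.\<close>
  define Am where "Am m = A \<inter> U \<inter> nball nrm 0 (real m + \<phi> 0)" for m :: nat
  have fin: "finite {a \<in> Am m. H a \<le> h}" for m h
    by (rule finite_subset[OF _ finite_level[of "real m + \<phi> 0" h]]) (auto simp: Am_def mem_nball)
  have "\<exists>\<kappa>>0. \<exists>h'>0. \<forall>h>h'. real (card {a\<in>Am m. H a \<le> h}) \<le> \<kappa> * h ^ d" for m
  proof -
    have "0 < real m + \<phi> 0" using \<phi>_pos[of 0] by simp
    then have "is_open_ball nrm (nball nrm 0 (real m + \<phi> 0))" unfolding is_open_ball_def by blast
    then show ?thesis using optimal unfolding optimal_system_def Am_def d_def by blast
  qed
  then obtain \<kappa> h where \<kappa>: "\<And>m. 0 < \<kappa> m" "\<And>m t. h m < t \<Longrightarrow> real (card {a\<in>Am m. H a \<le> t}) \<le> \<kappa> m * t ^ d"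
    by metis
  define \<gamma> where "\<gamma> m = \<eta> * (1/2) ^ Suc m" for m
  have \<gamma>: "0 < \<gamma> m" for m using \<eta> by (simp add: \<gamma>_def)
  obtain x0 where x0: "0 \<le> x0" "\<phi> x0 \<le> min \<delta> \<epsilon>" using van[of "min \<delta> \<epsilon>"] \<delta> GD(1) by auto
  have "\<exists>k0. h m < M ^ k0 \<and> \<phi> (M ^ k0) \<le> min \<delta> \<epsilon> \<and> \<kappa> m * M ^ d * (\<Sum>k. y (k + k0)) \<le> \<gamma> m" for m
  proof -
    have "0 < \<gamma> m / (\<kappa> m * M ^ d)" using \<gamma> \<kappa>(1)[of m] M by simp
    from suminf_exist_split[OF this Sy] obtain N where N: "\<And>n. N \<le> n \<Longrightarrow> norm (\<Sum>k. y (k + n)) < \<gamma> m / (\<kappa> m * M ^ d)" by blast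
    obtain n where n: "max (h m) x0 < M ^ n" using real_arch_pow[of M "max (h m) x0"] M by auto
    define k0 where "k0 = max n N"
    have "M ^ n \<le> M ^ k0" using M by (intro power_increasing) (auto simp: k0_def)
    then have "h m < M ^ k0" "x0 \<le> M ^ k0" using n by auto
    moreover have "\<phi> (M ^ k0) \<le> \<phi> x0" using x0(1) \<open>x0 \<le> M ^ k0\<close> by (rule \<phi>_le)
    moreover have "(\<Sum>k. y (k + k0)) < \<gamma> m / (\<kappa> m * M ^ d)" using N[of k0] by (simp add: k0_def)
    then have "\<kappa> m * M ^ d * (\<Sum>k. y (k + k0)) \<le> \<gamma> m" using \<kappa>(1)[of m] M by (simp add: pos_less_divide_eq mult.commute)
    ultimately show ?thesis using x0(2) by (intro exI[of _ k0]) auto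
  qed
  then obtain k0 where k0: "\<And>m. h m < M ^ k0 m \<and> \<phi> (M ^ k0 m) \<le> min \<delta> \<epsilon> \<and> \<kappa> m * M ^ d * (\<Sum>k. y (k + k0 m)) \<le> \<gamma> m" by metis
  define B where "B m = {a \<in> Am m. M ^ k0 m \<le> H a}" for m
  have small: "0 < \<phi> (H a) \<and> \<phi> (H a) \<le> min \<delta> \<epsilon>" if "a \<in> B m" for a m
  proof -
    have "\<phi> (H a) \<le> \<phi> (M ^ k0 m)" using that Mpos[of "k0 m"] by (intro \<phi>_le) (auto simp: B_def less_imp_le)
    moreover have "0 < \<phi> (H a)" using that H_pos[of a] by (intro \<phi>_pos) (auto simp: B_def Am_def)
    ultimately show ?thesis using k0[of m] by auto
  qed
  have cost: "(\<integral>\<^sup>+a. ennreal (G (\<phi> (H a))) \<partial>count_space (B m)) \<le> ennreal (\<gamma> m)" for m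
  proof -
    define X where "X k = {a \<in> Am m. M ^ (k0 m + k) \<le> H a \<and> H a < M ^ (k0 m + Suc k)}" for k
    have "B m = (\<Union>k. X k)"
    proof (intro set_eqI iffI)
      fix a assume a: "a \<in> B m"
      then have "M ^ k0 m \<le> H a" by (simp add: B_def)
      from power_interval_exists[OF _ this] obtain i where "M ^ (k0 m + i) \<le> H a" "H a < M ^ (k0 m + Suc i)" using M by auto
      then have "a \<in> X i" using a by (simp add: X_def B_def)
      then show "a \<in> (\<Union>k. X k)" by blast
    next
      fix a assume "a \<in> (\<Union>k. X k)"
      then obtain k where k: "a \<in> X k" by blast
      have "M ^ k0 m \<le> M ^ (k0 m + k)" using M by (intro power_increasing) auto
      then show "a \<in> B m" using k by (simp add: X_def B_def)
    qed
    moreover have "disjoint_family X"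
      unfolding disjoint_family_on_def
    proof (intro ballI impI)
      fix i k :: nat assume "i \<noteq> k"
      then show "X i \<inter> X k = {}" using power_interval_unique[of M "k0 m" i _ k] M unfolding X_def by auto
    qed
    ultimately have "(\<integral>\<^sup>+a. ennreal (G (\<phi> (H a))) \<partial>count_space (B m)) = (\<integral>\<^sup>+k. (\<integral>\<^sup>+a. ennreal (G (\<phi> (H a))) \<partial>count_space (X k)) \<partial>count_space UNIV)"
      by (simp add: nn_integral_count_space_UN)
    also have "\<dots> = (\<Sum>k. \<integral>\<^sup>+a. ennreal (G (\<phi> (H a))) \<partial>count_space (X k))" by (rule nn_integral_count_space_nat)
    also have "\<dots> \<le> (\<Sum>k. ennreal (\<kappa> m * M ^ d * y (k + k0 m)))"
    proof (intro suminf_le)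
      fix k
      define K where "K = k0 m + k"
      have finX: "finite (X k)" by (rule finite_subset[OF _ fin[of m "M ^ Suc K"]]) (auto simp: X_def K_def)
      have KM: "M ^ k0 m \<le> M ^ K" "M ^ K \<le> M ^ Suc K" using M by (auto simp: K_def intro!: power_increasing)
      have cX: "real (card (X k)) \<le> \<kappa> m * (M ^ Suc K) ^ d"
      proof -
        have "card (X k) \<le> card {a \<in> Am m. H a \<le> M ^ Suc K}" by (intro card_mono fin) (auto simp: X_def K_def)
        moreover have "real (card {a \<in> Am m. H a \<le> M ^ Suc K}) \<le> \<kappa> m * (M ^ Suc K) ^ d"
          using k0[of m] KM by (intro \<kappa>(2)) linarith
        ultimately show ?thesis by linarith
      qed
      have \<phi>K: "\<phi> (M ^ K) \<le> \<epsilon>" using \<phi>_le[of "M ^ k0 m" "M ^ K"] KM Mpos[of "k0 m"] k0[of m] by auto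
      have "ennreal (G (\<phi> (H a))) \<le> ennreal (G (min (\<phi> (M ^ K)) \<epsilon>))" if a: "a \<in> X k" for a
      proof (rule ennreal_leI)
        have "M ^ K \<le> H a" using a by (simp add: X_def K_def)
        then have 1: "\<phi> (H a) \<le> \<phi> (M ^ K)" using Mpos[of K] by (intro \<phi>_le) auto
        have "0 < \<phi> (H a)" using a H_pos[of a] by (intro \<phi>_pos) (auto simp: X_def Am_def)
        then show "G (\<phi> (H a)) \<le> G (min (\<phi> (M ^ K)) \<epsilon>)" using 1 \<phi>K by (intro GD(3)) auto
      qed
      then have "(\<Sum>a\<in>X k. ennreal (G (\<phi> (H a)))) \<le> of_nat (card (X k)) * ennreal (G (min (\<phi> (M ^ K)) \<epsilon>))"
        by (rule sum_bounded_above)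
      also have "\<dots> = ennreal (real (card (X k)) * G (min (\<phi> (M ^ K)) \<epsilon>))"
        by (simp add: ennreal_mult' ennreal_of_nat_eq_real_of_nat)
      also have "\<dots> \<le> ennreal (\<kappa> m * (M ^ Suc K) ^ d * G (min (\<phi> (M ^ K)) \<epsilon>))"
        using cX GD(2)[OF rpos, of K] by (intro ennreal_leI mult_right_mono) auto
      also have "\<kappa> m * (M ^ Suc K) ^ d * G (min (\<phi> (M ^ K)) \<epsilon>) = \<kappa> m * M ^ d * y (k + k0 m)"
        by (simp add: y_def K_def power_mult_distrib add.commute)
      finally show "(\<integral>\<^sup>+a. ennreal (G (\<phi> (H a))) \<partial>count_space (X k)) \<le> ennreal (\<kappa> m * M ^ d * y (k + k0 m))"
        using finX by (simp add: nn_integral_count_space_finite)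
    qed auto
    also have "\<dots> = ennreal (\<Sum>k. \<kappa> m * M ^ d * y (k + k0 m))"
      using \<kappa>(1)[of m] M y0 Sy by (intro suminf_ennreal2 summable_mult) (auto simp: less_imp_le summable_iff_shift)
    also have "(\<Sum>k. \<kappa> m * M ^ d * y (k + k0 m)) = \<kappa> m * M ^ d * (\<Sum>k. y (k + k0 m))"
      using Sy by (intro suminf_mult) (simp add: summable_iff_shift)
    also have "ennreal \<dots> \<le> ennreal (\<gamma> m)" using k0[of m] by (intro ennreal_leI) simp
    finally show ?thesis .
  qed
  define I where "I = Sigma UNIV B"
  have cB: "countable (B m)" for m by (rule countable_subset[OF _ countable_A]) (auto simp: B_def Am_def)
  have "countable I" unfolding I_def using cB by (intro countable_SIGMA) auto
  moreover have "F \<inter> U \<subseteq> (\<Union>i\<in>I. nball nrm (snd i) (\<phi> (H (snd i))))"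
  proof
    fix x assume x: "x \<in> F \<inter> U"
    \<comment> \<open>Optimality counts only centres in U. As x has room e in U, discarding finitely
      many approximants leaves one of radius at most e, whose centre is then in U.\<close>
    obtain e where e: "0 < e" "nball nrm x e \<subseteq> U" using openE_nball[OF open_U] x by blast
    obtain x1 where x1: "0 \<le> x1" "\<phi> x1 \<le> e" using van[OF e(1)] by blast
    obtain m where m: "nrm x < real m" using reals_Archimedean2 by blast
    have "finite {a \<in> A. nrm a < real m + \<phi> 0 \<and> H a \<le> max x1 (M ^ k0 m)}" by (rule finite_level)
    moreover have "infinite {a\<in>A. nrm (x - a) < \<phi> (H a)}" using x by (simp add: F_def)
    ultimately have "infinite ({a\<in>A. nrm (x - a) < \<phi> (H a)} - {a \<in> A. nrm a < real m + \<phi> 0 \<and> H a \<le> max x1 (M ^ k0 m)})"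
      by (rule Diff_infinite_finite)
    then obtain a where a: "a \<in> A" "nrm (x - a) < \<phi> (H a)" "\<not> (nrm a < real m + \<phi> 0 \<and> H a \<le> max x1 (M ^ k0 m))"
      using infinite_imp_nonempty by blast
    have "\<phi> (H a) \<le> \<phi> 0" using H_pos[OF a(1)] by (intro \<phi>_le) auto
    moreover have "nrm a \<le> nrm (a - x) + nrm x" using nrm_diff_triangle[of a 0 x] by simp
    ultimately have na: "nrm a < real m + \<phi> 0" using a(2) m nrm_minus_commute[of a x] by linarith
    then have Ha: "x1 \<le> H a" "M ^ k0 m \<le> H a" using a(3) by auto
    have "\<phi> (H a) \<le> e" using \<phi>_le[OF x1(1) Ha(1)] x1(2) by linarith
    then have "a \<in> U" using e(2) a(2) nrm_minus_commute[of a x] by (auto simp: mem_nball)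
    then have "(m, a) \<in> I" using a(1) na Ha by (simp add: I_def B_def Am_def mem_nball)
    then show "x \<in> (\<Union>i\<in>I. nball nrm (snd i) (\<phi> (H (snd i))))" using a(2) by (intro UN_I[of "(m, a)"]) (auto simp: mem_nball)
  qed
  moreover have "\<forall>i\<in>I. 0 < \<phi> (H (snd i)) \<and> \<phi> (H (snd i)) \<le> \<delta>" using small by (force simp: I_def)
  moreover have "(\<integral>\<^sup>+i. ennreal (G (\<phi> (H (snd i)))) \<partial>count_space I) \<le> ennreal \<eta>"
  proof -
    have "I = (\<Union>m\<in>UNIV. Pair m ` B m)" by (auto simp: I_def)
    then have "(\<integral>\<^sup>+i. ennreal (G (\<phi> (H (snd i)))) \<partial>count_space I) = (\<integral>\<^sup>+m. (\<integral>\<^sup>+i. ennreal (G (\<phi> (H (snd i)))) \<partial>count_space (Pair m ` B m)) \<partial>count_space UNIV)"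
      using nn_integral_count_space_UN[of "UNIV :: nat set" "\<lambda>m. Pair m ` B m" "\<lambda>i. ennreal (G (\<phi> (H (snd i))))"]
      by (simp add: disjoint_family_on_def image_Int[symmetric] disjoint_iff) blast
    also have "\<dots> = (\<Sum>m. \<integral>\<^sup>+a. ennreal (G (\<phi> (H a))) \<partial>count_space (B m))"
      by (subst nn_integral_count_space_nat) (simp add: nn_integral_count_space_inj inj_on_def)
    also have "\<dots> \<le> (\<Sum>m. ennreal (\<gamma> m))" by (intro suminf_le cost) auto
    also have "\<dots> = ennreal \<eta>"
    proof (rule suminf_ennreal_eq)
      show "\<gamma> sums \<eta>" unfolding \<gamma>_def using sums_mult[OF power_half_series, of \<eta>] by simp
    qed (use \<gamma> in \<open>simp add: less_imp_le\<close>)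
    finally show ?thesis .
  qed
  ultimately show "\<exists>(I :: (nat \<times> 'a) set) c r. countable I \<and> F \<inter> U \<subseteq> (\<Union>i\<in>I. nball nrm (c i) (r i)) \<and>
     (\<forall>i\<in>I. 0 < r i \<and> r i \<le> \<delta>) \<and> (\<integral>\<^sup>+i. ennreal (G (r i)) \<partial>count_space I) \<le> ennreal \<eta>"
    by (intro exI[of _ I] exI[of _ snd] exI[of _ "\<lambda>i. \<phi> (H (snd i))"]) auto
qed

end

section \<open>Boosted gauges and full measure\<close>

text \<open>Dual of the damping lemma: \<open>\<theta>(v) = \<Sum>j. min v (t j)\<close> dominates every multiple of \<open>v\<close> near \<open>0\<close>,
  and the levels \<open>t j\<close> are so small that convergence is preserved.\<close>

lemma convergent_boost:
  fixes m r :: "nat \<Rightarrow> real"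
  assumes g: "dgauge_on d \<epsilon> g" and m: "\<And>k. 0 \<le> m k" and r: "\<And>k. 0 < r k" "\<And>k. r k \<le> \<epsilon>"
    and conv: "summable (\<lambda>k. m k * g (r k))"
    and lim: "\<And>c. 0 < c \<Longrightarrow> \<exists>\<delta>>0. \<forall>x. 0 < x \<longrightarrow> x \<le> \<delta> \<longrightarrow> x \<le> \<epsilon> \<longrightarrow> g x \<le> c"
  obtains g' where "dgauge_on d \<epsilon> g'" "summable (\<lambda>k. m k * g' (r k))"
    "\<And>x y. 0 < x \<Longrightarrow> x \<le> y \<Longrightarrow> y \<le> \<epsilon> \<Longrightarrow> g' y / g y \<le> g' x / g x"
    "\<And>B. \<exists>\<delta>>0. \<forall>x. 0 < x \<longrightarrow> x \<le> \<delta> \<longrightarrow> x \<le> \<epsilon> \<longrightarrow> B \<le> g' x / g x"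
    "\<And>c. 0 < c \<Longrightarrow> \<exists>\<delta>>0. \<forall>x. 0 < x \<longrightarrow> x \<le> \<delta> \<longrightarrow> x \<le> \<epsilon> \<longrightarrow> g' x \<le> c"
proof -
  note gD = dgauge_onD[OF g]
  have gr: "0 < g (r k)" for k using gD(2) r by blast
  \<comment> \<open>Finitely many initial terms are small because t is small, the remaining ones
    because the series converges.\<close>
  have "\<exists>t. 0 < t \<and> t \<le> (1/2) ^ j \<and> (\<forall>n. (\<Sum>k<n. m k * min (g (r k)) t) \<le> (1/2) ^ j)" for j
  proof -
    let ?\<delta> = "(1/2::real) ^ j / 2"
    have "0 < ?\<delta>" by simp
    from suminf_exist_split[OF this conv] obtain K where K: "\<And>n. K \<le> n \<Longrightarrow> norm (\<Sum>k. m (k + n) * g (r (k + n))) < ?\<delta>" by blast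
    define S where "S = (\<Sum>k<K. m k)"
    have S: "0 \<le> S" using m by (simp add: S_def sum_nonneg)
    define t where "t = min ((1/2) ^ j) (?\<delta> / (1 + S))"
    have t: "0 < t" "t \<le> (1/2) ^ j" "S * t \<le> ?\<delta>"
    proof -
      show "0 < t" "t \<le> (1/2) ^ j" using S by (auto simp: t_def)
      have "S * t \<le> S * (?\<delta> / (1 + S))" using S by (intro mult_left_mono) (auto simp: t_def)
      also have "\<dots> = ?\<delta> * (S / (1 + S))" by simp
      also have "\<dots> \<le> ?\<delta> * 1" using S by (intro mult_left_mono) auto
      finally show "S * t \<le> ?\<delta>" by simp
    qed
    have "(\<Sum>k<n. m k * min (g (r k)) t) \<le> (1/2) ^ j" for n
    proof -
      have nn: "0 \<le> m k * min (g (r k)) t" for k using m[of k] gr[of k] t(1) by simp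
      have "(\<Sum>k<n. m k * min (g (r k)) t) \<le> (\<Sum>k<K + n. m k * min (g (r k)) t)"
        using nn by (intro sum_mono2) auto
      also have "\<dots> = (\<Sum>k<K. m k * min (g (r k)) t) + (\<Sum>k<n. m (k + K) * min (g (r (k + K))) t)"
      proof -
        have "{..<K + n} = {..<K} \<union> {K..<K + n}" by auto
        then have "(\<Sum>k<K + n. m k * min (g (r k)) t) = (\<Sum>k<K. m k * min (g (r k)) t) + (\<Sum>k\<in>{K..<K+n}. m k * min (g (r k)) t)"
          by (simp add: sum.union_disjoint ivl_disj_int)
        also have "(\<Sum>k\<in>{K..<K+n}. m k * min (g (r k)) t) = (\<Sum>k<n. m (k + K) * min (g (r (k + K))) t)"
          using sum.shift_bounds_nat_ivl[of "\<lambda>k. m k * min (g (r k)) t" 0 K n] by (simp add: lessThan_atLeast0 add.commute)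
        finally show ?thesis .
      qed
      also have "(\<Sum>k<K. m k * min (g (r k)) t) \<le> (\<Sum>k<K. m k * t)"
        using m by (intro sum_mono mult_left_mono) auto
      also have "(\<Sum>k<K. m k * t) = S * t" by (simp add: S_def sum_distrib_right)
      also have "\<dots> \<le> ?\<delta>" by (rule t)
      also have "(\<Sum>k<n. m (k + K) * min (g (r (k + K))) t) \<le> (\<Sum>k<n. m (k + K) * g (r (k + K)))"
        using m by (intro sum_mono mult_left_mono) auto
      also have "\<dots> \<le> (\<Sum>k. m (k + K) * g (r (k + K)))"
        using m gr less_imp_le[OF gr] by (intro sum_le_suminf summable_ignore_initial_segment[OF conv]) auto
      also have "\<dots> \<le> ?\<delta>" using K[of K] by simp
      finally show ?thesis by simp
    qed
    then show ?thesis using t by blast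
  qed
  then obtain t where t: "\<And>j. 0 < t j" "\<And>j. t j \<le> (1/2) ^ j" "\<And>j n. (\<Sum>k<n. m k * min (g (r k)) (t j)) \<le> (1/2) ^ j"
    by metis
  define \<theta> where "\<theta> v = (\<Sum>j. min v (t j))" for v
  have geo: "summable (\<lambda>j. (1/2::real) ^ j)" by (intro summable_geometric) simp
  have sm: "summable (\<lambda>j. min v (t j))" if "0 \<le> v" for v
    by (rule summable_comparison_test'[OF geo, of 0]) (use that t(1,2) less_imp_le[OF t(1)] in \<open>auto simp: min.coboundedI2\<close>)
  have part: "(\<Sum>j<J. min v (t j)) \<le> \<theta> v" if "0 \<le> v" for v J
    unfolding \<theta>_def using that less_imp_le[OF t(1)] by (intro sum_le_suminf sm) auto
  have \<theta>_pos: "0 < \<theta> v" if "0 < v" for v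
    using part[of v 1] that t(1)[of 0] by simp
  have \<theta>_mono: "\<theta> v \<le> \<theta> v'" if "0 \<le> v" "v \<le> v'" for v v'
    unfolding \<theta>_def using that by (intro suminf_le sm) auto
  have \<theta>_sub: "\<theta> v' * v \<le> \<theta> v * v'" if "0 < v" "v \<le> v'" for v v'
  proof -
    have "\<theta> v' * v = (\<Sum>j. min v' (t j) * v)"
      unfolding \<theta>_def using that by (intro suminf_mult2 sm) auto
    also have "\<dots> \<le> (\<Sum>j. min v (t j) * v')"
      using that less_imp_le[OF t(1)] by (intro suminf_le min_div_antimono summable_mult2 sm) auto
    also have "\<dots> = \<theta> v * v'"
      unfolding \<theta>_def using that by (intro suminf_mult2[symmetric] sm) auto
    finally show ?thesis .
  qed
  have \<theta>_lim: "\<exists>v0>0. \<forall>v. 0 < v \<longrightarrow> v \<le> v0 \<longrightarrow> \<theta> v \<le> c" if c: "0 < c" for c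
  proof -
    obtain J where J: "(1/2::real) ^ J < c / 4" using real_arch_pow_inv[of "c / 4" "1/2"] c by auto
    have "\<theta> v \<le> c" if v: "0 < v" "v \<le> c / (2 * (real J + 1))" for v
    proof -
      have "\<theta> v = (\<Sum>j<J. min v (t j)) + (\<Sum>j. min v (t (j + J)))"
        unfolding \<theta>_def using suminf_split_initial_segment[OF sm, of v J] v by simp
      also have "(\<Sum>j<J. min v (t j)) \<le> (\<Sum>j<J. v)" by (intro sum_mono) auto
      also have "(\<Sum>j<J. v) = real J * v" by simp
      also have "real J * v \<le> real J * (c / (2 * (real J + 1)))" using v by (intro mult_left_mono) auto
      also have "\<dots> \<le> c / 2" using c by (simp add: field_simps)
      also have "(\<Sum>j. min v (t (j + J))) \<le> (\<Sum>j. (1/2) ^ j * (1/2) ^ J)"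
      proof (intro suminf_le)
        show "min v (t (j + J)) \<le> (1/2) ^ j * (1/2) ^ J" for j using t(2)[of "j + J"] by (simp add: power_add)
        show "summable (\<lambda>j. min v (t (j + J)))" using summable_ignore_initial_segment[OF sm, of v J] v by simp
      qed (intro summable_mult2 geo)
      also have "\<dots> = (\<Sum>j. (1/2::real) ^ j) * (1/2) ^ J" by (intro suminf_mult2[symmetric] geo)
      also have "(\<Sum>j. (1/2::real) ^ j) = 2" by (subst suminf_geometric) auto
      finally show ?thesis using J by simp
    qed
    then show ?thesis using c by (intro exI[of _ "c / (2 * (real J + 1))"]) auto
  qed
  \<comment> \<open>Below the first J levels each of the first J terms of \<theta>(v) equals
    v.\<close>
  have \<theta>_big: "\<exists>v0>0. \<forall>v. 0 < v \<longrightarrow> v \<le> v0 \<longrightarrow> real J * v \<le> \<theta> v" for J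
  proof -
    define v0 where "v0 = Min (insert 1 (t ` {..<J}))"
    have v0: "0 < v0" "\<And>j. j < J \<Longrightarrow> v0 \<le> t j" using t(1) by (auto simp: v0_def)
    have "real J * v \<le> \<theta> v" if v: "0 < v" "v \<le> v0" for v
    proof -
      have "real J * v = (\<Sum>j<J. min v (t j))" using v v0(2) by (simp add: min_absorb1 order.trans)
      also have "\<dots> \<le> \<theta> v" using v by (intro part) auto
      finally show ?thesis .
    qed
    then show ?thesis using v0(1) by blast
  qed
  have small_g: "\<exists>\<delta>>0. \<forall>x. 0 < x \<longrightarrow> x \<le> \<delta> \<longrightarrow> x \<le> \<epsilon> \<longrightarrow> P (g x)" if P: "\<exists>v0>0. \<forall>v. 0 < v \<longrightarrow> v \<le> v0 \<longrightarrow> P v" for P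
  proof -
    obtain v0 where v0: "0 < v0" "\<And>v. 0 < v \<Longrightarrow> v \<le> v0 \<Longrightarrow> P v" using P by blast
    obtain \<delta> where "0 < \<delta>" "\<And>x. 0 < x \<Longrightarrow> x \<le> \<delta> \<Longrightarrow> x \<le> \<epsilon> \<Longrightarrow> g x \<le> v0" using lim[OF v0(1)] by blast
    then show ?thesis using v0(2) gD(2) by blast
  qed
  show ?thesis
  proof (rule that[of "\<lambda>x. \<theta> (g x)"])
    show ratio: "\<theta> (g y) / g y \<le> \<theta> (g x) / g x" if "0 < x" "x \<le> y" "y \<le> \<epsilon>" for x y
      using \<theta>_sub[of "g x" "g y"] gD(2)[of x] gD(2)[of y] gD(3)[OF that] that by (simp add: divide_simps mult_ac)
    show "dgauge_on d \<epsilon> (\<lambda>x. \<theta> (g x))"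
      unfolding dgauge_on_def
    proof (intro conjI allI impI)
      show "0 < \<epsilon>" by (rule gD)
      show "0 < \<theta> (g x)" if "0 < x" "x \<le> \<epsilon>" for x using that gD(2) \<theta>_pos by blast
      fix x y assume xy: "0 < x" "x \<le> y" "y \<le> \<epsilon>"
      have gp: "0 < g x" "0 < g y" using gD(2) xy by auto
      show "\<theta> (g x) \<le> \<theta> (g y)" using gp gD(3)[OF xy] by (intro \<theta>_mono) auto
      have "(\<theta> (g y) / g y) * (g y / y ^ d) \<le> (\<theta> (g x) / g x) * (g x / x ^ d)"
        using ratio[OF xy] gD(4)[OF xy] gp xy \<theta>_pos[OF gp(1)] \<theta>_pos[OF gp(2)] by (intro mult_mono) auto
      then show "\<theta> (g y) / y ^ d \<le> \<theta> (g x) / x ^ d" using gp by simp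
    qed
    show "summable (\<lambda>k. m k * \<theta> (g (r k)))"
    proof (rule summableI_nonneg_bounded)
      show "0 \<le> m k * \<theta> (g (r k))" for k using m[of k] \<theta>_pos[OF gr[of k]] by simp
      fix n
      have smk: "summable (\<lambda>j. m k * min (g (r k)) (t j))" for k
        using less_imp_le[OF gr] by (intro summable_mult sm)
      have "(\<Sum>k<n. m k * \<theta> (g (r k))) = (\<Sum>k<n. \<Sum>j. m k * min (g (r k)) (t j))"
        unfolding \<theta>_def using less_imp_le[OF gr] by (intro sum.cong suminf_mult[symmetric] sm) auto
      also have "\<dots> = (\<Sum>j. \<Sum>k<n. m k * min (g (r k)) (t j))"
        by (rule suminf_sum[symmetric]) (rule smk)
      also have "\<dots> \<le> (\<Sum>j. (1/2) ^ j)"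
        by (intro suminf_le t(3) geo summable_sum smk)
      also have "\<dots> = 2" by (subst suminf_geometric) auto
      finally show "(\<Sum>k<n. m k * \<theta> (g (r k))) \<le> 2" .
    qed
    show "\<exists>\<delta>>0. \<forall>x. 0 < x \<longrightarrow> x \<le> \<delta> \<longrightarrow> x \<le> \<epsilon> \<longrightarrow> B \<le> \<theta> (g x) / g x" for B
    proof (rule small_g)
      obtain J where J: "B \<le> real J" using real_arch_simple by blast
      obtain v0 where v0: "0 < v0" "\<And>v. 0 < v \<Longrightarrow> v \<le> v0 \<Longrightarrow> real J * v \<le> \<theta> v" using \<theta>_big[of J] by blast
      have "B \<le> \<theta> v / v" if v: "0 < v" "v \<le> v0" for v
      proof -
        have "B * v \<le> real J * v" using J v by (intro mult_right_mono) auto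
        then have "B * v \<le> \<theta> v" using v0(2)[OF v] by linarith
        then show ?thesis using v by (simp add: pos_le_divide_eq)
      qed
      then show "\<exists>v0>0. \<forall>v. 0 < v \<longrightarrow> v \<le> v0 \<longrightarrow> B \<le> \<theta> v / v" using v0(1) by blast
    qed
    show "\<exists>\<delta>>0. \<forall>x. 0 < x \<longrightarrow> x \<le> \<delta> \<longrightarrow> x \<le> \<epsilon> \<longrightarrow> \<theta> (g x) \<le> c" if "0 < c" for c
      by (rule small_g[OF \<theta>_lim[OF that]])
  qed
qed

lemma ell_eq_topI:
  assumes "\<And>B. 0 < B \<Longrightarrow> \<exists>\<delta>>0. \<forall>r. 0 < r \<longrightarrow> r \<le> \<delta> \<longrightarrow> ennreal (B * r ^ d) \<le> g (ennreal r)"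
  shows "ell d g = top"
proof (rule ccontr)
  assume "ell d g \<noteq> top"
  then obtain x where x: "0 \<le> x" "ell d g = ennreal x" by (cases "ell d g") auto
  obtain \<delta> where \<delta>: "0 < \<delta>" "\<And>r. 0 < r \<Longrightarrow> r \<le> \<delta> \<Longrightarrow> ennreal ((x + 1) * r ^ d) \<le> g (ennreal r)"
    using assms[of "x + 1"] x by auto
  have "\<forall>\<^sub>F r in at_right 0. ennreal (x + 1) \<le> g (ennreal r) / ennreal r ^ d"
    unfolding eventually_at_right_field
  proof (intro exI[of _ \<delta>] conjI allI impI)
    fix r assume r: "0 < r" "r < \<delta>"
    have "ennreal (x + 1) = ennreal ((x + 1) * r ^ d) / ennreal (r ^ d)"
      using r x by (subst divide_ennreal) auto
    also have "\<dots> \<le> g (ennreal r) / ennreal (r ^ d)" using \<delta>(2)[of r] r by (intro divide_right_mono_ennreal) auto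
    finally show "ennreal (x + 1) \<le> g (ennreal r) / ennreal r ^ d" using r by (simp add: ennreal_power)
  qed (rule \<delta>)
  then have "ennreal (x + 1) \<le> ell d g" unfolding ell_def by (rule Liminf_bounded)
  then show False using x by (simp add: ennreal_le_iff)
qed

section \<open>Vanishing radii, the limsup set as a G-delta, and full measure\<close>

context regular_approximation begin

definition vanishing :: bool where "vanishing \<longleftrightarrow> (\<forall>c>0. \<exists>x\<ge>0. \<phi> x \<le> c)"

lemma vanishing_power:
  assumes "vanishing" "2 \<le> M" "0 < c"
  obtains k0 where "\<And>k. k0 \<le> k \<Longrightarrow> \<phi> (M ^ k) \<le> c"
proof -
  obtain x where x: "0 \<le> x" "\<phi> x \<le> c" using assms unfolding vanishing_def by blast
  obtain k0 where k0: "x < M ^ k0" using real_arch_pow[of M x] assms by auto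
  have "\<phi> (M ^ k) \<le> c" if "k0 \<le> k" for k
  proof -
    have "M ^ k0 \<le> M ^ k" using assms that by (intro power_increasing) auto
    then have "\<phi> (M ^ k) \<le> \<phi> x" using x k0 by (intro \<phi>_le) auto
    then show ?thesis using x by simp
  qed
  then show ?thesis by (rule that)
qed

text \<open>Since \<phi> tends to 0, changing the truncation level affects only finitely many
  terms.\<close>

lemma divergent_radius:
  assumes "vanishing" "2 \<le> M" "0 < \<epsilon>" "0 < \<delta>"
  shows "divergent M \<epsilon> G \<longleftrightarrow> divergent M \<delta> G"
proof -
  obtain k0 where "\<And>k. k0 \<le> k \<Longrightarrow> \<phi> (M ^ k) \<le> min \<epsilon> \<delta>"
    using vanishing_power[OF assms(1,2), of "min \<epsilon> \<delta>"] assms by auto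
  then have "\<forall>\<^sub>F k in sequentially. (M ^ k) ^ DIM('a) * G (min (\<phi> (M ^ k)) \<epsilon>) = (M ^ k) ^ DIM('a) * G (min (\<phi> (M ^ k)) \<delta>)"
    unfolding eventually_sequentially by (intro exI[of _ k0]) (simp add: min_absorb1)
  then show ?thesis unfolding divergent_def by (simp add: summable_cong)
qed

lemma divergent_mono:
  assumes "divergent M \<epsilon> G" "dgauge_on d \<epsilon> G" "2 \<le> M" "\<And>r. 0 < r \<Longrightarrow> r \<le> \<epsilon> \<Longrightarrow> G r \<le> G' r"
  shows "divergent M \<epsilon> G'"
  unfolding divergent_def
proof
  assume s: "summable (\<lambda>k. (M ^ k) ^ DIM('a) * G' (min (\<phi> (M ^ k)) \<epsilon>))"
  have "summable (\<lambda>k. (M ^ k) ^ DIM('a) * G (min (\<phi> (M ^ k)) \<epsilon>))"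
  proof (rule summable_comparison_test'[OF s, of 0])
    fix k
    have p: "0 < min (\<phi> (M ^ k)) \<epsilon>" "min (\<phi> (M ^ k)) \<epsilon> \<le> \<epsilon>" using \<phi>_pos[of "M ^ k"] dgauge_onD(1)[OF assms(2)] assms(3) by auto
    have "0 < G (min (\<phi> (M ^ k)) \<epsilon>)" using dgauge_onD(2)[OF assms(2) p] .
    then show "norm ((M ^ k) ^ DIM('a) * G (min (\<phi> (M ^ k)) \<epsilon>)) \<le> (M ^ k) ^ DIM('a) * G' (min (\<phi> (M ^ k)) \<epsilon>)"
      using assms(3) assms(4)[OF p] by (simp add: abs_mult)
  qed
  then show False using assms(1) by (simp add: divergent_def)
qed

definition tail :: "nat \<Rightarrow> 'a set" where "tail m = (\<Union>a\<in>A - initial m. nball nrm a (\<phi> (H a)))"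

lemma open_tail: "open (tail m)" by (auto simp: tail_def)

lemma F_eq_Inter: "F = (\<Inter>m. tail m)"
  by (auto simp: mem_F_iff tail_def mem_nball)

lemma gdelta_F: "gdelta_in euclidean F"
  unfolding F_eq_Inter by (intro gdelta_in_Inter) (auto intro: open_imp_gdelta_in simp: open_tail)

lemma F_borel: "F \<in> sets borel"
  unfolding F_eq_Inter using open_tail by (intro sets.countable_INT'') auto

text \<open>No Lebesgue density argument is needed: an open \<open>W\<close> slightly larger than a set missed by
  \<open>tail m\<close> still meets \<open>tail m\<close> in at least the proportion \<open>c\<close> of its measure.\<close>

lemma full_measure:
  assumes div: "\<And>M. 2 \<le> M \<Longrightarrow> divergent M 1 (\<lambda>r. r ^ DIM('a))"
  shows "emeasure lborel (U - F) = 0"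
proof -
  define d where "d = DIM('a)"
  obtain M where M: "2 \<le> M" and hs: "\<And>g \<epsilon>. dgauge_on DIM('a) \<epsilon> g \<Longrightarrow> divergent M \<epsilon> g \<Longrightarrow>
     \<exists>c>0. \<forall>Q N. dyadic_cube Q \<longrightarrow> Q \<subseteq> U \<longrightarrow> dm Q \<le> \<epsilon> \<longrightarrow> finite N \<longrightarrow> (\<exists>K. subcubes N Q K \<and> heavy g c Q K)"
    by (rule heavy_subcubes) blast
  have "dgauge_on DIM('a) 1 (\<lambda>r. r ^ DIM('a))" by (auto simp: dgauge_on_def power_mono)
  from hs[OF this div[OF M]] obtain c where c: "0 < c" and K: "\<And>Q N. dyadic_cube Q \<Longrightarrow> Q \<subseteq> U \<Longrightarrow> dm Q \<le> 1 \<Longrightarrow> finite N \<Longrightarrow>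
      \<exists>K. subcubes N Q K \<and> heavy (\<lambda>r. r ^ d) c Q K" unfolding d_def by blast
  have cube: "ennreal c * emeasure lborel Q \<le> emeasure lborel (tail m \<inter> Q)"
    if Q: "dyadic_cube Q" "Q \<subseteq> U" "dm Q \<le> 1" for Q m
  proof -
    obtain K where K: "subcubes (initial m) Q K" "heavy (\<lambda>r. r ^ d) c Q K" using K[OF Q finite_initial] by blast
    have Kq: "dyadic_cube k" "k \<subseteq> Q" "k \<subseteq> tail m" if "k \<in> K" for k
      using K(1) that closure_subset[of k] unfolding subcubes_def tail_def by blast+
    have fin: "finite K" and disj: "disjoint K" using K(1) by (auto simp: subcubes_def)
    \<comment> \<open>K dominates itself, so heaviness turns into a lower bound for its total
      volume.\<close>
    have le: "c * dm Q ^ d \<le> (\<Sum>k\<in>K. dm k ^ d)"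
      using K(2)[unfolded heavy_def, rule_format, OF fin] Kq by blast
    have "ennreal c * emeasure lborel Q = ennreal (c * dm Q ^ d * (1 / udiam) ^ d)"
      using Q(1) c by (simp add: emeasure_dyadic_cube ennreal_mult'[symmetric] d_def power_divide)
    also have "\<dots> \<le> ennreal ((\<Sum>k\<in>K. dm k ^ d) * (1 / udiam) ^ d)"
      using le udiam_pos by (intro ennreal_leI mult_right_mono) auto
    also have "\<dots> = (\<Sum>k\<in>K. ennreal ((dm k / udiam) ^ d))"
    proof -
      have "0 \<le> (dm k / udiam) ^ d" if "k \<in> K" for k using udiam_pos dm_pos[OF Kq(1)[OF that]] by simp
      then show ?thesis by (subst sum_ennreal) (auto simp: sum_divide_distrib power_divide)
    qed
    also have "\<dots> = (\<Sum>k\<in>K. emeasure lborel k)" using Kq(1) by (simp add: emeasure_dyadic_cube d_def)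
    also have "\<dots> = emeasure lborel (\<Union>k\<in>K. k)"
    proof (rule sum_emeasure)
      show "disjoint_family_on (\<lambda>k. k) K" using disj by (auto simp: disjoint_family_on_def pairwise_def disjnt_def)
    qed (use fin dyadic_cube_borel[OF Kq(1)] in auto)
    also have "\<dots> \<le> emeasure lborel (tail m \<inter> Q)"
    proof (rule emeasure_mono)
      show "(\<Union>k\<in>K. k) \<subseteq> tail m \<inter> Q" using Kq by blast
      show "tail m \<inter> Q \<in> sets lborel" using open_tail[of m] dyadic_cube_borel[OF Q(1)] by auto
    qed
    finally show ?thesis .
  qed
  have opn: "ennreal c * emeasure lborel W \<le> emeasure lborel (tail m \<inter> W)" if W: "open W" "W \<subseteq> U" for W m
  proof -
    obtain \<Q> where Q: "countable \<Q>" "disjoint \<Q>" "\<Union>\<Q> = W" "\<And>Q. Q \<in> \<Q> \<Longrightarrow> dyadic_cube Q \<and> dm Q \<le> 1"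
      using dyadic_partition[OF W(1) zero_less_one] by blast
    have dQ: "disjoint_family_on (\<lambda>Q. Q) \<Q>" "disjoint_family_on (\<lambda>Q. tail m \<inter> Q) \<Q>"
      using Q(2) by (auto simp: disjoint_family_on_def pairwise_def disjnt_def)
    have "ennreal c * emeasure lborel (\<Union>Q\<in>\<Q>. Q) = ennreal c * (\<integral>\<^sup>+Q. emeasure lborel Q \<partial>count_space \<Q>)"
      using Q(1,4) dQ dyadic_cube_borel by (subst emeasure_UN_countable) auto
    also have "\<dots> = (\<integral>\<^sup>+Q. ennreal c * emeasure lborel Q \<partial>count_space \<Q>)" by (rule nn_integral_cmult[symmetric]) simp
    also have "\<dots> \<le> (\<integral>\<^sup>+Q. emeasure lborel (tail m \<inter> Q) \<partial>count_space \<Q>)"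
      using Q(3,4) W(2) by (intro nn_integral_mono cube) auto
    also have "\<dots> = emeasure lborel (\<Union>Q\<in>\<Q>. tail m \<inter> Q)"
    proof (rule emeasure_UN_countable[symmetric])
      show "tail m \<inter> Q \<in> sets lborel" if "Q \<in> \<Q>" for Q using open_tail[of m] dyadic_cube_borel[of Q] Q(4)[OF that] by auto
    qed (use Q dQ in auto)
    also have "(\<Union>Q\<in>\<Q>. tail m \<inter> Q) = tail m \<inter> W" using Q(3) by blast
    finally show ?thesis using Q(3) by simp
  qed
  \<comment> \<open>Cutting with balls makes the measure finite, so that outer regularity can
    provide an excess smaller than c times it.\<close>
  have null: "emeasure lborel ((U - tail m) \<inter> nball nrm 0 (real i)) = 0" for m i
  proof (rule ccontr)
    let ?E = "(U - tail m) \<inter> nball nrm 0 (real i)"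
    assume ne: "emeasure lborel ?E \<noteq> 0"
    have E: "?E \<in> sets borel" using open_U open_tail[of m] by auto
    have "emeasure lborel ?E < \<infinity>"
      using emeasure_bounded_finite[of ?E] bounded_subset[OF bounded_nball[of 0 "real i"]] by auto
    then obtain e where e: "emeasure lborel ?E = ennreal e" "0 < e" using ne by (cases "emeasure lborel ?E") auto
    obtain W0 where W0: "open W0" "?E \<subseteq> W0" "emeasure lborel (W0 - ?E) < ennreal (c * e)"
      using outer_regular_lborel[OF E, of "c * e"] c e by auto
    define W where "W = W0 \<inter> U"
    have W: "open W" "W \<subseteq> U" "?E \<subseteq> W" using W0 open_U by (auto simp: W_def)
    have "ennreal (c * e) = ennreal c * emeasure lborel ?E" using c e by (simp add: ennreal_mult')
    also have "\<dots> \<le> ennreal c * emeasure lborel W" using W by (intro mult_left_mono emeasure_mono) auto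
    also have "\<dots> \<le> emeasure lborel (tail m \<inter> W)" using W by (intro opn)
    also have "\<dots> \<le> emeasure lborel (W0 - ?E)"
      using W0(1) E by (intro emeasure_mono) (auto simp: W_def)
    finally show False using W0(3) by simp
  qed
  have "U - F = (\<Union>m. \<Union>i. (U - tail m) \<inter> nball nrm 0 (real i))"
  proof -
    have "\<exists>i. x \<in> nball nrm 0 (real i)" for x using reals_Archimedean2[of "nrm x"] by (simp add: mem_nball)
    then show ?thesis by (auto simp: F_eq_Inter)
  qed
  moreover have "(\<Union>m. \<Union>i. (U - tail m) \<inter> nball nrm 0 (real i)) \<in> null_sets lborel"
    using null open_U open_tail by (intro null_sets_UN) (auto simp: null_sets_def)
  ultimately show ?thesis by auto
qed

end

section \<open>Describability\<close>

context regular_approximation begin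

lemma Minf_F_Int_divergent:
  assumes M: "2 \<le> M" and exact: "\<And>g \<epsilon> Q N. dgauge_on DIM('a) \<epsilon> g \<Longrightarrow> divergent M \<epsilon> g \<Longrightarrow> unbounded g \<Longrightarrow>
     dyadic_cube Q \<Longrightarrow> Q \<subseteq> U \<Longrightarrow> dm Q \<le> \<epsilon> \<Longrightarrow> finite N \<Longrightarrow> \<exists>K. subcubes N Q K \<and> heavy g 1 Q K"
    and van: vanishing
    and h: "h 0 = 0" "\<And>r. 0 < r \<Longrightarrow> r \<le> \<epsilon> \<Longrightarrow> h (ennreal r) = ennreal (G r)"
    and G: "dgauge_on DIM('a) \<epsilon> G" "divergent M \<epsilon> G" "unbounded G" and V: "open V" "V \<subseteq> U"
  shows "Minf nrm h (F \<inter> V) = Minf nrm h V"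
\<comment> \<open>Halving \<epsilon> produces the strict inequality with \<open>eps_h\<close>, for
  which \<open>eps_h_ge\<close> gives only a weak one.\<close>
proof (rule Minf_F_Int[where \<epsilon> = "\<epsilon> / 2" and g = G])
  have e: "0 < \<epsilon>" using dgauge_onD(1)[OF G(1)] .
  show g: "dgauge_on DIM('a) (\<epsilon> / 2) G" using dgauge_on_subset[OF G(1)] e by simp
  have "ennreal (\<epsilon> / 2) < ennreal \<epsilon>" using e by (simp add: ennreal_less_iff)
  also have "\<dots> \<le> eps_h DIM('a) h" using h G by (intro eps_h_ge) auto
  finally show "ennreal (\<epsilon> / 2) < eps_h DIM('a) h" .
  have "divergent M (\<epsilon> / 2) G" using divergent_radius[OF van M, of \<epsilon> "\<epsilon> / 2" G] e G(2) by simp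
  then show "\<exists>K. subcubes N q K \<and> heavy G 1 q K" if "dyadic_cube q" "q \<subseteq> U" "dm q \<le> \<epsilon> / 2" "finite N" for q N
    using exact[OF g _ G(3)] that by blast
qed (use h V dgauge_onD(1)[OF G(1)] in auto)

lemma Minf_U_pos:
  assumes "U \<noteq> {}" and h: "h 0 = 0" "\<And>r. 0 < r \<Longrightarrow> r \<le> \<epsilon> \<Longrightarrow> h (ennreal r) = ennreal (G r)"
    and G: "dgauge_on DIM('a) \<epsilon> G"
  shows "0 < Minf nrm h U"
proof -
  obtain \<Q> where Q: "\<Union>\<Q> = U" "\<And>Q. Q \<in> \<Q> \<Longrightarrow> dyadic_cube Q \<and> dm Q \<le> \<epsilon>"
    using dyadic_partition[OF open_U dgauge_onD(1)[OF G]] by blast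
  obtain Q where "Q \<in> \<Q>" using Q(1) assms(1) by blast
  then have q: "dyadic_cube Q" "dm Q \<le> \<epsilon>" "Q \<subseteq> U" using Q by auto
  have "0 < ennreal (G (dm Q))" using dgauge_onD(2)[OF G dm_pos[OF q(1)] q(2)] by simp
  also have "\<dots> \<le> Minf nrm h Q" using h G q by (intro Minf_dyadic_cube_ge) auto
  also have "\<dots> \<le> Minf nrm h U" using q by (intro Minf_mono)
  finally show ?thesis .
qed

end

section \<open>Gauges that precede a given one\<close>

lemma boosted_gauge:
  assumes rep: "represents d g \<epsilon> G" and G': "dgauge_on d \<epsilon> G'"
    and ratio: "\<And>x y. 0 < x \<Longrightarrow> x \<le> y \<Longrightarrow> y \<le> \<epsilon> \<Longrightarrow> G' y / G y \<le> G' x / G x"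
    and big: "\<And>B. \<exists>\<delta>>0. \<forall>x. 0 < x \<longrightarrow> x \<le> \<delta> \<longrightarrow> x \<le> \<epsilon> \<longrightarrow> B \<le> G' x / G x"
    and lim: "\<And>c. 0 < c \<Longrightarrow> \<exists>\<delta>>0. \<forall>x. 0 < x \<longrightarrow> x \<le> \<delta> \<longrightarrow> x \<le> \<epsilon> \<longrightarrow> G' x \<le> c"
  obtains h where "gauge h" "d_normalized d h" "gprec h (dnorm d g)" "h 0 = 0"
    "\<And>r. 0 < r \<Longrightarrow> r \<le> \<epsilon> \<Longrightarrow> h (ennreal r) = ennreal (G' r)" "represents d h \<epsilon> G'"
proof -
  note GD = representsD[OF rep] dgauge_onD[OF representsD(1)[OF rep]]
  note G'D = dgauge_onD[OF G']
  \<comment> \<open>Beyond \<epsilon> the function is continued by its value at \<epsilon>; a gauge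
    is constrained only near 0 and at infinity.\<close>
  define h where "h x = (if x = 0 then 0 else if x = top then top else ennreal (G' (min (enn2real x) \<epsilon>)))" for x
  have h: "h 0 = 0" "h top = top" "\<And>r. 0 < r \<Longrightarrow> r \<le> \<epsilon> \<Longrightarrow> h (ennreal r) = ennreal (G' r)" by (auto simp: h_def)
  have lim': "\<exists>\<delta>>0. \<forall>x. 0 < x \<longrightarrow> x \<le> \<delta> \<longrightarrow> G' x \<le> c" if c: "0 < c" for c
  proof -
    obtain \<delta> where "0 < \<delta>" "\<And>x. 0 < x \<Longrightarrow> x \<le> \<delta> \<Longrightarrow> x \<le> \<epsilon> \<Longrightarrow> G' x \<le> c" using lim[OF c] by blast
    then show ?thesis using G'D(1) by (intro exI[of _ "min \<delta> \<epsilon>"]) auto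
  qed
  have reph: "represents d h \<epsilon> G'" by (rule represents_self[OF h(1,3) G' lim'])
  note hD = representsD[OF reph]
  have "gauge h" unfolding gauge_def
  proof (intro conjI)
    show "\<exists>\<epsilon>>0. mono_on {0..\<epsilon>} h" using hD(3) G'D(1) by (intro exI[of _ "ennreal \<epsilon>"]) auto
    show "(h \<longlongrightarrow> 0) (at 0)"
    proof (rule order_tendstoI)
      fix a :: ennreal assume "0 < a"
      then obtain c' where c': "0 < c'" "c' < a" using dense by blast
      then have "c' < top" using top.not_eq_extremum by fastforce
      then obtain c where c: "c' = ennreal c" "0 < c" using c'(1) by (cases c') auto
      obtain \<delta> where \<delta>: "0 < \<delta>" "\<And>r. 0 < r \<Longrightarrow> r \<le> \<delta> \<Longrightarrow> h (ennreal r) \<le> ennreal c" using hD(4)[OF c(2)] by blast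
      have "\<forall>\<^sub>F x in nhds (0::ennreal). x < ennreal \<delta>"
        using \<delta>(1) by (intro eventually_nhds_in_open[of "{..<ennreal \<delta>}", simplified]) auto
      then show "\<forall>\<^sub>F x in at 0. h x < a"
        unfolding eventually_at_filter
      proof (eventually_elim, intro impI)
        fix x :: ennreal assume x: "x < ennreal \<delta>" "x \<noteq> 0"
        then have "x < top" by (meson le_ennreal_less_top less_imp_le)
        then obtain r where r: "x = ennreal r" "0 \<le> r" by (auto simp: less_top_ennreal)
        then have "0 < r" "r \<le> \<delta>" using x by (auto simp: ennreal_less_iff less_imp_le)
        then have "h x \<le> c'" using \<delta>(2) r c(1) by simp
        then show "h x < a" using c'(2) by simp
      qed
    qed simp
  qed (use h in auto)
  moreover have "d_normalized d h"
    unfolding d_normalized_def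
  proof (intro exI[of _ "ennreal \<epsilon>"] conjI allI impI)
    fix x :: ennreal assume x: "x < ennreal \<epsilon>"
    then have "x < top" by (meson le_ennreal_less_top less_imp_le)
    then obtain r where r: "x = ennreal r" "0 \<le> r" by (auto simp: less_top_ennreal)
    show "h x = dnorm d h x"
    proof (cases "r = 0")
      case False
      then have "0 < r" "r \<le> \<epsilon>" using x r by (auto simp: ennreal_less_iff)
      then show ?thesis using hD(2) h(3) r by simp
    qed (use r h in simp)
  qed (use G'D(1) in simp)
  moreover have "gprec h (dnorm d g)"
    unfolding gprec_def
  proof (intro disjI2 conjI)
    have q: "h (ennreal r) / dnorm d g (ennreal r) = ennreal (G' r / G r)" if "0 < r" "r \<le> \<epsilon>" for r
      using h(3)[OF that] GD(2)[OF that] GD(6)[OF that] G'D(2)[OF that] by (simp add: divide_ennreal)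
    show "\<exists>\<epsilon>>0. \<forall>r s. 0 < r \<longrightarrow> r \<le> s \<longrightarrow> s < \<epsilon> \<longrightarrow>
      h (ennreal s) / dnorm d g (ennreal s) \<le> h (ennreal r) / dnorm d g (ennreal r)"
      using G'D(1) ratio by (intro exI[of _ \<epsilon>]) (auto simp: q intro!: ennreal_leI)
    show "((\<lambda>r. h (ennreal r) / dnorm d g (ennreal r)) \<longlongrightarrow> top) (at_right 0)"
    proof (rule order_tendstoI)
      fix a :: ennreal assume "a < top"
      then obtain B where B: "0 \<le> B" "a = ennreal B" by (auto simp: less_top_ennreal)
      obtain \<delta> where \<delta>: "0 < \<delta>" "\<And>x. 0 < x \<Longrightarrow> x \<le> \<delta> \<Longrightarrow> x \<le> \<epsilon> \<Longrightarrow> B + 1 \<le> G' x / G x" using big by blast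
      show "\<forall>\<^sub>F r in at_right 0. a < h (ennreal r) / dnorm d g (ennreal r)"
        unfolding eventually_at_right_field
      proof (intro exI[of _ "min \<delta> \<epsilon>"] conjI allI impI)
        fix r assume r: "0 < r" "r < min \<delta> \<epsilon>"
        then have "B + 1 \<le> G' r / G r" using \<delta>(2) by simp
        then show "a < h (ennreal r) / dnorm d g (ennreal r)" using B q[of r] r by (simp add: ennreal_less_iff)
      qed (use \<delta>(1) G'D(1) in simp)
    qed simp
  qed
  ultimately show ?thesis using that[of h] h(1,3) reph by blast
qed

text \<open>The case of a gauge vanishing near 0 is excluded by \<open>ell d g = top\<close>, so
  h/g_d tends to infinity; hence h dominates g_d near 0 and inherits the unbounded ratio to r^d.
  Being normalized, h coincides there with its own real representative.\<close>

lemma gprec_represents: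
  assumes g: "g \<in> Ginf d" and rep: "represents d g \<epsilon> G"
    and h: "gauge h" "d_normalized d h" "gprec h (dnorm d g)"
  obtains \<delta> G' where "0 < \<delta>" "\<delta> \<le> \<epsilon>" "dgauge_on d \<delta> G'" "h 0 = 0" "\<And>r. 0 < r \<Longrightarrow> r \<le> \<delta> \<Longrightarrow> h (ennreal r) = ennreal (G' r)"
    "\<And>r. 0 < r \<Longrightarrow> r \<le> \<delta> \<Longrightarrow> G r \<le> G' r" "\<And>B. \<exists>\<delta>>0. \<forall>x. 0 < x \<longrightarrow> x \<le> \<delta> \<longrightarrow> B \<le> G' x / x ^ d"
proof -
  note GD = representsD[OF rep] dgauge_onD[OF representsD(1)[OF rep]]
  have "\<not> (\<exists>\<epsilon>>0. \<forall>r<\<epsilon>. dnorm d g r = 0)"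
  proof
    assume "\<exists>\<epsilon>>0. \<forall>r<\<epsilon>. dnorm d g r = 0"
    then obtain e where e: "0 < e" "\<And>r. r < e \<Longrightarrow> dnorm d g r = 0" by blast
    obtain x where x: "0 < x" "x < e" using dense e(1) by blast
    then have "x < top" using top.not_eq_extremum by fastforce
    then obtain y where y: "x = ennreal y" "0 < y" using x by (cases x) auto
    have "ennreal (min y \<epsilon>) \<le> x" using y by (simp add: ennreal_leI)
    then have "ennreal (min y \<epsilon>) < e" using x(2) by (rule le_less_trans)
    then have "dnorm d g (ennreal (min y \<epsilon>)) = 0" by (rule e(2))
    then show False using GD(2)[of "min y \<epsilon>"] GD(6)[of "min y \<epsilon>"] GD(5) y by simp
  qed
  then have "((\<lambda>r. h (ennreal r) / dnorm d g (ennreal r)) \<longlongrightarrow> top) (at_right 0)"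
    using h(3) unfolding gprec_def by blast
  then have "\<forall>\<^sub>F r in at_right 0. 1 < h (ennreal r) / dnorm d g (ennreal r)" by (rule order_tendstoD) simp
  then obtain b where b: "0 < b" "\<And>r. 0 < r \<Longrightarrow> r < b \<Longrightarrow> 1 < h (ennreal r) / dnorm d g (ennreal r)"
    unfolding eventually_at_right_field by auto
  define e1 where "e1 = min (b / 2) \<epsilon>"
  have e1: "0 < e1" "e1 \<le> \<epsilon>" using b GD(5) by (auto simp: e1_def)
  have hg: "ennreal (G r) \<le> h (ennreal r)" if r: "0 < r" "r \<le> e1" for r
  proof -
    have G: "0 < G r" "dnorm d g (ennreal r) = ennreal (G r)" using GD(2,6) r e1 by auto
    have "1 \<le> h (ennreal r) / ennreal (G r)" using b(2)[of r] r b(1) G(2) by (simp add: e1_def less_imp_le)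
    then have "ennreal (G r) * 1 \<le> ennreal (G r) * (h (ennreal r) / ennreal (G r))" by (rule mult_left_mono) simp
    then show ?thesis using G(1) by (simp add: pos_times_divide_cancel)
  qed
  have unbG: "\<exists>\<delta>>0. \<forall>x. 0 < x \<longrightarrow> x \<le> \<delta> \<longrightarrow> B \<le> G x / x ^ d" for B
    using represents_unbounded[OF rep] g by (simp add: Ginf_def)
  have ellh: "ell d h = top"
  proof (rule ell_eq_topI)
    fix B :: real assume "0 < B"
    obtain \<delta> where \<delta>: "0 < \<delta>" "\<And>x. 0 < x \<Longrightarrow> x \<le> \<delta> \<Longrightarrow> B \<le> G x / x ^ d" using unbG by blast
    have "ennreal (B * r ^ d) \<le> h (ennreal r)" if r: "0 < r" "r \<le> min \<delta> e1" for r
    proof -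
      have "B * r ^ d \<le> G r" using \<delta>(2)[of r] r by (simp add: pos_le_divide_eq)
      then have "ennreal (B * r ^ d) \<le> ennreal (G r)" by (rule ennreal_leI)
      then show ?thesis using hg[of r] r by simp
    qed
    then show "\<exists>\<delta>>0. \<forall>r. 0 < r \<longrightarrow> r \<le> \<delta> \<longrightarrow> ennreal (B * r ^ d) \<le> h (ennreal r)"
      using \<delta>(1) e1(1) by (intro exI[of _ "min \<delta> e1"]) auto
  qed
  obtain e2 G' where reph: "represents d h e2 G'" using gauge_represents[OF h(1)] ellh by (metis ennreal_zero_less_top)
  note G'D = representsD[OF reph] dgauge_onD[OF representsD(1)[OF reph]]
  obtain e3' where e3': "0 < e3'" "\<And>r. r < e3' \<Longrightarrow> h r = dnorm d h r" using h(2) unfolding d_normalized_def by blast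
  obtain x where x: "0 < x" "x < e3'" using dense e3'(1) by blast
  then have "x < top" using top.not_eq_extremum by fastforce
  then obtain e3 where e3: "x = ennreal e3" "0 < e3" using x by (cases x) auto
  have hn: "h (ennreal r) = dnorm d h (ennreal r)" if "r \<le> e3" for r
  proof -
    have "ennreal r \<le> x" using that e3 by (simp add: ennreal_leI)
    then show ?thesis using e3'(2) x(2) by (meson le_less_trans)
  qed
  define \<delta> where "\<delta> = min e1 (min e2 e3)"
  have \<delta>: "0 < \<delta>" "\<delta> \<le> \<epsilon>" "\<delta> \<le> e1" "\<delta> \<le> e2" "\<delta> \<le> e3" using e1 e3 G'D(5) by (auto simp: \<delta>_def)
  have hG': "h (ennreal r) = ennreal (G' r)" if "0 < r" "r \<le> \<delta>" for r
    using hn[of r] G'D(2)[of r] that \<delta> by simp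
  show ?thesis
  proof (rule that[of \<delta> G'])
    show "dgauge_on d \<delta> G'" using dgauge_on_subset[OF G'D(1)] \<delta> by blast
    show "h 0 = 0" using h(1) by (simp add: gauge_def)
    show "G r \<le> G' r" if r: "0 < r" "r \<le> \<delta>" for r
    proof -
      have "ennreal (G r) \<le> ennreal (G' r)" using hg[of r] hG'[OF r] r \<delta> by simp
      then show ?thesis using G'D(6)[of r] r \<delta> by (simp add: ennreal_le_iff)
    qed
    show "\<exists>\<delta>>0. \<forall>x. 0 < x \<longrightarrow> x \<le> \<delta> \<longrightarrow> B \<le> G' x / x ^ d" for B by (rule represents_unbounded[OF reph ellh])
  qed (use \<delta> hG' in auto)
qed

section \<open>Integral conditions as series, and the describability proof\<close>

context optimal_regular_approximation begin

text \<open>The integrand is bounded on [0, b), so only its behaviour at infinity decides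
  convergence.\<close>

lemma \<phi>_integral_split:
  fixes f :: "real \<Rightarrow> ennreal"
  assumes f: "(\<lambda>\<eta>. f \<eta> * indicator {0..} \<eta>) \<in> borel_measurable borel" and "0 \<le> b" and bd: "\<And>\<eta>. 0 \<le> \<eta> \<Longrightarrow> \<eta> < b \<Longrightarrow> f \<eta> \<le> C" and "C < top"
  shows "(\<integral>\<^sup>+\<eta>\<in>{0..}. f \<eta> \<partial>lborel) < \<infinity> \<longleftrightarrow> (\<integral>\<^sup>+\<eta>\<in>{b..}. f \<eta> \<partial>lborel) < \<infinity>"
proof -
  have m: "(\<lambda>\<eta>. (f \<eta> * indicator {0..} \<eta>) * indicator S \<eta>) \<in> borel_measurable lborel" if "S \<in> sets borel" for S
    using borel_measurable_times_ennreal[OF f borel_measurable_indicator[OF that]] by simp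
  have "(\<integral>\<^sup>+\<eta>\<in>{0..}. f \<eta> \<partial>lborel) = (\<integral>\<^sup>+\<eta>. (f \<eta> * indicator {0..} \<eta>) * indicator {..<b} \<eta> + (f \<eta> * indicator {0..} \<eta>) * indicator {b..} \<eta> \<partial>lborel)"
    by (intro nn_integral_cong) (auto simp: indicator_def)
  also have "\<dots> = (\<integral>\<^sup>+\<eta>. (f \<eta> * indicator {0..} \<eta>) * indicator {..<b} \<eta> \<partial>lborel) + (\<integral>\<^sup>+\<eta>. (f \<eta> * indicator {0..} \<eta>) * indicator {b..} \<eta> \<partial>lborel)"
    by (intro nn_integral_add m) auto
  also have "(\<integral>\<^sup>+\<eta>. (f \<eta> * indicator {0..} \<eta>) * indicator {b..} \<eta> \<partial>lborel) = (\<integral>\<^sup>+\<eta>\<in>{b..}. f \<eta> \<partial>lborel)"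
    using assms(2) by (intro nn_integral_cong) (auto simp: indicator_def)
  finally have eq: "(\<integral>\<^sup>+\<eta>\<in>{0..}. f \<eta> \<partial>lborel) = (\<integral>\<^sup>+\<eta>. (f \<eta> * indicator {0..} \<eta>) * indicator {..<b} \<eta> \<partial>lborel) + (\<integral>\<^sup>+\<eta>\<in>{b..}. f \<eta> \<partial>lborel)" .
  have "(\<integral>\<^sup>+\<eta>. (f \<eta> * indicator {0..} \<eta>) * indicator {..<b} \<eta> \<partial>lborel) \<le> (\<integral>\<^sup>+\<eta>. C * indicator {0..b} \<eta> \<partial>lborel)"
    using bd by (intro nn_integral_mono) (auto simp: indicator_def)
  also have "\<dots> = C * ennreal b" using assms(2) by (simp add: nn_integral_cmult_indicator)
  also have "\<dots> < \<infinity>" using assms(4) by (simp add: ennreal_mult_less_top)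
  finally show ?thesis unfolding eq by simp
qed

context
  assumes cont: "continuous_on {0..} \<phi>"
begin

text \<open>\<phi> is controlled only on the half-line; clamping the argument makes the composite
  continuous everywhere.\<close>

lemma \<phi>_clamped_measurable: "(\<lambda>\<eta>. \<phi> (max 0 \<eta>)) \<in> borel_measurable borel"
proof (intro borel_measurable_continuous_onI continuous_on_compose2[OF cont])
qed (auto intro: continuous_intros)

lemma \<phi>_comp_measurable:
  assumes "f \<in> borel_measurable borel"
  shows "(\<lambda>\<eta>. ennreal (\<eta> ^ k) * f (\<phi> \<eta>) * indicator {0..} \<eta>) \<in> borel_measurable borel"
proof -
  have "(\<lambda>\<eta>. f (\<phi> (max 0 \<eta>))) \<in> borel_measurable borel"
    using measurable_compose[OF \<phi>_clamped_measurable assms] .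
  then have "(\<lambda>\<eta>. ennreal (\<eta> ^ k) * f (\<phi> (max 0 \<eta>)) * indicator {0..} \<eta>) \<in> borel_measurable borel" by measurable
  also have "(\<lambda>\<eta>. ennreal (\<eta> ^ k) * f (\<phi> (max 0 \<eta>)) * indicator {0..} \<eta>) = (\<lambda>\<eta>. ennreal (\<eta> ^ k) * f (\<phi> \<eta>) * indicator {0..} \<eta>)"
    by (auto simp: fun_eq_iff indicator_def)
  finally show ?thesis .
qed

lemma volume_integral_finite_iff:
  assumes M: "2 \<le> M"
  shows "(\<integral>\<^sup>+ \<eta>\<in>{0..}. ennreal (\<eta> ^ (DIM('a) - 1) * \<phi> \<eta> ^ DIM('a)) \<partial>lborel) < \<infinity> \<longleftrightarrow>
    summable (\<lambda>k. (M ^ k) ^ DIM('a) * \<phi> (M ^ k) ^ DIM('a))"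
proof -
  have "(\<lambda>r. ennreal (r ^ DIM('a))) \<in> borel_measurable borel" by measurable
  from \<phi>_comp_measurable[OF this, of "DIM('a) - 1"]
  have m: "(\<lambda>\<eta>. ennreal (\<eta> ^ (DIM('a) - 1) * \<phi> \<eta> ^ DIM('a)) * indicator {0..} \<eta>) \<in> borel_measurable borel"
    by (rule measurable_cong[THEN iffD1, rotated]) (auto simp: indicator_def ennreal_mult')
  have "(\<integral>\<^sup>+ \<eta>\<in>{0..}. ennreal (\<eta> ^ (DIM('a) - 1) * \<phi> \<eta> ^ DIM('a)) \<partial>lborel) < \<infinity> \<longleftrightarrow>
     (\<integral>\<^sup>+ \<eta>\<in>{M ^ 0..}. ennreal (\<eta> ^ (DIM('a) - 1) * \<phi> \<eta> ^ DIM('a)) \<partial>lborel) < \<infinity>"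
  proof (rule \<phi>_integral_split[OF m, of _ "ennreal (\<phi> 0 ^ DIM('a))"])
    fix \<eta> :: real assume \<eta>: "0 \<le> \<eta>" "\<eta> < M ^ 0"
    have "\<eta> ^ (DIM('a) - 1) * \<phi> \<eta> ^ DIM('a) \<le> 1 * \<phi> 0 ^ DIM('a)"
      using \<eta> \<phi>_le[of 0 \<eta>] \<phi>_pos[of \<eta>] by (intro mult_mono power_mono power_le_one) auto
    then show "ennreal (\<eta> ^ (DIM('a) - 1) * \<phi> \<eta> ^ DIM('a)) \<le> ennreal (\<phi> 0 ^ DIM('a))" by (intro ennreal_leI) simp
  qed auto
  also have "\<dots> \<longleftrightarrow> summable (\<lambda>k. (M ^ k) ^ DIM('a) * \<phi> (M ^ k) ^ DIM('a))"
  proof (rule condensation[OF M])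
    fix x y :: real assume "M ^ 0 \<le> x"
    then have x: "0 \<le> x" by simp
    show "0 \<le> \<phi> x ^ DIM('a)" using \<phi>_pos[OF x] by simp
    show "\<phi> y ^ DIM('a) \<le> \<phi> x ^ DIM('a)" if "x \<le> y" using \<phi>_le[OF x that] \<phi>_pos[of y] x that by (intro power_mono) auto
  qed simp
  finally show ?thesis .
qed

text \<open>The terms tend to 0 and (M^k)^d \<ge> 1, which forces \<phi> to be small at some power
  of M.\<close>

lemma summable_vanishing:
  assumes M: "2 \<le> M" and s: "summable (\<lambda>k. (M ^ k) ^ DIM('a) * \<phi> (M ^ k) ^ DIM('a))"
  shows vanishing
  unfolding vanishing_def
proof (intro allI impI)
  fix c :: real assume c: "0 < c"
  have "\<forall>\<^sub>F k in sequentially. (M ^ k) ^ DIM('a) * \<phi> (M ^ k) ^ DIM('a) < c ^ DIM('a)"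
    using summable_LIMSEQ_zero[OF s] by (rule order_tendstoD) (use c in simp)
  then obtain k where k: "(M ^ k) ^ DIM('a) * \<phi> (M ^ k) ^ DIM('a) < c ^ DIM('a)" unfolding eventually_sequentially by blast
  have p: "0 < \<phi> (M ^ k)" using M by (intro \<phi>_pos) simp
  have "1 * \<phi> (M ^ k) ^ DIM('a) \<le> (M ^ k) ^ DIM('a) * \<phi> (M ^ k) ^ DIM('a)"
    using M p by (intro mult_right_mono) auto
  then have "\<phi> (M ^ k) ^ DIM('a) < c ^ DIM('a)" using k by simp
  then have "\<phi> (M ^ k) < c" using less_imp_le[OF c] by (rule power_less_imp_less_base)
  then show "\<exists>x\<ge>0. \<phi> x \<le> c" using M by (intro exI[of _ "M ^ k"]) auto
qed

text \<open>\<phi> may stay away from 0 here, so the truncation at 1 cannot be removed by passing to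
  a tail. Instead the truncated term is bounded below by the minimum of the original term and
  1.\<close>

lemma infinite_volume_divergent:
  assumes M: "2 \<le> M" and I: "(\<integral>\<^sup>+ \<eta>\<in>{0..}. ennreal (\<eta> ^ (DIM('a) - 1) * \<phi> \<eta> ^ DIM('a)) \<partial>lborel) = \<infinity>"
  shows "divergent M 1 (\<lambda>r. r ^ DIM('a))"
proof -
  let ?x = "\<lambda>k. (M ^ k) ^ DIM('a) * \<phi> (M ^ k) ^ DIM('a)"
  have ns: "\<not> summable ?x" using volume_integral_finite_iff[OF M] I by simp
  have p: "0 < \<phi> (M ^ k)" for k using M by (intro \<phi>_pos) simp
  have "\<not> summable (\<lambda>k. min (?x k) 1)"
    using M less_imp_le[OF p] by (intro not_summable_min_1 ns) auto
  moreover have "min (?x k) 1 \<le> (M ^ k) ^ DIM('a) * min (\<phi> (M ^ k)) 1 ^ DIM('a)" for k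
  proof (cases "\<phi> (M ^ k) \<le> 1")
    case False
    have "1 \<le> (M ^ k) ^ DIM('a)" using M by simp
    then show ?thesis using False by simp
  qed simp
  then have "summable (\<lambda>k. min (?x k) 1)" if "summable (\<lambda>k. (M ^ k) ^ DIM('a) * min (\<phi> (M ^ k)) 1 ^ DIM('a))"
    by (intro summable_comparison_test'[OF that, of 0]) (use M less_imp_le[OF p] in auto)
  ultimately show ?thesis unfolding divergent_def by blast
qed

text \<open>From \<open>M ^ k0\<close> on, \<phi> is at most \<epsilon> and at most 1, so neither
  the restriction to (0,1] nor the truncation at \<epsilon> is felt. Before that point the integrand
  is bounded by means of \<open>dratio\<close> at \<phi>(M^k0), which by antimonotonicity also
  controls the scales beyond \<epsilon>.\<close>

lemma measure_integral_finite_iff: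
  assumes M: "2 \<le> M" and van: vanishing and rep: "represents DIM('a) g \<epsilon> G"
    and n: "\<forall>f \<in> borel_measurable borel. (\<forall>r. r \<notin> {0<..1} \<longrightarrow> f r = 0) \<longrightarrow>
               (\<integral>\<^sup>+ r. f r \<partial>n) = (\<integral>\<^sup>+ \<eta>\<in>{0..}. ennreal (\<eta> ^ (DIM('a) - 1)) * f (\<phi> \<eta>) \<partial>lborel)"
  shows "(\<integral>\<^sup>+ r\<in>{0<..1}. dnorm DIM('a) g (ennreal r) \<partial>n) < \<infinity> \<longleftrightarrow> \<not> divergent M \<epsilon> G"
proof -
  define d where "d = DIM('a)"
  note GD = representsD[OF rep, folded d_def] dgauge_onD[OF representsD(1)[OF rep], folded d_def]
  define f where "f r = dnorm d g (ennreal r) * indicator {0<..1} r" for r :: real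
  have fm: "f \<in> borel_measurable borel" unfolding f_def by (rule dnorm_measurable)
  have fn: "(\<integral>\<^sup>+ r. f r \<partial>n) = (\<integral>\<^sup>+ \<eta>\<in>{0..}. ennreal (\<eta> ^ (d - 1)) * f (\<phi> \<eta>) \<partial>lborel)"
    using n fm by (auto simp: f_def d_def)
  obtain k0 where k0: "\<And>k. k0 \<le> k \<Longrightarrow> \<phi> (M ^ k) \<le> min \<epsilon> 1"
    using vanishing_power[OF van M, of "min \<epsilon> 1"] GD(5) by auto
  let ?b = "M ^ k0"
  have b: "0 < ?b" "\<phi> ?b \<le> \<epsilon>" "\<phi> ?b \<le> 1" "0 < \<phi> ?b" using M k0[of k0] \<phi>_pos[of ?b] by auto
  have far: "f (\<phi> \<eta>) = ennreal (G (min (\<phi> \<eta>) \<epsilon>))" if "?b \<le> \<eta>" for \<eta>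
  proof -
    have "\<phi> \<eta> \<le> \<phi> ?b" "0 < \<phi> \<eta>" using that b(1) \<phi>_le[of ?b \<eta>] \<phi>_pos[of \<eta>] by auto
    then have "\<phi> \<eta> \<le> \<epsilon>" "\<phi> \<eta> \<le> 1" "0 < \<phi> \<eta>" using b by auto
    then show ?thesis using GD(2) by (simp add: f_def min_absorb1)
  qed
  have "(\<integral>\<^sup>+ r. f r \<partial>n) < \<infinity> \<longleftrightarrow> (\<integral>\<^sup>+ \<eta>\<in>{?b..}. ennreal (\<eta> ^ (d - 1)) * f (\<phi> \<eta>) \<partial>lborel) < \<infinity>"
    unfolding fn
  proof (rule \<phi>_integral_split[OF \<phi>_comp_measurable[OF fm], of _ _ "ennreal (?b ^ (d - 1)) * dratio d g (ennreal (\<phi> ?b))"])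
    fix \<eta> :: real assume \<eta>: "0 \<le> \<eta>" "\<eta> < ?b"
    have \<phi>\<eta>: "\<phi> ?b \<le> \<phi> \<eta>" "0 < \<phi> \<eta>" using \<phi>_le[of \<eta> ?b] \<phi>_pos[of \<eta>] \<eta> by auto
    have "f (\<phi> \<eta>) \<le> dratio d g (ennreal (\<phi> ?b))"
    proof (cases "\<phi> \<eta> \<le> 1")
      case True
      then have "f (\<phi> \<eta>) = ennreal (\<phi> \<eta> ^ d) * dratio d g (ennreal (\<phi> \<eta>))"
        using \<phi>\<eta> by (simp add: f_def dnorm_eq)
      also have "\<dots> \<le> 1 * dratio d g (ennreal (\<phi> ?b))"
        using True \<phi>\<eta> by (intro mult_mono dratio_antimono) (auto simp: ennreal_leI power_le_one)
      finally show ?thesis by simp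
    qed (simp add: f_def)
    then show "ennreal (\<eta> ^ (d - 1)) * f (\<phi> \<eta>) \<le> ennreal (?b ^ (d - 1)) * dratio d g (ennreal (\<phi> ?b))"
      using \<eta> by (intro mult_mono ennreal_leI power_mono) auto
  next
    have "ennreal (\<phi> ?b ^ d) * dratio d g (ennreal (\<phi> ?b)) = ennreal (G (\<phi> ?b))"
      using GD(2)[OF b(4,2)] dnorm_eq[OF b(4), of d g] by simp
    then have "dratio d g (ennreal (\<phi> ?b)) < top"
      using b(4) by (cases "dratio d g (ennreal (\<phi> ?b))") (auto simp: ennreal_mult_top)
    then show "ennreal (?b ^ (d - 1)) * dratio d g (ennreal (\<phi> ?b)) < top" by (simp add: ennreal_mult_less_top)
  qed (use b in simp)
  also have "(\<integral>\<^sup>+ \<eta>\<in>{?b..}. ennreal (\<eta> ^ (d - 1)) * f (\<phi> \<eta>) \<partial>lborel) = (\<integral>\<^sup>+ \<eta>\<in>{?b..}. ennreal (\<eta> ^ (d - 1) * G (min (\<phi> \<eta>) \<epsilon>)) \<partial>lborel)"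
    using far b(1) by (intro nn_integral_cong) (auto simp: indicator_def ennreal_mult')
  also have "\<dots> < \<infinity> \<longleftrightarrow> summable (\<lambda>k. (M ^ k) ^ d * G (min (\<phi> (M ^ k)) \<epsilon>))"
  proof (rule condensation[OF M])
    fix x y :: real assume x: "?b \<le> x"
    then have px: "0 < min (\<phi> x) \<epsilon>" using \<phi>_pos[of x] b(1) GD(5) by simp
    show "0 \<le> G (min (\<phi> x) \<epsilon>)" using GD(6)[OF px] by simp
    show "G (min (\<phi> y) \<epsilon>) \<le> G (min (\<phi> x) \<epsilon>)" if "x \<le> y"
      using \<phi>_le[of x y] \<phi>_pos[of y] that x b(1) GD(5) by (intro GD(7)) auto
  qed (simp add: d_def)
  finally show ?thesis by (simp add: f_def d_def divergent_def)
qed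

text \<open>The mass is infinite because \<phi> is eventually at most 1 and \<eta>^(d-1) is not
  integrable at infinity, which is condensation for the constant 1. It is finite on [\<rho>, 1]
  because \<phi> drops below \<rho>, and the d-th moment is bounded by the volume integral.\<close>

lemma measure_in_Rcal_d:
  fixes M :: real
  assumes M: "2 \<le> M" and van: vanishing
    and I: "(\<integral>\<^sup>+ \<eta>\<in>{0..}. ennreal (\<eta> ^ (DIM('a) - 1) * \<phi> \<eta> ^ DIM('a)) \<partial>lborel) < \<infinity>"
    and ns: "sets n = sets borel" "emeasure n (- {0<..1}) = 0"
    and n: "\<forall>f \<in> borel_measurable borel. (\<forall>r. r \<notin> {0<..1} \<longrightarrow> f r = 0) \<longrightarrow>
               (\<integral>\<^sup>+ r. f r \<partial>n) = (\<integral>\<^sup>+ \<eta>\<in>{0..}. ennreal (\<eta> ^ (DIM('a) - 1)) * f (\<phi> \<eta>) \<partial>lborel)"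
  shows "n \<in> Rcal_d DIM('a)"
proof -
  define d where "d = DIM('a)"
  have n: "(\<integral>\<^sup>+ r. f r \<partial>n) = (\<integral>\<^sup>+ \<eta>\<in>{0..}. ennreal (\<eta> ^ (d - 1)) * f (\<phi> \<eta>) \<partial>lborel)"
    if "f \<in> borel_measurable borel" "\<And>r. r \<notin> {0<..1} \<Longrightarrow> f r = 0" for f
    using n that by (simp add: d_def)
  have em: "emeasure n S = (\<integral>\<^sup>+ \<eta>\<in>{0..}. ennreal (\<eta> ^ (d - 1)) * indicator S (\<phi> \<eta>) \<partial>lborel)"
    if "S \<in> sets borel" "S \<subseteq> {0<..1}" for S
  proof -
    have "emeasure n S = (\<integral>\<^sup>+ r. indicator S r \<partial>n)" using that ns by simp
    also have "\<dots> = (\<integral>\<^sup>+ \<eta>\<in>{0..}. ennreal (\<eta> ^ (d - 1)) * indicator S (\<phi> \<eta>) \<partial>lborel)"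
      using that by (intro n) (auto simp: indicator_def)
    finally show ?thesis .
  qed
  obtain k0 where k0: "\<And>k. k0 \<le> k \<Longrightarrow> \<phi> (M ^ k) \<le> 1" using vanishing_power[OF van M zero_less_one] by blast
  have Mk: "0 < M ^ k0" using M by simp
  have inf: "emeasure n {0<..1} = \<infinity>"
  proof -
    have "\<not> summable (\<lambda>k. (M ^ k) ^ d * 1)"
    proof
      assume "summable (\<lambda>k. (M ^ k) ^ d * 1)"
      then have "(\<lambda>k. (M ^ k) ^ d * 1) \<longlonglongrightarrow> 0" by (rule summable_LIMSEQ_zero)
      then have "\<forall>\<^sub>F k in sequentially. (M ^ k) ^ d * 1 < 1" by (rule order_tendstoD) simp
      then obtain k where "(M ^ k) ^ d * 1 < 1" unfolding eventually_sequentially by blast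
      moreover have "1 \<le> (M ^ k) ^ d" using M by simp
      ultimately show False by simp
    qed
    then have inf_tail: "\<not> (\<integral>\<^sup>+\<eta>\<in>{M ^ k0..}. ennreal (\<eta> ^ (d - 1) * 1) \<partial>lborel) < \<infinity>"
      using condensation[OF M, of d k0 "\<lambda>_. 1"] by (simp add: d_def)
    have em_unit: "emeasure n {0<..1} = (\<integral>\<^sup>+ \<eta>\<in>{0..}. ennreal (\<eta> ^ (d - 1)) * indicator {0<..1} (\<phi> \<eta>) \<partial>lborel)"
      by (rule em) auto
    have "(\<integral>\<^sup>+\<eta>\<in>{M ^ k0..}. ennreal (\<eta> ^ (d - 1) * 1) \<partial>lborel) \<le> emeasure n {0<..1}"
      unfolding em_unit
    proof (rule nn_integral_mono)
      fix \<eta> :: real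
      show "ennreal (\<eta> ^ (d - 1) * 1) * indicator {M ^ k0..} \<eta> \<le> ennreal (\<eta> ^ (d - 1)) * indicator {0<..1} (\<phi> \<eta>) * indicator {0..} \<eta>"
      proof (cases "M ^ k0 \<le> \<eta>")
        case True
        then have "\<phi> \<eta> \<le> 1" "0 < \<phi> \<eta>" "0 \<le> \<eta>" using \<phi>_le[of "M ^ k0" \<eta>] \<phi>_pos[of \<eta>] k0[of k0] Mk by auto
        then show ?thesis using True by simp
      qed simp
    qed
    with inf_tail show ?thesis by (auto simp: not_less top_unique)
  qed
  have fin: "emeasure n {\<rho>..1} < \<infinity>" if \<rho>: "\<rho> \<in> {0<..1}" for \<rho>
  proof -
    \<comment> \<open>Half of \<rho> makes \<phi> strictly smaller than \<rho> beyond x.\<close>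
    obtain x where x: "0 \<le> x" "\<phi> x \<le> \<rho> / 2" using van \<rho> unfolding vanishing_def by (metis greaterThanAtMost_iff half_gt_zero)
    have "emeasure n {\<rho>..1} = (\<integral>\<^sup>+ \<eta>\<in>{0..}. ennreal (\<eta> ^ (d - 1)) * indicator {\<rho>..1} (\<phi> \<eta>) \<partial>lborel)"
      using \<rho> by (intro em) auto
    also have "\<dots> \<le> (\<integral>\<^sup>+ \<eta>. ennreal (x ^ (d - 1)) * indicator {0..x} \<eta> \<partial>lborel)"
    proof (rule nn_integral_mono)
      fix \<eta> :: real
      show "ennreal (\<eta> ^ (d - 1)) * indicator {\<rho>..1} (\<phi> \<eta>) * indicator {0..} \<eta> \<le> ennreal (x ^ (d - 1)) * indicator {0..x} \<eta>"
      proof (cases "0 \<le> \<eta> \<and> \<rho> \<le> \<phi> \<eta>")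
        case True
        have "\<eta> \<le> x"
        proof (rule ccontr)
          assume "\<not> \<eta> \<le> x"
          then have "\<phi> \<eta> \<le> \<phi> x" using x by (intro \<phi>_le) auto
          then show False using x True \<rho> by auto
        qed
        then show ?thesis using True by (auto simp: indicator_def intro!: ennreal_leI power_mono)
      qed (auto simp: indicator_def)
    qed
    also have "\<dots> < \<infinity>" using x by (simp add: nn_integral_cmult_indicator ennreal_mult_less_top)
    finally show ?thesis .
  qed
  have "(\<integral>\<^sup>+ r\<in>{0<..1}. ennreal (r ^ d) \<partial>n) < \<infinity>"
  proof -
    have "(\<integral>\<^sup>+ r\<in>{0<..1}. ennreal (r ^ d) \<partial>n) = (\<integral>\<^sup>+ \<eta>\<in>{0..}. ennreal (\<eta> ^ (d - 1)) * (ennreal (\<phi> \<eta> ^ d) * indicator {0<..1} (\<phi> \<eta>)) \<partial>lborel)"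
      by (intro n) auto
    also have "\<dots> \<le> (\<integral>\<^sup>+ \<eta>\<in>{0..}. ennreal (\<eta> ^ (d - 1) * \<phi> \<eta> ^ d) \<partial>lborel)"
      by (intro nn_integral_mono) (auto simp: indicator_def ennreal_mult')
    also have "\<dots> < \<infinity>" using I by (simp add: d_def)
    finally show ?thesis .
  qed
  then show ?thesis using ns inf fin by (auto simp: Rcal_d_def Rcal_def d_def)
qed

lemma describable:
  assumes U: "U \<noteq> {}"
    and I: "(\<integral>\<^sup>+ \<eta>\<in>{0..}. ennreal (\<eta> ^ (DIM('a) - 1) * \<phi> \<eta> ^ DIM('a)) \<partial>lborel) < \<infinity>"
    and ns: "sets n = sets borel" "emeasure n (- {0<..1}) = 0"
    and n: "\<forall>f \<in> borel_measurable borel. (\<forall>r. r \<notin> {0<..1} \<longrightarrow> f r = 0) \<longrightarrow>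
               (\<integral>\<^sup>+ r. f r \<partial>n) = (\<integral>\<^sup>+ \<eta>\<in>{0..}. ennreal (\<eta> ^ (DIM('a) - 1)) * f (\<phi> \<eta>) \<partial>lborel)"
  shows "n_describable nrm n F U"
proof -
  obtain M where M: "2 \<le> M" and exact: "\<And>g \<epsilon> Q N. dgauge_on DIM('a) \<epsilon> g \<Longrightarrow> divergent M \<epsilon> g \<Longrightarrow> unbounded g \<Longrightarrow>
     dyadic_cube Q \<Longrightarrow> Q \<subseteq> U \<Longrightarrow> dm Q \<le> \<epsilon> \<Longrightarrow> finite N \<Longrightarrow> \<exists>K. subcubes N Q K \<and> heavy g 1 Q K"
    by (rule heavy_subcubes_exact) blast
  have vol: "summable (\<lambda>k. (M ^ k) ^ DIM('a) * \<phi> (M ^ k) ^ DIM('a))" using volume_integral_finite_iff[OF M] I by simp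
  then have van: vanishing using summable_vanishing[OF M] by blast
  have van': "\<And>c. 0 < c \<Longrightarrow> \<exists>x0\<ge>0. \<phi> x0 \<le> c" using van by (simp add: vanishing_def)
  note Minf_F = Minf_F_Int_divergent[OF M exact van]
  have Gn_iff: "g \<in> Gn DIM('a) n \<longleftrightarrow> divergent M \<epsilon> G" if "g \<in> Ginf DIM('a)" "represents DIM('a) g \<epsilon> G" for g \<epsilon> G
    using measure_integral_finite_iff[OF M van that(2) n] that(1) by (auto simp: Gn_def less_top[symmetric])
  have rep: "\<exists>\<epsilon> G. represents DIM('a) g \<epsilon> G" if "g \<in> Ginf DIM('a)" for g
  proof -
    have "gauge g" "0 < ell DIM('a) g" using that by (auto simp: Ginf_def)
    then show ?thesis by (rule gauge_represents) blast
  qed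
  have null: "null_for G (F \<inter> U)" if "dgauge_on DIM('a) \<epsilon> G" "\<not> divergent M \<epsilon> G" for \<epsilon> G
    using null_for_F[OF van' that(1) M] that(2) by (simp add: divergent_def)
  have minor: "F \<in> large_int_class nrm g U" if g: "g \<in> Gn DIM('a) n" for g
  proof -
    have gi: "g \<in> Ginf DIM('a)" using g by (simp add: Gn_def)
    obtain \<epsilon> G where r: "represents DIM('a) g \<epsilon> G" using rep[OF gi] by blast
    have div: "divergent M \<epsilon> G" using Gn_iff[OF gi r] g by simp
    \<comment> \<open>h dominates the normalization of g near 0, so its own series diverges and the
      content argument applies to h directly.\<close>
    have "Minf nrm h (F \<inter> V) = Minf nrm h V"
      if h: "gauge h" "d_normalized DIM('a) h" "gprec h (dnorm DIM('a) g)" and V: "open V" "V \<subseteq> U" for h V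
    proof -
      obtain \<delta> G' where G': "0 < \<delta>" "\<delta> \<le> \<epsilon>" "dgauge_on DIM('a) \<delta> G'" "h 0 = 0" "\<And>r. 0 < r \<Longrightarrow> r \<le> \<delta> \<Longrightarrow> h (ennreal r) = ennreal (G' r)"
        "\<And>r. 0 < r \<Longrightarrow> r \<le> \<delta> \<Longrightarrow> G r \<le> G' r" "\<And>B. \<exists>\<delta>>0. \<forall>x. 0 < x \<longrightarrow> x \<le> \<delta> \<longrightarrow> B \<le> G' x / x ^ DIM('a)"
        by (rule gprec_represents[OF gi r h]) (rule that)
      have e: "0 < \<epsilon>" "dgauge_on DIM('a) \<epsilon> G" using representsD(1)[OF r] dgauge_onD(1) by auto
      have "divergent M \<delta> G" using divergent_radius[OF van M e(1) G'(1)] div by blast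
      then have "divergent M \<delta> G'" using dgauge_on_subset[OF e(2) G'(1,2)] M G'(6) by (rule divergent_mono)
      moreover have "unbounded G'" unfolding unbounded_def using G'(7) by blast
      ultimately show ?thesis using G'(3,4,5) V by (intro Minf_F) auto
    qed
    then show ?thesis using gdelta_F by (auto simp: large_int_class_def)
  qed
  have major: "hausdorff_g nrm g (F \<inter> U) = 0 \<longleftrightarrow> g \<notin> Gn DIM('a) n" if g: "g \<in> Ginf DIM('a)" for g
  proof -
    obtain \<epsilon> G where r: "represents DIM('a) g \<epsilon> G" using rep[OF g] by blast
    note rD = representsD[OF r]
    have rd: "represents DIM('a) (dnorm DIM('a) g) \<epsilon> G" by (rule represents_dnorm[OF r])
    \<comment> \<open>The normalization of g is taken as the content gauge: a Hausdorff null set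
      would have zero content, but divergence makes the content equal to the positive one of
      U.\<close>
    have "False" if z: "hausdorff_g nrm g (F \<inter> U) = 0" and G: "g \<in> Gn DIM('a) n"
    proof -
      have "null_for G (F \<inter> U)" using r z by (rule hausdorff_g_null_imp_null_for)
      then have "Minf nrm (dnorm DIM('a) g) (F \<inter> U) = 0" using rD(2) by (intro Minf_null[OF rd]) auto
      moreover have "unbounded G" unfolding unbounded_def using represents_unbounded[OF r] g by (simp add: Ginf_def)
      then have "Minf nrm (dnorm DIM('a) g) (F \<inter> U) = Minf nrm (dnorm DIM('a) g) U"
        using rD(1,2) Gn_iff[OF g r] G open_U by (intro Minf_F[where \<epsilon> = \<epsilon> and G = G]) auto
      moreover have "0 < Minf nrm (dnorm DIM('a) g) U" using U rD(1,2) by (intro Minf_U_pos) auto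
      ultimately show False by simp
    qed
    moreover have "hausdorff_g nrm g (F \<inter> U) = 0" if "g \<notin> Gn DIM('a) n"
      using g null[OF rD(1)] Gn_iff[OF g r] that by (intro hausdorff_g_null[OF r]) (auto simp: Ginf_def gauge_def)
    ultimately show ?thesis by blast
  qed
  have minor': "g \<in> Gn DIM('a) n" if g: "g \<in> Ginf DIM('a)" and F': "F' \<in> large_int_class nrm g U" "F' \<subseteq> F" for g F'
  proof (rule ccontr)
    assume ng: "g \<notin> Gn DIM('a) n"
    obtain \<epsilon> G where r: "represents DIM('a) g \<epsilon> G" using rep[OF g] by blast
    note rD = representsD[OF r]
    have e: "0 < \<epsilon>" using dgauge_onD(1)[OF rD(1)] .
    have "summable (\<lambda>k. (M ^ k) ^ DIM('a) * G (min (\<phi> (M ^ k)) \<epsilon>))" using Gn_iff[OF g r] ng by (simp add: divergent_def)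
    \<comment> \<open>G'/G tends to infinity monotonically, so the gauge built from G' is one of
      those tested by the class of g, yet its series still converges.\<close>
    then obtain G' where G': "dgauge_on DIM('a) \<epsilon> G'" "summable (\<lambda>k. (M ^ k) ^ DIM('a) * G' (min (\<phi> (M ^ k)) \<epsilon>))"
      "\<And>x y. 0 < x \<Longrightarrow> x \<le> y \<Longrightarrow> y \<le> \<epsilon> \<Longrightarrow> G' y / G y \<le> G' x / G x"
      "\<And>B. \<exists>\<delta>>0. \<forall>x. 0 < x \<longrightarrow> x \<le> \<delta> \<longrightarrow> x \<le> \<epsilon> \<longrightarrow> B \<le> G' x / G x"
      "\<And>c. 0 < c \<Longrightarrow> \<exists>\<delta>>0. \<forall>x. 0 < x \<longrightarrow> x \<le> \<delta> \<longrightarrow> x \<le> \<epsilon> \<longrightarrow> G' x \<le> c"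
    proof (rule convergent_boost[OF rD(1), of "\<lambda>k. (M ^ k) ^ DIM('a)" "\<lambda>k. min (\<phi> (M ^ k)) \<epsilon>", rotated 3])
      show "0 < min (\<phi> (M ^ k)) \<epsilon>" for k using \<phi>_pos[of "M ^ k"] M e by simp
      show "\<exists>\<delta>>0. \<forall>x. 0 < x \<longrightarrow> x \<le> \<delta> \<longrightarrow> x \<le> \<epsilon> \<longrightarrow> G x \<le> c" if "0 < c" for c using represents_lim[OF r that] .
    qed (use M in auto)
    obtain h where h: "gauge h" "d_normalized DIM('a) h" "gprec h (dnorm DIM('a) g)" "h 0 = 0"
      "\<And>r. 0 < r \<Longrightarrow> r \<le> \<epsilon> \<Longrightarrow> h (ennreal r) = ennreal (G' r)" "represents DIM('a) h \<epsilon> G'"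
      by (rule boosted_gauge[OF r G'(1,3,4,5)]; (assumption | (rule that, assumption+)))
    have "Minf nrm h (F' \<inter> U) = Minf nrm h U"
      using F'(1) h(1,2,3) open_U unfolding large_int_class_def by blast
    moreover have "Minf nrm h (F' \<inter> U) \<le> Minf nrm h (F \<inter> U)" using F'(2) by (intro Minf_mono) auto
    moreover have "Minf nrm h (F \<inter> U) = 0"
      using null[OF G'(1)] G'(2) h(4,5) by (intro Minf_null[OF h(6)]) (auto simp: divergent_def)
    moreover have "0 < Minf nrm h U" using U h(4,5) G'(1) by (intro Minf_U_pos) auto
    ultimately show False by simp
  qed
  have "F \<in> nullsets_in U"
  proof -
    \<comment> \<open>Lebesgue nullity is the natural-cover bound for the gauge r^d, with the finite
      volume integral as the convergent series.\<close>
    have "dgauge_on DIM('a) 1 (\<lambda>r. r ^ DIM('a))" by (auto simp: dgauge_on_def power_mono)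
    moreover have "\<not> divergent M 1 (\<lambda>r. r ^ DIM('a))"
      unfolding divergent_def not_not
    proof (rule summable_comparison_test'[OF vol, of 0])
      fix k
      have "0 < \<phi> (M ^ k)" using M by (intro \<phi>_pos) simp
      then show "norm ((M ^ k) ^ DIM('a) * min (\<phi> (M ^ k)) 1 ^ DIM('a)) \<le> (M ^ k) ^ DIM('a) * \<phi> (M ^ k) ^ DIM('a)"
        using M by (auto simp: abs_mult power_abs intro!: mult_left_mono power_mono)
    qed
    ultimately have "null_for (\<lambda>r. r ^ DIM('a)) (F \<inter> U)" by (rule null)
    then have "emeasure lborel (F \<inter> U) = 0" using F_borel open_U by (intro lebesgue_null) auto
    then show ?thesis using F_borel open_U by (simp add: nullsets_in_def)
  qed
  moreover have "n \<in> Rcal_d DIM('a)" using measure_in_Rcal_d[OF M van I ns n] .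
  moreover have "majorizing nrm F U = Ginf DIM('a) - Gn DIM('a) n"
    using major by (auto simp: majorizing_def)
  moreover have "minorizing nrm F U \<inter> Ginf DIM('a) = Gn DIM('a) n"
  proof
    show "minorizing nrm F U \<inter> Ginf DIM('a) \<subseteq> Gn DIM('a) n" using minor' by (auto simp: minorizing_def)
    have "Gn DIM('a) n \<subseteq> Ginf DIM('a)" by (auto simp: Gn_def)
    moreover have "Ginf DIM('a) \<subseteq> Gstar DIM('a)" by (auto simp: Ginf_def Gstar_def)
    ultimately show "Gn DIM('a) n \<subseteq> minorizing nrm F U \<inter> Ginf DIM('a)" using minor by (auto simp: minorizing_def)
  qed
  ultimately show ?thesis by (simp add: n_describable_def)
qed

end

end

theorem theorem9p5:
  fixes nrm :: "'a::euclidean_space \<Rightarrow> real"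
    and U A :: "'a set" and H :: "'a \<Rightarrow> real" and \<phi> :: "real \<Rightarrow> real"
  assumes "is_norm nrm"
    and "open U" and "U \<noteq> {}"
    and "optimal_regular_system nrm A H U"
    and "\<forall>x\<ge>0. \<phi> x > 0" and "antimono_on {0..} \<phi>" and "continuous_on {0..} \<phi>"
  defines "F \<equiv> {x. infinite {a\<in>A. nrm (x - a) < \<phi> (H a)}}"
    and "I \<equiv> (\<integral>\<^sup>+ \<eta>\<in>{0..}. ennreal (\<eta> ^ (DIM('a) - 1) * \<phi> \<eta> ^ DIM('a)) \<partial>lborel)"
  shows "(I = \<infinity> \<longrightarrow> emeasure lebesgue (U - F) = 0) \<and>
         (I < \<infinity> \<longrightarrow> (\<forall>n::real measure.
            sets n = sets borel \<and> emeasure n (- {0<..1}) = 0 \<and>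
            (\<forall>f \<in> borel_measurable borel. (\<forall>r. r \<notin> {0<..1} \<longrightarrow> f r = 0) \<longrightarrow>
               (\<integral>\<^sup>+ r. f r \<partial>n) = (\<integral>\<^sup>+ \<eta>\<in>{0..}. ennreal (\<eta> ^ (DIM('a) - 1)) * f (\<phi> \<eta>) \<partial>lborel))
            \<longrightarrow> n_describable nrm n F U))"
proof -
  interpret optimal_regular_approximation nrm U A H \<phi>
    using assms(1-6) by unfold_locales (auto simp: optimal_regular_system_def)
  have F: "local.F = F" unfolding assms(8) by (simp add: local.F_def)
  show ?thesis
  proof (intro conjI impI allI)
    assume "I = \<infinity>"
    then have "emeasure lborel (U - local.F) = 0"
      unfolding I_def by (intro full_measure infinite_volume_divergent[OF assms(7)])
    then show "emeasure lebesgue (U - F) = 0" using F F_borel assms(2) by simp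
  next
    fix n :: "real measure"
    assume "I < \<infinity>" and "sets n = sets borel \<and> emeasure n (- {0<..1}) = 0 \<and>
            (\<forall>f \<in> borel_measurable borel. (\<forall>r. r \<notin> {0<..1} \<longrightarrow> f r = 0) \<longrightarrow>
               (\<integral>\<^sup>+ r. f r \<partial>n) = (\<integral>\<^sup>+ \<eta>\<in>{0..}. ennreal (\<eta> ^ (DIM('a) - 1)) * f (\<phi> \<eta>) \<partial>lborel))"
    then have "n_describable nrm n local.F U"
      unfolding I_def by (elim conjE) (rule describable[OF assms(7,3)])
    then show "n_describable nrm n F U" by (simp add: F)
  qed
qed

end
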